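(* Let $M$ be a 3-dimensional oriented Riemannian manifold with a fixed spin structure, let $m\ge 0$ be an integer, and let $\nabla^{\ast}\nabla$ be the connection Laplacian on $\mathbf{S}_m$. Then the higher spin Dirac operators satisfy the following identities on $\Gamma(M,\mathbf{S}_m)$: $$D_m^0D_m^0+D_{m-2}^+D_m^-=m^2\nabla^{\ast}\nabla+\frac{m}{2}R_m^0,$$ $$D_m^0D_m^0+D_{m+2}^-D_m^+=(m+2)^2\nabla^{\ast}\nabla-\frac{m+2}{2}R_m^0,$$ $$D_{m+2}^0D_m^+-D_{m}^+D_m^0=\frac{m+2}{2}R_m^+,$$ $$D_{m-2}^0D_m^--D_{m}^-D_m^0=-\frac{m}{2}R_m^-.$$
   Context: Representations: for an integer $m\ge 0$, $V_m$ is the complex vector space of polynomials of degree $\le m$ in one variable $z_m$, with the Hermitian inner product for which $(z_m^k,z_m^l)=k!(m-k)!\,\delta_{kl}$. $SU(2)$ acts unitarily and irreducibly by $\rho_m(h)z_m^k=(bz_m+d)^{m-k}(az_m+c)^k$ for $h=\begin{pmatrix}a&b\\c&d\end{pmatrix}$. Put $V_{-1}=V_{-2}=0$ (all maps into or out of these are $0$). $\mathbf{R}^3$ (standard basis $e_1,e_2,e_3$, standard inner product) is identified with $\mathfrak{su}(2)$ by $e_i\leftrightarrow\sigma_i$, where $\sigma_1=\begin{pmatrix}i&0\\0&-i\end{pmatrix}$, $\sigma_2=\begin{pmatrix}0&1\\-1&0\end{pmatrix}$, $\sigma_3=\begin{pmatrix}0&i\\i&0\end{pmatrix}$. Clifford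 homomorphisms: for $X\in\mathbf{R}^3$ the maps $\rho_m^0(X):V_m\to V_m$ and $\rho_m^{\pm}(X):V_m\to V_{m\pm2}$ are linear in $X$ and (after complex-linear extension in $X$) given by $\rho_m^0(\frac{e_1}{2})z_m^k=i(k-\frac m2)z_m^k$, $\rho_m^0(\frac{e_2}{2}+i\frac{e_3}{2})z_m^k=-kz_m^{k-1}$, $\rho_m^0(\frac{e_2}{2}-i\frac{e_3}{2})z_m^k=(m-k)z_m^{k+1}$; $\rho_m^+(\frac{e_1}{2})z_m^k=iz_{m+2}^{k+1}$, $\rho_m^+(\frac{e_2}{2}+i\frac{e_3}{2})z_m^k=-z_{m+2}^k$, $\rho_m^+(\frac{e_2}{2}-i\frac{e_3}{2})z_m^k=-z_{m+2}^{k+2}$; $\rho_m^-(\frac{e_1}{2})z_m^k=ik(m-k)z_{m-2}^{k-1}$, $\rho_m^-(\frac{e_2}{2}+i\frac{e_3}{2})z_m^k=k(k-1)z_{m-2}^{k-2}$, $\rho_m^-(\frac{e_2}{2}-i\frac{e_3}{2})z_m^k=(m-k)(m-k-1)z_{m-2}^k$. Bundles: $\mathbf{Spin}(M)$ is the principal $Spin(3)=SU(2)$ bundle, $\mathbf{S}_m=\mathbf{Spin}(M)\times_{\rho_m}V_m$ with the induced Hermitian metric ($\mathbf{S}_{-1}=\mathbf{S}_{-2}=0$), and $T(M)=\mathbf{Spin}(M)\times_{\mathrm{Ad}}\mathbf{R}^3$. The Clifford homomorphisms are $SU(2)$-equivariant, so they induce bundle maps $\rho_m^0(X)\in\mathrm{End}(\mathbf{S}_m)$,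 $\rho_m^\pm(X)\in\mathrm{Hom}(\mathbf{S}_m,\mathbf{S}_{m\pm2})$ for tangent vectors $X$: $\rho([p,e_i])[p,v]=[p,\rho(e_i)v]$. $\nabla$ is the covariant derivative on $\mathbf{S}_m$ induced by the Levi-Civita (spin) connection. Higher spin Dirac operators: for a local positively oriented orthonormal frame $\{e_i\}$ of $T(M)$, $D_m^0=\sum_{i=1}^3\rho_m^0(e_i)\nabla_{e_i}:\Gamma(M,\mathbf{S}_m)\to\Gamma(M,\mathbf{S}_m)$ and $D_m^\pm=\sum_{i=1}^3\rho_m^\pm(e_i)\nabla_{e_i}:\Gamma(M,\mathbf{S}_m)\to\Gamma(M,\mathbf{S}_{m\pm2})$. Curvature: $R_m(X,Y)=\nabla_X\nabla_Y-\nabla_Y\nabla_X-\nabla_{[X,Y]}$ on $\mathbf{S}_m$, and $R_m^0=\sum_{\sigma\in S_3}\mathrm{sgn}(\sigma)\rho_m^0(e_{\sigma(1)})R_m(e_{\sigma(2)},e_{\sigma(3)})$, $R_m^\pm=\sum_{\sigma\in S_3}\mathrm{sgn}(\sigma)\rho_m^\pm(e_{\sigma(1)})R_m(e_{\sigma(2)},e_{\sigma(3)})$. *)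

theory Defs
  imports "HOL-Analysis.Analysis"
begin

section \<open>Smooth functions on open subsets of normed spaces\<close>

primrec Ck :: "nat \<Rightarrow> 'a::real_normed_vector set \<Rightarrow> ('a \<Rightarrow> 'b::real_normed_vector) \<Rightarrow> bool" where
  "Ck 0 S f \<longleftrightarrow> continuous_on S f"
| "Ck (Suc n) S f \<longleftrightarrow>
     (\<forall>x\<in>S. f differentiable (at x)) \<and> (\<forall>v. Ck n S (\<lambda>x. frechet_derivative f (at x) v))"

text \<open>Only used for open \<open>S\<close> in a finite-dimensional space, where having continuous iterated
  directional derivatives of all orders means being \<open>C\<close>-infinity.\<close>

definition smooth_on :: "'a::real_normed_vector set \<Rightarrow> ('a \<Rightarrow> 'b::real_normed_vector) \<Rightarrow> bool" where
  "smooth_on S f \<longleftrightarrow> (\<forall>n. Ck n S f)"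


section \<open>Oriented Riemannian 3-manifolds\<close>

type_synonym 'a chart = "'a set \<times> ('a \<Rightarrow> real^3)"

text \<open>A tangent vector is encoded by its coordinates in all charts of the atlas: it assigns
  a vector of \<open>R^3\<close> to each chart around its foot point, compatibly with the Jacobians of the
  coordinate changes, and (as a normalisation) zero to everything else.\<close>

type_synonym 'a tvec = "'a chart \<Rightarrow> real^3"

type_synonym 'a vfield = "'a \<Rightarrow> 'a tvec"

text \<open>\<open>lc x v Y\<close> is the covariant derivative at \<open>x\<close> of the local vector field \<open>Y\<close>
  in direction \<open>v\<close>.\<close>

record 'a riem3 =
  base :: "'a topology"
  atlas :: "'a chart set"
  metric :: "'a \<Rightarrow> 'a tvec \<Rightarrow> 'a tvec \<Rightarrow> real"
  lc :: "'a \<Rightarrow> 'a tvec \<Rightarrow> 'a vfield \<Rightarrow> 'a tvec"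

definition chart_change :: "'a chart \<Rightarrow> 'a chart \<Rightarrow> real^3 \<Rightarrow> real^3" where
  "chart_change c d = snd d \<circ> inv_into (fst c) (snd c)"

definition oriented_manifold3 :: "('a, 'z) riem3_scheme \<Rightarrow> bool" where
  "oriented_manifold3 M \<longleftrightarrow>
     Hausdorff_space (base M) \<and> second_countable (base M) \<and>
     (\<Union>c\<in>atlas M. fst c) = topspace (base M) \<and>
     (\<forall>c\<in>atlas M. openin (base M) (fst c) \<and> open (snd c ` fst c) \<and>
        homeomorphic_map (subtopology (base M) (fst c)) (top_of_set (snd c ` fst c)) (snd c)) \<and>
     (\<forall>c\<in>atlas M. \<forall>d\<in>atlas M.
        smooth_on (snd c ` (fst c \<inter> fst d)) (chart_change c d) \<and>
        (\<forall>x\<in>fst c \<inter> fst d.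
           det (matrix (frechet_derivative (chart_change c d) (at (snd c x)))) > 0))"

definition chart_at :: "('a, 'z) riem3_scheme \<Rightarrow> 'a \<Rightarrow> 'a chart \<Rightarrow> bool" where
  "chart_at M x c \<longleftrightarrow> c \<in> atlas M \<and> x \<in> fst c"

definition smooth_fun :: "('a, 'z) riem3_scheme \<Rightarrow> 'a set \<Rightarrow> ('a \<Rightarrow> 'b::real_normed_vector) \<Rightarrow> bool" where
  "smooth_fun M U f \<longleftrightarrow>
     (\<forall>c\<in>atlas M. smooth_on (snd c ` (U \<inter> fst c)) (f \<circ> inv_into (fst c) (snd c)))"

definition tangent :: "('a, 'z) riem3_scheme \<Rightarrow> 'a \<Rightarrow> 'a tvec set" where
  "tangent M x = {v.
     (\<forall>c. \<not> chart_at M x c \<longrightarrow> v c = 0) \<and>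
     (\<forall>c d. chart_at M x c \<longrightarrow> chart_at M x d \<longrightarrow>
        v d = frechet_derivative (chart_change c d) (at (snd c x)) (v c))}"

definition ddir :: "('a, 'z) riem3_scheme \<Rightarrow> 'a \<Rightarrow> 'a tvec \<Rightarrow> ('a \<Rightarrow> 'b::real_normed_vector) \<Rightarrow> 'b" where
  "ddir M x v f =
     (let c = (SOME c. chart_at M x c)
      in frechet_derivative (f \<circ> inv_into (fst c) (snd c)) (at (snd c x)) (v c))"

definition smooth_vfield :: "('a, 'z) riem3_scheme \<Rightarrow> 'a set \<Rightarrow> 'a vfield \<Rightarrow> bool" where
  "smooth_vfield M U X \<longleftrightarrow>
     (\<forall>x\<in>U. X x \<in> tangent M x) \<and> (\<forall>c\<in>atlas M. smooth_fun M (U \<inter> fst c) (\<lambda>x. X x c))"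

definition lie_bracket :: "('a, 'z) riem3_scheme \<Rightarrow> 'a vfield \<Rightarrow> 'a vfield \<Rightarrow> 'a vfield" where
  "lie_bracket M X Y x = (\<lambda>c.
     if chart_at M x c then ddir M x (X x) (\<lambda>y. Y y c) - ddir M x (Y x) (\<lambda>y. X y c) else 0)"

definition tlin :: "real \<Rightarrow> 'a tvec \<Rightarrow> real \<Rightarrow> 'a tvec \<Rightarrow> 'a tvec" where
  "tlin a v b w = (\<lambda>c. a *\<^sub>R v c + b *\<^sub>R w c)"

definition riemannian_metric :: "('a, 'z) riem3_scheme \<Rightarrow> bool" where
  "riemannian_metric M \<longleftrightarrow>
     (\<forall>x\<in>topspace (base M).
        (\<forall>v\<in>tangent M x. \<forall>w\<in>tangent M x. metric M x v w = metric M x w v) \<and>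
        (\<forall>u\<in>tangent M x. \<forall>v\<in>tangent M x. \<forall>w\<in>tangent M x. \<forall>a b.
           metric M x (tlin a u b v) w = a * metric M x u w + b * metric M x v w) \<and>
        (\<forall>v\<in>tangent M x. v \<noteq> (\<lambda>c. 0) \<longrightarrow> metric M x v v > 0)) \<and>
     (\<forall>U X Y. openin (base M) U \<and> smooth_vfield M U X \<and> smooth_vfield M U Y \<longrightarrow>
        smooth_fun M U (\<lambda>x. metric M x (X x) (Y x)))"

text \<open>A covariant derivative acts on smooth vector fields defined on open sets; the fourth
  clause below says that it only depends on the germ of the differentiated field.\<close>

definition affine_connection :: "('a, 'z) riem3_scheme \<Rightarrow> bool" where
  "affine_connection M \<longleftrightarrow>
     (\<forall>U Y. openin (base M) U \<and> smooth_vfield M U Y \<longrightarrow>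
        (\<forall>x\<in>U. \<forall>v\<in>tangent M x. lc M x v Y \<in> tangent M x \<and>
           (\<forall>w\<in>tangent M x. \<forall>a b.
              lc M x (tlin a v b w) Y = tlin a (lc M x v Y) b (lc M x w Y)) \<and>
           (\<forall>Z. smooth_vfield M U Z \<longrightarrow>
              lc M x v (\<lambda>y. tlin 1 (Y y) 1 (Z y)) = tlin 1 (lc M x v Y) 1 (lc M x v Z)) \<and>
           (\<forall>Z. smooth_vfield M U Z \<and> (\<forall>y\<in>U. Y y = Z y) \<longrightarrow> lc M x v Y = lc M x v Z) \<and>
           (\<forall>f :: 'a \<Rightarrow> real. smooth_fun M U f \<longrightarrow>
              lc M x v (\<lambda>y c. f y *\<^sub>R Y y c) = tlin (ddir M x v f) (Y x) (f x) (lc M x v Y)))) \<and>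
     (\<forall>U X Y. openin (base M) U \<and> smooth_vfield M U X \<and> smooth_vfield M U Y \<longrightarrow>
        smooth_vfield M U (\<lambda>x. lc M x (X x) Y))"

definition levi_civita :: "('a, 'z) riem3_scheme \<Rightarrow> bool" where
  "levi_civita M \<longleftrightarrow> affine_connection M \<and>
     (\<forall>U Y Z. openin (base M) U \<and> smooth_vfield M U Y \<and> smooth_vfield M U Z \<longrightarrow>
        (\<forall>x\<in>U. \<forall>v\<in>tangent M x.
           ddir M x v (\<lambda>y. metric M y (Y y) (Z y)) =
             metric M x (lc M x v Y) (Z x) + metric M x (Y x) (lc M x v Z))) \<and>
     (\<forall>U X Y. openin (base M) U \<and> smooth_vfield M U X \<and> smooth_vfield M U Y \<longrightarrow>
        (\<forall>x\<in>U. tlin 1 (lc M x (X x) Y) (-1) (lc M x (Y x) X) = lie_bracket M X Y x))"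

definition oriented_onb :: "('a, 'z) riem3_scheme \<Rightarrow> 'a \<Rightarrow> (3 \<Rightarrow> 'a tvec) \<Rightarrow> bool" where
  "oriented_onb M x e \<longleftrightarrow>
     (\<forall>i. e i \<in> tangent M x) \<and>
     (\<forall>i j. metric M x (e i) (e j) = (if i = j then 1 else 0)) \<and>
     (\<forall>c. chart_at M x c \<longrightarrow> det (\<chi> i. e i c) > 0)"

definition local_onframe :: "('a, 'z) riem3_scheme \<Rightarrow> 'a set \<Rightarrow> (3 \<Rightarrow> 'a vfield) \<Rightarrow> bool" where
  "local_onframe M U e \<longleftrightarrow> openin (base M) U \<and>
     (\<forall>i. smooth_vfield M U (e i)) \<and> (\<forall>y\<in>U. oriented_onb M y (\<lambda>i. e i y))"

text \<open>An arbitrary choice of a local oriented orthonormal frame around \<open>x\<close>; the operators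
  defined with it below do not depend on the choice.\<close>

definition frame_near :: "('a, 'z) riem3_scheme \<Rightarrow> 'a \<Rightarrow> 3 \<Rightarrow> 'a vfield" where
  "frame_near M x = (SOME e. \<exists>U. x \<in> U \<and> local_onframe M U e)"

definition tcomb :: "(3 \<Rightarrow> 'a tvec) \<Rightarrow> real^3 \<Rightarrow> 'a tvec" where
  "tcomb e \<xi> = (\<lambda>c. \<Sum>i\<in>UNIV. \<xi> $ i *\<^sub>R e i c)"


section \<open>The group \<open>SU(2)\<close> and its Lie algebra\<close>

definition adj :: "complex^2^2 \<Rightarrow> complex^2^2" where
  "adj h = (\<chi> i j. cnj (h $ j $ i))"

definition SU2 :: "(complex^2^2) set" where
  "SU2 = {h. h ** adj h = mat 1 \<and> det h = 1}"

definition sigma1 :: "complex^2^2" where "sigma1 = vector [vector [\<i>, 0], vector [0, -\<i>]]"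
definition sigma2 :: "complex^2^2" where "sigma2 = vector [vector [0, 1], vector [-1, 0]]"
definition sigma3 :: "complex^2^2" where "sigma3 = vector [vector [0, \<i>], vector [\<i>, 0]]"

definition su2_of :: "real^3 \<Rightarrow> complex^2^2" where
  "su2_of \<xi> = \<xi> $ 1 *\<^sub>R sigma1 + \<xi> $ 2 *\<^sub>R sigma2 + \<xi> $ 3 *\<^sub>R sigma3"

text \<open>\<open>su2_of\<close> is injective with range \<open>su(2)\<close>, so \<open>inv su2_of\<close> transports the
  adjoint actions of the group and of the Lie algebra from \<open>su(2)\<close> to \<open>R^3\<close>.\<close>

definition Ad :: "complex^2^2 \<Rightarrow> real^3 \<Rightarrow> real^3" where
  "Ad h \<xi> = inv su2_of (h ** su2_of \<xi> ** adj h)"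

definition ad :: "real^3 \<Rightarrow> real^3 \<Rightarrow> real^3" where
  "ad \<zeta> \<xi> = inv su2_of (su2_of \<zeta> ** su2_of \<xi> - su2_of \<xi> ** su2_of \<zeta>)"


section \<open>The representations and the Clifford homomorphisms\<close>

text \<open>The index \<open>m\<close> is an integer so that \<open>V_space (-1)\<close> and \<open>V_space (-2)\<close> make sense; these are
  \<open>{0}\<close>, on which all maps below vanish.\<close>

definition V_space :: "int \<Rightarrow> complex poly set" where
  "V_space m = {p. p = 0 \<or> int (degree p) \<le> m}"

text \<open>Linear extension of a map given on the monomials \<open>z^k\<close>, \<open>k \<le> m\<close>.\<close>

definition on_monomials :: "int \<Rightarrow> (nat \<Rightarrow> complex poly) \<Rightarrow> complex poly \<Rightarrow> complex poly" where
  "on_monomials m F p = (\<Sum>k\<le>nat m. smult (coeff p k) (F k))"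

definition rep :: "int \<Rightarrow> complex^2^2 \<Rightarrow> complex poly \<Rightarrow> complex poly" where
  "rep m h = on_monomials m
     (\<lambda>k. [: h $ 2 $ 2, h $ 1 $ 2 :] ^ (nat m - k) * [: h $ 2 $ 1, h $ 1 $ 1 :] ^ k)"

text \<open>The differential of \<open>rep m\<close> at the identity. The formula for \<open>rep m\<close> is polynomial in
  the entries of an arbitrary matrix, so its derivative in a direction \<open>A\<close> of \<open>su(2)\<close>,
  which is tangent to \<open>SU(2)\<close>, may be taken along the straight line.\<close>

definition drep :: "int \<Rightarrow> complex^2^2 \<Rightarrow> complex poly \<Rightarrow> complex poly" where
  "drep m A p = (\<Sum>k\<le>nat m.
     monom (vector_derivative (\<lambda>t::real. coeff (rep m (mat 1 + t *\<^sub>R A) p) k) (at 0)) k)"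

text \<open>The maps \<open>A\<close>, \<open>B\<close>, \<open>C\<close> give the values at \<open>e1/2\<close>, \<open>e2/2 + i e3/2\<close>,
  \<open>e2/2 - i e3/2\<close>, in terms of which
  \<open>xi = 2 xi1 (e1/2) + (xi2 - i xi3) (e2/2 + i e3/2) + (xi2 + i xi3) (e2/2 - i e3/2)\<close>.\<close>

definition clifford ::
  "int \<Rightarrow> (nat \<Rightarrow> complex poly) \<Rightarrow> (nat \<Rightarrow> complex poly) \<Rightarrow> (nat \<Rightarrow> complex poly)
     \<Rightarrow> real^3 \<Rightarrow> complex poly \<Rightarrow> complex poly" where
  "clifford m A B C \<xi> = on_monomials m (\<lambda>k.
       smult (2 * of_real (\<xi> $ 1)) (A k)
     + smult (of_real (\<xi> $ 2) - \<i> * of_real (\<xi> $ 3)) (B k)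
     + smult (of_real (\<xi> $ 2) + \<i> * of_real (\<xi> $ 3)) (C k))"

text \<open>Truncated exponents such as \<open>k - 1\<close> at \<open>k = 0\<close> only occur with coefficient zero.\<close>

definition rho0 :: "int \<Rightarrow> real^3 \<Rightarrow> complex poly \<Rightarrow> complex poly" where
  "rho0 m = clifford m
     (\<lambda>k. monom (\<i> * (of_nat k - of_int m / 2)) k)
     (\<lambda>k. monom (- of_nat k) (k - 1))
     (\<lambda>k. monom (of_int m - of_nat k) (k + 1))"

definition rho_plus :: "int \<Rightarrow> real^3 \<Rightarrow> complex poly \<Rightarrow> complex poly" where
  "rho_plus m = clifford m
     (\<lambda>k. monom \<i> (k + 1))
     (\<lambda>k. monom (- 1) k)
     (\<lambda>k. monom (- 1) (k + 2))"

definition rho_minus :: "int \<Rightarrow> real^3 \<Rightarrow> complex poly \<Rightarrow> complex poly" where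
  "rho_minus m = clifford m
     (\<lambda>k. monom (\<i> * of_nat k * (of_int m - of_nat k)) (k - 1))
     (\<lambda>k. monom (of_nat k * (of_nat k - 1)) (k - 2))
     (\<lambda>k. monom ((of_int m - of_nat k) * (of_int m - of_nat k - 1)) k)"


section \<open>Spin structures\<close>

text \<open>The smooth structure of the total space of the principal \<open>SU(2)\<close>-bundle is given by a
  bundle atlas, i.e. by local sections (equivalently, local trivialisations) over an open cover
  whose transition functions are smooth. The bundle map to the oriented orthonormal frames sends
  \<open>p\<close> to the frame \<open>i \<mapsto> [p, e_i]\<close>.\<close>

record ('a, 'p) spin3 = "'a riem3" +
  spin_total :: "'p set"
  spin_proj :: "'p \<Rightarrow> 'a"
  spin_act :: "'p \<Rightarrow> complex^2^2 \<Rightarrow> 'p"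
  spin_atlas :: "('a set \<times> ('a \<Rightarrow> 'p)) set"
  spin_frame :: "'p \<Rightarrow> 3 \<Rightarrow> 'a tvec"

definition spin_fibre :: "('a, 'p) spin3 \<Rightarrow> 'a \<Rightarrow> 'p set" where
  "spin_fibre M x = {p \<in> spin_total M. spin_proj M p = x}"

definition spin_transition :: "('a, 'p) spin3 \<Rightarrow> ('a \<Rightarrow> 'p) \<Rightarrow> ('a \<Rightarrow> 'p) \<Rightarrow> 'a \<Rightarrow> complex^2^2" where
  "spin_transition M s t x = (THE h. h \<in> SU2 \<and> t x = spin_act M (s x) h)"

definition principal_SU2_bundle :: "('a, 'p) spin3 \<Rightarrow> bool" where
  "principal_SU2_bundle M \<longleftrightarrow>
     (\<forall>p\<in>spin_total M. spin_proj M p \<in> topspace (base M) \<and>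
        spin_act M p (mat 1) = p \<and>
        (\<forall>h\<in>SU2. spin_act M p h \<in> spin_fibre M (spin_proj M p) \<and>
           (\<forall>k\<in>SU2. spin_act M (spin_act M p h) k = spin_act M p (h ** k))) \<and>
        (\<forall>q\<in>spin_fibre M (spin_proj M p). \<exists>!h. h \<in> SU2 \<and> q = spin_act M p h)) \<and>
     (\<Union>(U, s)\<in>spin_atlas M. U) = topspace (base M) \<and>
     (\<forall>(U, s)\<in>spin_atlas M. openin (base M) U \<and> (\<forall>x\<in>U. s x \<in> spin_fibre M x)) \<and>
     (\<forall>(U, s)\<in>spin_atlas M. \<forall>(W, t)\<in>spin_atlas M.
        smooth_fun M (U \<inter> W) (spin_transition M s t))"

definition spin_structure :: "('a, 'p) spin3 \<Rightarrow> bool" where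
  "spin_structure M \<longleftrightarrow> principal_SU2_bundle M \<and>
     (\<forall>p\<in>spin_total M. oriented_onb M (spin_proj M p) (spin_frame M p) \<and>
        (\<forall>h\<in>SU2. \<forall>\<xi>. tcomb (spin_frame M (spin_act M p h)) \<xi> = tcomb (spin_frame M p) (Ad h \<xi>))) \<and>
     (\<forall>(U, s)\<in>spin_atlas M. \<forall>i. smooth_vfield M U (\<lambda>x. spin_frame M (s x) i))"

definition spin_section :: "('a, 'p) spin3 \<Rightarrow> 'a set \<Rightarrow> ('a \<Rightarrow> 'p) \<Rightarrow> bool" where
  "spin_section M U s \<longleftrightarrow> openin (base M) U \<and> (\<forall>x\<in>U. s x \<in> spin_fibre M x) \<and>
     (\<forall>(W, t)\<in>spin_atlas M. smooth_fun M (U \<inter> W) (spin_transition M t s))"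


section \<open>The associated bundles\<close>

text \<open>An element \<open>[p, v]\<close> is the equivalence class of \<open>(p, v)\<close> under
  \<open>(p, v) \<sim> (p h, h\<inverse> v)\<close>, where \<open>h\<inverse> = adj h\<close>. A class
  contains exactly one pair over each point of the fibre of the principal bundle, so fibrewise
  operations are computed pair by pair.\<close>

type_synonym 'p spinor = "('p \<times> complex poly) set"

definition spinor_class :: "('a, 'p) spin3 \<Rightarrow> int \<Rightarrow> 'p \<Rightarrow> complex poly \<Rightarrow> 'p spinor" where
  "spinor_class M m p v = {(spin_act M p h, rep m (adj h) v) | h. h \<in> SU2}"

definition spinor_fibre :: "('a, 'p) spin3 \<Rightarrow> int \<Rightarrow> 'a \<Rightarrow> 'p spinor set" where
  "spinor_fibre M m x = {spinor_class M m p v | p v. p \<in> spin_fibre M x \<and> v \<in> V_space m}"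

definition spinor_scale :: "complex \<Rightarrow> 'p spinor \<Rightarrow> 'p spinor" where
  "spinor_scale a A = {(p, smult a u) | p u. (p, u) \<in> A}"

definition spinor_add :: "'p spinor \<Rightarrow> 'p spinor \<Rightarrow> 'p spinor" where
  "spinor_add A B = {(p, u + w) | p u w. (p, u) \<in> A \<and> (p, w) \<in> B}"

definition spinor_diff :: "'p spinor \<Rightarrow> 'p spinor \<Rightarrow> 'p spinor" where
  "spinor_diff A B = spinor_add A (spinor_scale (- 1) B)"

definition spinor_sum :: "'i set \<Rightarrow> ('i \<Rightarrow> 'p spinor) \<Rightarrow> 'p spinor" where
  "spinor_sum I A = {(p, \<Sum>i\<in>I. u i) | p u. \<forall>i\<in>I. (p, u i) \<in> A i}"

text \<open>The bundle map induced by an equivariant map \<open>F\<close>: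
  \<open>F([p, \<xi>]) [p, u] = [p, F \<xi> u]\<close>.\<close>

definition bundle_map ::
  "('a, 'p) spin3 \<Rightarrow> (real^3 \<Rightarrow> complex poly \<Rightarrow> complex poly) \<Rightarrow> 'a tvec \<Rightarrow> 'p spinor \<Rightarrow> 'p spinor" where
  "bundle_map M F X A =
     {(p, F \<xi> u) | p u \<xi>. (p, u) \<in> A \<and> X = tcomb (spin_frame M p) \<xi>}"

text \<open>The function representing \<open>\<psi>\<close> with respect to a local section \<open>s\<close> of the principal
  bundle, i.e. \<open>\<psi> = [s, spinor_coord s \<psi>]\<close>.\<close>

definition spinor_coord :: "('a \<Rightarrow> 'p) \<Rightarrow> ('a \<Rightarrow> 'p spinor) \<Rightarrow> 'a \<Rightarrow> complex poly" where
  "spinor_coord s \<psi> x = (THE v. (s x, v) \<in> \<psi> x)"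

definition spinor_fields :: "('a, 'p) spin3 \<Rightarrow> int \<Rightarrow> ('a \<Rightarrow> 'p spinor) set" where
  "spinor_fields M m = {\<psi>.
     (\<forall>x\<in>topspace (base M). \<psi> x \<in> spinor_fibre M m x) \<and>
     (\<forall>U s. spin_section M U s \<longrightarrow> (\<forall>k. smooth_fun M U (\<lambda>x. coeff (spinor_coord s \<psi> x) k)))}"

text \<open>The Levi-Civita connection form lifted to the spin bundle and pulled back along \<open>s\<close>: its
  value on \<open>v\<close> is the element of \<open>su(2)\<close> (seen in \<open>R^3\<close>) whose adjoint action gives the
  covariant derivatives of the orthonormal frame induced by \<open>s\<close>.\<close>

definition spin_form :: "('a, 'p) spin3 \<Rightarrow> ('a \<Rightarrow> 'p) \<Rightarrow> 'a \<Rightarrow> 'a tvec \<Rightarrow> real^3" where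
  "spin_form M s x v = (THE \<zeta>. \<forall>j.
     lc M x v (\<lambda>y. spin_frame M (s y) j) = tcomb (spin_frame M (s x)) (ad \<zeta> (axis j 1)))"

text \<open>\<open>\<nabla>\<^sub>v [s, f] = [s, v f + drep (spin_form s v) f]\<close> at \<open>x\<close>, for all local sections
  \<open>s\<close> around \<open>x\<close>; the resulting pairs form one class because the right-hand side does not
  depend on \<open>s\<close>.\<close>

definition nabla :: "('a, 'p) spin3 \<Rightarrow> int \<Rightarrow> 'a tvec \<Rightarrow> ('a \<Rightarrow> 'p spinor) \<Rightarrow> 'a \<Rightarrow> 'p spinor" where
  "nabla M m v \<psi> x =
     {(s x, (\<Sum>k\<le>nat m. monom (ddir M x v (\<lambda>y. coeff (spinor_coord s \<psi> y) k)) k)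
            + drep m (su2_of (spin_form M s x v)) (spinor_coord s \<psi> x))
      | U s. spin_section M U s \<and> x \<in> U}"


section \<open>The operators\<close>

definition dirac ::
  "('a, 'p) spin3 \<Rightarrow> int \<Rightarrow> (real^3 \<Rightarrow> complex poly \<Rightarrow> complex poly)
     \<Rightarrow> ('a \<Rightarrow> 'p spinor) \<Rightarrow> 'a \<Rightarrow> 'p spinor" where
  "dirac M m F \<psi> x =
     (let e = frame_near M x
      in spinor_sum UNIV (\<lambda>i. bundle_map M F (e i x) (nabla M m (e i x) \<psi> x)))"

definition D0 :: "('a, 'p) spin3 \<Rightarrow> int \<Rightarrow> ('a \<Rightarrow> 'p spinor) \<Rightarrow> 'a \<Rightarrow> 'p spinor" where
  "D0 M m = dirac M m (rho0 m)"

definition D_plus :: "('a, 'p) spin3 \<Rightarrow> int \<Rightarrow> ('a \<Rightarrow> 'p spinor) \<Rightarrow> 'a \<Rightarrow> 'p spinor" where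
  "D_plus M m = dirac M m (rho_plus m)"

definition D_minus :: "('a, 'p) spin3 \<Rightarrow> int \<Rightarrow> ('a \<Rightarrow> 'p spinor) \<Rightarrow> 'a \<Rightarrow> 'p spinor" where
  "D_minus M m = dirac M m (rho_minus m)"

text \<open>The connection Laplacian is minus the trace of the second covariant derivative
  \<open>\<nabla>\<^sub>X \<nabla>\<^sub>Y - \<nabla>\<^sub>Z\<close> with \<open>Z = lc X Y\<close>
  (this is the formula of the formal adjoint composition for the Hermitian metric of the bundle,
  which is not needed otherwise).\<close>

definition conn_laplacian :: "('a, 'p) spin3 \<Rightarrow> int \<Rightarrow> ('a \<Rightarrow> 'p spinor) \<Rightarrow> 'a \<Rightarrow> 'p spinor" where
  "conn_laplacian M m \<psi> x =
     (let e = frame_near M x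
      in spinor_scale (- 1) (spinor_sum UNIV (\<lambda>i.
           spinor_diff (nabla M m (e i x) (\<lambda>y. nabla M m (e i y) \<psi> y) x)
               (nabla M m (lc M x (e i x) (e i)) \<psi> x))))"

definition curvature ::
  "('a, 'p) spin3 \<Rightarrow> int \<Rightarrow> 'a vfield \<Rightarrow> 'a vfield \<Rightarrow> ('a \<Rightarrow> 'p spinor) \<Rightarrow> 'a \<Rightarrow> 'p spinor" where
  "curvature M m X Y \<psi> x =
     spinor_diff (spinor_diff (nabla M m (X x) (\<lambda>y. nabla M m (Y y) \<psi> y) x)
              (nabla M m (Y x) (\<lambda>y. nabla M m (X y) \<psi> y) x))
         (nabla M m (lie_bracket M X Y x) \<psi> x)"

definition clifford_curvature ::
  "('a, 'p) spin3 \<Rightarrow> int \<Rightarrow> (real^3 \<Rightarrow> complex poly \<Rightarrow> complex poly)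
     \<Rightarrow> ('a \<Rightarrow> 'p spinor) \<Rightarrow> 'a \<Rightarrow> 'p spinor" where
  "clifford_curvature M m F \<psi> x =
     (let e = frame_near M x
      in spinor_sum {\<sigma> :: 3 \<Rightarrow> 3. \<sigma> permutes UNIV} (\<lambda>\<sigma>.
           spinor_scale (of_int (sign \<sigma>))
             (bundle_map M F (e (\<sigma> 1) x) (curvature M m (e (\<sigma> 2)) (e (\<sigma> 3)) \<psi> x))))"

definition R0 :: "('a, 'p) spin3 \<Rightarrow> int \<Rightarrow> ('a \<Rightarrow> 'p spinor) \<Rightarrow> 'a \<Rightarrow> 'p spinor" where
  "R0 M m = clifford_curvature M m (rho0 m)"

definition R_plus :: "('a, 'p) spin3 \<Rightarrow> int \<Rightarrow> ('a \<Rightarrow> 'p spinor) \<Rightarrow> 'a \<Rightarrow> 'p spinor" where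
  "R_plus M m = clifford_curvature M m (rho_plus m)"

definition R_minus :: "('a, 'p) spin3 \<Rightarrow> int \<Rightarrow> ('a \<Rightarrow> 'p spinor) \<Rightarrow> 'a \<Rightarrow> 'p spinor" where
  "R_minus M m = clifford_curvature M m (rho_minus m)"

end

theory Submission
  imports Defs
begin

text \<open>The identities come down to four algebraic relations between the Clifford homomorphisms, the
  first two being
  \<open>\<rho>\<^sup>0(\<xi>) \<rho>\<^sup>0(\<eta>) + \<rho>\<^sup>+(\<xi>) \<rho>\<^sup>-(\<eta>) = - m\<^sup>2 (\<xi>, \<eta>) + m \<rho>\<^sup>0(\<xi> \<times> \<eta>)\<close> and
  \<open>\<rho>\<^sup>0(\<xi>) \<rho>\<^sup>0(\<eta>) + \<rho>\<^sup>-(\<xi>) \<rho>\<^sup>+(\<eta>) = - (m + 2)\<^sup>2 (\<xi>, \<eta>) - (m + 2) \<rho>\<^sup>0(\<xi> \<times> \<eta>)\<close>,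
  while in the other two, for \<open>\<rho>\<^sup>0 \<rho>\<^sup>\<plusminus> - \<rho>\<^sup>\<plusminus> \<rho>\<^sup>0\<close>, only a cross product occurs
  (\<open>clifford_relation_minus_plus\<close> and the three lemmas after it). They are polynomial identities
  between the coefficients of a polynomial and of its image.

  Let \<open>e\<close> be a local oriented orthonormal frame and let \<open>H i j\<close> be the second covariant derivative
  of the spinor field in the directions \<open>e i\<close> and \<open>e j\<close>. A composition of two of the first-order
  operators equals the sum of \<open>G(e i) F(e j) (H i j)\<close> over \<open>i\<close> and \<open>j\<close>, without first-order terms
  (\<open>dirac_dirac_class\<close>): Clifford multiplication is parallel (\<open>cov_deriv_clifford\<close>), and the
  connection coefficients of an orthonormal frame are skew (\<open>frame_derivative_terms\<close>).
  After inserting the Clifford relations, the inner product contracts \<open>H\<close> to its trace, which is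
  minus the connection Laplacian. The cross product contracts \<open>H\<close> to its skew part, which is the
  curvature, because the connection is torsion free (\<open>curvature_class\<close>, \<open>sum_cross3_hess\<close>). This
  gives all four identities (\<open>weitzenboeck_local\<close>).

  Spinors are equivalence classes over the fibres of the spin bundle, and the covariant derivative
  collects its values in all local sections. Before calculating in one section \<open>s\<close>, one therefore has
  to know that the values fit together. For the bundle maps this is the equivariance of the Clifford
  homomorphisms (\<open>rho0_equivariant\<close>, \<open>rho_plus_equivariant\<close>, \<open>rho_minus_equivariant\<close>). For the
  covariant derivative it is the behaviour of the connection form in passing from \<open>s\<close> to \<open>s h\<close>,
  namely \<open>\<omega> \<mapsto> Ad h\<inverse> \<omega> + h\<inverse> dh\<close> (\<open>nabla_value\<close>). Since the operators choose
  a frame at each point anew, one also needs their independence of the frame (\<open>dirac_class\<close>)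
  to see that they can be composed.\<close>

section \<open>Smooth functions\<close>

lemma has_derivative_cong_open:
  assumes "open S" "x \<in> S" "\<And>y. y \<in> S \<Longrightarrow> f y = g y"
  shows "(f has_derivative D) (at x) \<longleftrightarrow> (g has_derivative D) (at x)"
  using has_derivative_transform_within_open[OF _ assms(1,2), of f D UNIV g]
    has_derivative_transform_within_open[OF _ assms(1,2), of g D UNIV f] assms(3) by auto

lemma frechet_derivative_cong_open:
  assumes "open S" "x \<in> S" "\<And>y. y \<in> S \<Longrightarrow> f y = g y"
  shows "frechet_derivative f (at x) = frechet_derivative g (at x)"
    and "f differentiable (at x) \<longleftrightarrow> g differentiable (at x)"
  using has_derivative_cong_open[OF assms]
  unfolding frechet_derivative_def differentiable_def by auto

lemma Ck_cong:
  assumes "open S" "\<And>x. x \<in> S \<Longrightarrow> f x = g x"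
  shows "Ck n S f \<longleftrightarrow> Ck n S g"
  using assms(2)
proof (induction n arbitrary: f g)
  case 0
  then show ?case by (auto intro: continuous_on_cong)
next
  case (Suc n)
  note c = frechet_derivative_cong_open[OF assms(1) _ Suc.prems]
  have "Ck n S (\<lambda>x. frechet_derivative f (at x) v) = Ck n S (\<lambda>x. frechet_derivative g (at x) v)" for v
    by (rule Suc.IH) (use c in auto)
  then show ?case using c(2) by auto
qed

lemma Ck_subset: "Ck n S f \<Longrightarrow> T \<subseteq> S \<Longrightarrow> Ck n T f"
  by (induction n arbitrary: f) (auto intro: continuous_on_subset)

lemma Ck_Suc_imp: "Ck (Suc n) S f \<Longrightarrow> Ck n S f"
proof (induction n arbitrary: f)
  case 0
  then show ?case
    by (auto intro!: continuous_at_imp_continuous_on differentiable_imp_continuous_within)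
next
  case (Suc n)
  then show ?case by (metis Ck.simps(2))
qed

lemma Ck_const: "Ck n S (\<lambda>_. c)"
  by (induction n arbitrary: c) auto

lemma Ck_linear:
  assumes L: "bounded_linear L" and "open S"
  shows "Ck n S f \<Longrightarrow> Ck n S (\<lambda>x. L (f x))"
proof (induction n arbitrary: f)
  case 0
  then show ?case
    using bounded_linear.continuous_on[OF L] by auto
next
  case (Suc n)
  have d: "((\<lambda>x. L (f x)) has_derivative (\<lambda>v. L (frechet_derivative f (at x) v))) (at x)" if "x \<in> S" for x
    using that Suc.prems by (intro bounded_linear.has_derivative[OF L]) (auto simp: frechet_derivative_works)
  have "Ck n S (\<lambda>x. frechet_derivative (\<lambda>x. L (f x)) (at x) v)" for v
    by (subst Ck_cong[OF assms(2), where g="\<lambda>x. L (frechet_derivative f (at x) v)"])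
      (use Suc frechet_derivative_at[symmetric, OF d] in auto)
  then show ?case using d by (auto simp: differentiable_def)
qed

lemma Ck_add:
  assumes "open S"
  shows "Ck n S f \<Longrightarrow> Ck n S g \<Longrightarrow> Ck n S (\<lambda>x. f x + g x)"
proof (induction n arbitrary: f g)
  case 0
  then show ?case by (auto intro: continuous_on_add)
next
  case (Suc n)
  have d: "((\<lambda>x. f x + g x) has_derivative
      (\<lambda>v. frechet_derivative f (at x) v + frechet_derivative g (at x) v)) (at x)" if "x \<in> S" for x
    using that Suc.prems by (intro has_derivative_add) (auto simp: frechet_derivative_works)
  have "Ck n S (\<lambda>x. frechet_derivative (\<lambda>x. f x + g x) (at x) v)" for v
    by (subst Ck_cong[OF assms, where g="\<lambda>x. frechet_derivative f (at x) v + frechet_derivative g (at x) v"])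
      (use Suc frechet_derivative_at[symmetric, OF d] in auto)
  then show ?case using d by (auto simp: differentiable_def)
qed

lemma Ck_bilinear:
  assumes B: "bounded_bilinear B" and "open S"
  shows "Ck n S f \<Longrightarrow> Ck n S g \<Longrightarrow> Ck n S (\<lambda>x. B (f x) (g x))"
proof (induction n arbitrary: f g)
  case 0
  then show ?case using bounded_bilinear.continuous_on[OF B] by auto
next
  case (Suc n)
  have d: "((\<lambda>x. B (f x) (g x)) has_derivative
      (\<lambda>v. B (f x) (frechet_derivative g (at x) v) + B (frechet_derivative f (at x) v) (g x))) (at x)"
    if "x \<in> S" for x
    using that Suc.prems by (intro bounded_bilinear.FDERIV[OF B]) (auto simp: frechet_derivative_works)
  have "Ck n S f" "Ck n S g" using Suc.prems by (auto intro: Ck_Suc_imp simp del: Ck.simps)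
  then have "Ck n S (\<lambda>x. frechet_derivative (\<lambda>x. B (f x) (g x)) (at x) v)" for v
    by (subst Ck_cong[OF assms(2), where g="\<lambda>x. B (f x) (frechet_derivative g (at x) v)
          + B (frechet_derivative f (at x) v) (g x)"])
      (use Suc frechet_derivative_at[symmetric, OF d] in \<open>auto intro!: Ck_add[OF assms(2)]\<close>)
  then show ?case using d by (auto simp: differentiable_def)
qed

lemma smooth_on_cong: "open S \<Longrightarrow> (\<And>x. x \<in> S \<Longrightarrow> f x = g x) \<Longrightarrow> smooth_on S f \<longleftrightarrow> smooth_on S g"
  unfolding smooth_on_def using Ck_cong by blast

lemma smooth_on_subset: "smooth_on S f \<Longrightarrow> T \<subseteq> S \<Longrightarrow> smooth_on T f"
  unfolding smooth_on_def using Ck_subset by blast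

lemma smooth_on_const: "smooth_on S (\<lambda>_. c)"
  unfolding smooth_on_def using Ck_const by blast

lemma smooth_on_linear: "bounded_linear L \<Longrightarrow> open S \<Longrightarrow> smooth_on S f \<Longrightarrow> smooth_on S (\<lambda>x. L (f x))"
  unfolding smooth_on_def using Ck_linear by blast

lemma smooth_on_add: "open S \<Longrightarrow> smooth_on S f \<Longrightarrow> smooth_on S g \<Longrightarrow> smooth_on S (\<lambda>x. f x + g x)"
  unfolding smooth_on_def using Ck_add by blast

lemma smooth_on_bilinear: "bounded_bilinear B \<Longrightarrow> open S \<Longrightarrow> smooth_on S f \<Longrightarrow> smooth_on S g
    \<Longrightarrow> smooth_on S (\<lambda>x. B (f x) (g x))"
  unfolding smooth_on_def using Ck_bilinear by blast

lemma smooth_on_sum: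
  assumes "open S" "\<And>i. i \<in> I \<Longrightarrow> smooth_on S (f i)"
  shows "smooth_on S (\<lambda>x. \<Sum>i\<in>I. f i x)"
  using assms(2) by (induction I rule: infinite_finite_induct)
    (auto intro: smooth_on_add[OF assms(1)] smooth_on_const)

lemma smooth_on_differentiable: "smooth_on S f \<Longrightarrow> x \<in> S \<Longrightarrow> f differentiable (at x)"
  unfolding smooth_on_def by (metis Ck.simps(2))

lemma smooth_on_derivative: "smooth_on S f \<Longrightarrow> smooth_on S (\<lambda>x. frechet_derivative f (at x) v)"
  unfolding smooth_on_def by (metis Ck.simps(2))

section \<open>Directional derivatives on a manifold\<close>

locale manifold3 =
  fixes M :: "('a, 'z) riem3_scheme"
  assumes manifold: "oriented_manifold3 M"
begin

lemma chart_open_image: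
  assumes "c \<in> atlas M" "openin (base M) U"
  shows "open (snd c ` (U \<inter> fst c))"
proof -
  have *: "openin (base M) (fst c)" "open (snd c ` fst c)"
     "homeomorphic_map (subtopology (base M) (fst c)) (top_of_set (snd c ` fst c)) (snd c)"
    using manifold assms(1) unfolding oriented_manifold3_def by auto
  have "openin (subtopology (base M) (fst c)) (U \<inter> fst c)"
    using assms(2) by (auto simp: openin_subtopology)
  then have "openin (top_of_set (snd c ` fst c)) (snd c ` (U \<inter> fst c))"
    using *(3) by (meson homeomorphic_imp_open_map open_map_def)
  then show ?thesis using *(2) openin_open_trans by blast
qed

lemma chart_inj: "c \<in> atlas M \<Longrightarrow> inj_on (snd c) (fst c)"
proof -
  assume c: "c \<in> atlas M"
  then have *: "homeomorphic_map (subtopology (base M) (fst c)) (top_of_set (snd c ` fst c)) (snd c)"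
    "openin (base M) (fst c)"
    using manifold unfolding oriented_manifold3_def by auto
  then have "topspace (subtopology (base M) (fst c)) = fst c"
    by (metis openin_subset topspace_subtopology inf.absorb2)
  then show ?thesis using homeomorphic_imp_injective_map[OF *(1)] by simp
qed

lemma chart_inv: "c \<in> atlas M \<Longrightarrow> x \<in> fst c \<Longrightarrow> inv_into (fst c) (snd c) (snd c x) = x"
  using chart_inj by auto

lemma chart_openin: "c \<in> atlas M \<Longrightarrow> openin (base M) (fst c)"
  using manifold unfolding oriented_manifold3_def by auto

lemma ex_chart_at: "x \<in> topspace (base M) \<Longrightarrow> \<exists>c. chart_at M x c"
  using manifold unfolding oriented_manifold3_def chart_at_def by blast

lemma some_chart_at: "x \<in> topspace (base M) \<Longrightarrow> chart_at M x (SOME c. chart_at M x c)"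
  using ex_chart_at someI_ex by metis

lemma smooth_fun_cong:
  assumes "openin (base M) U" "\<And>x. x \<in> U \<Longrightarrow> f x = g x"
  shows "smooth_fun M U f \<longleftrightarrow> smooth_fun M U g"
  unfolding smooth_fun_def
proof (intro ball_cong refl smooth_on_cong chart_open_image)
  fix c z assume c: "c \<in> atlas M" and "z \<in> snd c ` (U \<inter> fst c)"
  then obtain y where "y \<in> U" "y \<in> fst c" "z = snd c y" by auto
  then show "(f \<circ> inv_into (fst c) (snd c)) z = (g \<circ> inv_into (fst c) (snd c)) z"
    using assms(2) chart_inv[OF c] by simp
qed (use assms(1) in auto)

lemma smooth_fun_subset: "smooth_fun M U f \<Longrightarrow> V \<subseteq> U \<Longrightarrow> smooth_fun M V f"
  unfolding smooth_fun_def using smooth_on_subset by (metis image_mono inf_mono order_refl)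

lemma smooth_fun_const: "smooth_fun M U (\<lambda>_. c)"
  unfolding smooth_fun_def comp_def using smooth_on_const by blast

lemma smooth_fun_linear:
  "bounded_linear L \<Longrightarrow> openin (base M) U \<Longrightarrow> smooth_fun M U f \<Longrightarrow> smooth_fun M U (\<lambda>x. L (f x))"
  unfolding smooth_fun_def comp_def by (auto intro: smooth_on_linear chart_open_image)

lemma smooth_fun_bilinear:
  "bounded_bilinear B \<Longrightarrow> openin (base M) U \<Longrightarrow> smooth_fun M U f \<Longrightarrow> smooth_fun M U g
    \<Longrightarrow> smooth_fun M U (\<lambda>x. B (f x) (g x))"
  unfolding smooth_fun_def comp_def by (auto intro: smooth_on_bilinear chart_open_image)

lemma smooth_fun_add:
  "openin (base M) U \<Longrightarrow> smooth_fun M U f \<Longrightarrow> smooth_fun M U g \<Longrightarrow> smooth_fun M U (\<lambda>x. f x + g x)"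
  unfolding smooth_fun_def comp_def by (auto intro: smooth_on_add chart_open_image)

lemma smooth_fun_sum:
  "openin (base M) U \<Longrightarrow> (\<And>i. i \<in> I \<Longrightarrow> smooth_fun M U (f i)) \<Longrightarrow> smooth_fun M U (\<lambda>x. \<Sum>i\<in>I. f i x)"
  unfolding smooth_fun_def comp_def by (intro ballI smooth_on_sum chart_open_image) auto

lemmas smooth_fun_mult = smooth_fun_bilinear[OF bounded_bilinear_mult]
lemmas smooth_fun_scaleR = smooth_fun_bilinear[OF bounded_bilinear_scaleR]
lemmas smooth_fun_nth = smooth_fun_linear[OF bounded_linear_vec_nth]
lemmas smooth_fun_of_real = smooth_fun_linear[OF bounded_linear_of_real]

lemma smooth_fun_vec:
  fixes f :: "'a \<Rightarrow> 'i::finite \<Rightarrow> 'b::real_normed_vector"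
  assumes "openin (base M) U" "\<And>i. smooth_fun M U (\<lambda>x. f x i)"
  shows "smooth_fun M U (\<lambda>x. \<chi> i. f x i)"
proof -
  have bl: "bounded_linear (\<lambda>u::'b. (\<chi> j. if j = i then u else 0)::'b^'i)" for i
    by (intro bounded_linear_intro[where K=1])
      (auto simp: vec_eq_iff norm_vec_def L2_set_def if_distrib[where f="\<lambda>u. (norm u)\<^sup>2"] cong: if_cong)
  have "(\<lambda>x. \<chi> i. f x i) = (\<lambda>x. \<Sum>i\<in>UNIV. (\<chi> j. if j = i then f x i else 0))"
    by (auto simp: vec_eq_iff)
  then show ?thesis
    using smooth_fun_sum[OF assms(1), of UNIV "\<lambda>i x. (\<chi> j. if j = i then f x i else 0)"]
      smooth_fun_linear[OF bl assms(1) assms(2)] by simp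
qed

lemma smooth_fun_differentiable:
  assumes "smooth_fun M U f" "x \<in> U" "chart_at M x c"
  shows "(f \<circ> inv_into (fst c) (snd c)) differentiable (at (snd c x))"
  using assms unfolding smooth_fun_def chart_at_def
  by (auto intro!: smooth_on_differentiable)

abbreviation "chart_near x \<equiv> SOME c. chart_at M x c"
abbreviation "local_rep f x \<equiv> f \<circ> inv_into (fst (chart_near x)) (snd (chart_near x))"

text \<open>A directional derivative is an honest Frechet derivative in one fixed chart. Each of
  the rules below is the corresponding rule for \<open>has_derivative\<close> in that chart.\<close>

lemma ddir_has_derivative:
  assumes "openin (base M) U" "x \<in> U" "smooth_fun M U f"
  shows "(local_rep f x has_derivative (\<lambda>u. ddir M x (\<lambda>_. u) f)) (at (snd (chart_near x) x))"
    and "inv_into (fst (chart_near x)) (snd (chart_near x)) (snd (chart_near x) x) = x"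
proof -
  have c: "chart_at M x (chart_near x)" using some_chart_at assms(1,2) openin_subset by blast
  show "(local_rep f x has_derivative (\<lambda>u. ddir M x (\<lambda>_. u) f)) (at (snd (chart_near x) x))"
    using smooth_fun_differentiable[OF assms(3,2) c]
    by (simp add: ddir_def Let_def frechet_derivative_works)
  show "inv_into (fst (chart_near x)) (snd (chart_near x)) (snd (chart_near x) x) = x"
    using c chart_inv by (auto simp: chart_at_def)
qed

lemma ddir_at_chart: "ddir M x v f = ddir M x (\<lambda>_. v (chart_near x)) f"
  by (simp add: ddir_def Let_def)

lemma ddirI:
  assumes "(local_rep f x has_derivative D) (at (snd (chart_near x) x))"
  shows "ddir M x v f = D (v (chart_near x))"
  using frechet_derivative_at[symmetric, OF assms] by (auto simp: ddir_def Let_def)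

lemma ddir_const: "ddir M x v (\<lambda>_. c) = 0"
  by (rule ddirI[where D="\<lambda>_. 0", unfolded comp_def]) auto

lemma ddir_linear:
  assumes "bounded_linear L" "openin (base M) U" "x \<in> U" "smooth_fun M U f"
  shows "ddir M x v (\<lambda>y. L (f y)) = L (ddir M x v f)"
  unfolding ddir_at_chart[of x v f] by (rule ddirI)
    (use bounded_linear.has_derivative[OF assms(1) ddir_has_derivative(1)[OF assms(2-4)]]
      in \<open>simp add: comp_def\<close>)

lemma ddir_add:
  assumes "openin (base M) U" "x \<in> U" "smooth_fun M U f" "smooth_fun M U g"
  shows "ddir M x v (\<lambda>y. f y + g y) = ddir M x v f + ddir M x v g"
  unfolding ddir_at_chart[of x v f] ddir_at_chart[of x v g] by (rule ddirI)
    (use has_derivative_add[OF ddir_has_derivative(1)[OF assms(1-3)] ddir_has_derivative(1)[OF assms(1,2,4)]]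
      in \<open>simp add: comp_def\<close>)

lemma ddir_bilinear:
  assumes "bounded_bilinear B" "openin (base M) U" "x \<in> U" "smooth_fun M U f" "smooth_fun M U g"
  shows "ddir M x v (\<lambda>y. B (f y) (g y)) = B (f x) (ddir M x v g) + B (ddir M x v f) (g x)"
  unfolding ddir_at_chart[of x v f] ddir_at_chart[of x v g] by (rule ddirI)
    (use bounded_bilinear.FDERIV[OF assms(1) ddir_has_derivative(1)[OF assms(2-4)]
        ddir_has_derivative(1)[OF assms(2,3,5)]]
      in \<open>simp add: comp_def ddir_has_derivative(2)[OF assms(2-4)]\<close>)

lemma ddir_sum:
  assumes "openin (base M) U" "x \<in> U" "\<And>i. i \<in> I \<Longrightarrow> smooth_fun M U (f i)"
  shows "ddir M x v (\<lambda>y. \<Sum>i\<in>I. f i y) = (\<Sum>i\<in>I. ddir M x v (f i))"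
  using assms(3)
proof (induction I rule: infinite_finite_induct)
  case (insert i I)
  then have "smooth_fun M U (\<lambda>y. \<Sum>i\<in>I. f i y)"
    by (intro smooth_fun_sum[OF assms(1)]) auto
  with insert show ?case
    using ddir_add[OF assms(1,2), of "f i" "\<lambda>y. \<Sum>i\<in>I. f i y"] by auto
qed (auto simp: ddir_const)

lemma ddir_comp:
  assumes "openin (base M) U" "x \<in> U" "smooth_fun M U f" "\<phi> differentiable (at (f x))"
  shows "ddir M x v (\<lambda>y. \<phi> (f y)) = frechet_derivative \<phi> (at (f x)) (ddir M x v f)"
  unfolding ddir_at_chart[of x v f] by (rule ddirI)
    (use has_derivative_compose[OF ddir_has_derivative(1)[OF assms(1-3)], of \<phi>] assms(4)
      in \<open>simp add: comp_def ddir_has_derivative(2)[OF assms(1-3)] frechet_derivative_works\<close>)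

lemma ddir_tlin:
  assumes "openin (base M) U" "x \<in> U" "smooth_fun M U f"
  shows "ddir M x (tlin a v b w) f = a *\<^sub>R ddir M x v f + b *\<^sub>R ddir M x w f"
proof -
  have "linear (\<lambda>u. ddir M x (\<lambda>_. u) f)"
    by (rule has_derivative_linear[OF ddir_has_derivative(1)[OF assms]])
  from linear_add[OF this] linear_scale[OF this] show ?thesis
    unfolding ddir_at_chart[of x v f] ddir_at_chart[of x w f] ddir_at_chart[of x "tlin a v b w" f]
    by (simp add: tlin_def)
qed

lemma ddir_cong:
  assumes "openin (base M) U" "x \<in> U" "\<And>y. y \<in> U \<Longrightarrow> f y = g y"
  shows "ddir M x v f = ddir M x v g"
proof -
  let ?c = "SOME c. chart_at M x c"
  have c: "chart_at M x ?c" using some_chart_at assms(1,2) openin_subset by blast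
  then have c': "?c \<in> atlas M" "x \<in> fst ?c" by (auto simp: chart_at_def)
  have "frechet_derivative (f \<circ> inv_into (fst ?c) (snd ?c)) (at (snd ?c x)) =
    frechet_derivative (g \<circ> inv_into (fst ?c) (snd ?c)) (at (snd ?c x))"
    by (rule frechet_derivative_cong_open[OF chart_open_image[OF c'(1) assms(1)]])
      (use c' assms in \<open>auto simp: chart_inv\<close>)
  then show ?thesis by (simp add: ddir_def Let_def)
qed

lemma chart_change_differentiable:
  assumes "chart_at M x c" "chart_at M x d"
  shows "chart_change c d differentiable (at (snd c x))"
proof -
  have "smooth_on (snd c ` (fst c \<inter> fst d)) (chart_change c d)"
    using manifold assms unfolding oriented_manifold3_def chart_at_def by auto
  then show ?thesis using assms
    by (auto simp: chart_at_def intro: smooth_on_differentiable)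
qed

text \<open>The chart used in the definition of a directional derivative is irrelevant by the chain
  rule, because the components of a tangent vector transform by the Jacobians.\<close>

lemma ddir_chart:
  assumes U: "openin (base M) U" "x \<in> U" "smooth_fun M U f" and v: "v \<in> tangent M x"
    and c: "chart_at M x c"
  shows "ddir M x v f = frechet_derivative (f \<circ> inv_into (fst c) (snd c)) (at (snd c x)) (v c)"
proof -
  define d where "d = (SOME c. chart_at M x c)"
  have d: "chart_at M x d" unfolding d_def using some_chart_at U openin_subset by blast
  have cd: "c \<in> atlas M" "d \<in> atlas M" "x \<in> fst c" "x \<in> fst d"
    using c d by (auto simp: chart_at_def)
  let ?pc = "f \<circ> inv_into (fst c) (snd c)" and ?ddir_poly = "f \<circ> inv_into (fst d) (snd d)"
  have 1: "(?pc has_derivative frechet_derivative ?pc (at (snd c x))) (at (snd c x))"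
    using smooth_fun_differentiable[OF U(3,2) c] by (simp add: frechet_derivative_works)
  have eq: "chart_change d c (snd d x) = snd c x"
    using cd by (simp add: chart_change_def chart_inv)
  have 2: "(chart_change d c has_derivative frechet_derivative (chart_change d c) (at (snd d x))) (at (snd d x))"
    using chart_change_differentiable[OF d c] by (simp add: frechet_derivative_works)
  have 3: "((\<lambda>z. ?pc (chart_change d c z)) has_derivative
      (\<lambda>u. frechet_derivative ?pc (at (snd c x)) (frechet_derivative (chart_change d c) (at (snd d x)) u)))
      (at (snd d x))"
    using has_derivative_compose[OF 2, of ?pc] 1 eq by simp
  have "(?ddir_poly has_derivative
      (\<lambda>u. frechet_derivative ?pc (at (snd c x)) (frechet_derivative (chart_change d c) (at (snd d x)) u)))
      (at (snd d x))"
  proof (rule has_derivative_transform_within_open[OF 3])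
    show "open (snd d ` (fst c \<inter> fst d))" using chart_open_image cd chart_openin by blast
    show "snd d x \<in> snd d ` (fst c \<inter> fst d)" using cd by auto
    show "?pc (chart_change d c z) = ?ddir_poly z" if "z \<in> snd d ` (fst c \<inter> fst d)" for z
      using that cd by (auto simp: chart_change_def chart_inv)
  qed
  then have "ddir M x v f = frechet_derivative ?pc (at (snd c x))
      (frechet_derivative (chart_change d c) (at (snd d x)) (v d))"
    using ddirI[of f x _ v] unfolding d_def by blast
  also have "frechet_derivative (chart_change d c) (at (snd d x)) (v d) = v c"
    using v c d unfolding tangent_def by (metis (mono_tags, lifting) mem_Collect_eq)
  finally show ?thesis .
qed

lemma smooth_vfield_component:
  assumes "smooth_vfield M U X" "c \<in> atlas M"
  shows "smooth_on (snd c ` (U \<inter> fst c)) ((\<lambda>x. X x c) \<circ> inv_into (fst c) (snd c))"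
proof -
  have "smooth_fun M (U \<inter> fst c) (\<lambda>x. X x c)" using assms by (auto simp: smooth_vfield_def)
  then have "smooth_on (snd c ` (U \<inter> fst c \<inter> fst c)) ((\<lambda>x. X x c) \<circ> inv_into (fst c) (snd c))"
    using assms(2) unfolding smooth_fun_def by blast
  then show ?thesis by (simp add: Int_assoc)
qed

text \<open>In a chart \<open>c\<close> the derivative along \<open>X\<close> is the sum of the
  components of \<open>X\<close> times the partial derivatives; \<open>ddir_chart\<close>
  permits computing it in \<open>c\<close> at every point of \<open>c\<close>, although the
  definition chooses a chart for each point separately.\<close>

lemma smooth_fun_ddir:
  fixes f :: "'a \<Rightarrow> 'b::real_normed_vector"
  assumes U: "openin (base M) U" and f: "smooth_fun M U f" and X: "smooth_vfield M U X"
  shows "smooth_fun M U (\<lambda>y. ddir M y (X y) f)"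
  unfolding smooth_fun_def
proof
  fix c assume c: "c \<in> atlas M"
  let ?i = "inv_into (fst c) (snd c)" and ?S = "snd c ` (U \<inter> fst c)"
  have oS: "open ?S" by (rule chart_open_image[OF c U])
  have sX: "smooth_on ?S ((\<lambda>x. X x c) \<circ> ?i)" by (rule smooth_vfield_component[OF X c])
  have sf: "smooth_on ?S (f \<circ> ?i)" using f c by (auto simp: smooth_fun_def)
  have "smooth_on ?S (\<lambda>z. \<Sum>j\<in>UNIV. (X (?i z) c $ j) *\<^sub>R frechet_derivative (f \<circ> ?i) (at z) (axis j 1))"
    by (intro smooth_on_sum oS smooth_on_bilinear[OF bounded_bilinear_scaleR]
        smooth_on_linear[OF bounded_linear_vec_nth] smooth_on_derivative sf)
      (use sX in \<open>simp add: comp_def\<close>)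
  moreover have "(\<Sum>j\<in>UNIV. (X (?i z) c $ j) *\<^sub>R frechet_derivative (f \<circ> ?i) (at z) (axis j 1))
      = ((\<lambda>y. ddir M y (X y) f) \<circ> ?i) z" if "z \<in> ?S" for z
  proof -
    from that obtain y where y: "y \<in> U" "y \<in> fst c" "z = snd c y" by auto
    have *: "?i z = y" using y c by (simp add: chart_inv)
    have ch: "chart_at M y c" using y c by (simp add: chart_at_def)
    have "linear (frechet_derivative (f \<circ> ?i) (at z))"
      using smooth_fun_differentiable[OF f y(1) ch] y(3) linear_frechet_derivative by blast
    then have "(\<Sum>j\<in>UNIV. (X y c $ j) *\<^sub>R frechet_derivative (f \<circ> ?i) (at z) (axis j 1))
      = frechet_derivative (f \<circ> ?i) (at z) (\<Sum>j\<in>UNIV. (X y c $ j) *\<^sub>R axis j 1)"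
      by (simp add: linear_sum linear_scale)
    also have "(\<Sum>j\<in>UNIV. (X y c $ j) *\<^sub>R axis j 1) = X y c"
      by (simp add: vec_eq_iff axis_def if_distrib cong: if_cong)
    also have "frechet_derivative (f \<circ> ?i) (at z) (X y c) = ddir M y (X y) f"
      unfolding y(3) by (rule ddir_chart[symmetric, OF U y(1) f _ ch])
        (use X y in \<open>auto simp: smooth_vfield_def\<close>)
    finally show ?thesis using * by (metis comp_apply)
  qed
  ultimately show "smooth_on ?S ((\<lambda>y. ddir M y (X y) f) \<circ> ?i)"
    by (subst (asm) smooth_on_cong[OF oS]) assumption+
qed

end

section \<open>The Clifford relations\<close>

text \<open>Coefficients are indexed by the integers, with value zero at negative indices. The
  Clifford homomorphisms then become difference operators given by one formula at all indices,
  and compositions can be compared without boundary cases.\<close>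

definition icoeff :: "complex poly \<Rightarrow> int \<Rightarrow> complex" where
  "icoeff p j = (if j < 0 then 0 else coeff p (nat j))"

lemma icoeff_add: "icoeff (p + q) j = icoeff p j + icoeff q j"
  by (simp add: icoeff_def)

lemma icoeff_diff: "icoeff (p - q) j = icoeff p j - icoeff q j"
  by (simp add: icoeff_def)

lemma icoeff_minus: "icoeff (- p) j = - icoeff p j"
  by (simp add: icoeff_def)

lemma icoeff_0 [simp]: "icoeff 0 j = 0"
  by (simp add: icoeff_def)

lemma icoeff_smult: "icoeff (smult a p) j = a * icoeff p j"
  by (simp add: icoeff_def)

lemma icoeff_int: "icoeff p (int n) = coeff p n"
  by (simp add: icoeff_def)

lemma poly_eq_icoeffI: "(\<And>j. icoeff p j = icoeff q j) \<Longrightarrow> p = q"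
  by (metis icoeff_int poly_eq_iff)

lemma V_space_iff: "p \<in> V_space m \<longleftrightarrow> (\<forall>j>m. icoeff p j = 0)"
proof
  assume "p \<in> V_space m"
  then show "\<forall>j>m. icoeff p j = 0"
    by (force simp: V_space_def icoeff_def intro: coeff_eq_0)
next
  assume *: "\<forall>j>m. icoeff p j = 0"
  show "p \<in> V_space m"
  proof (rule ccontr)
    assume "p \<notin> V_space m"
    then have "p \<noteq> 0" "int (degree p) > m" by (auto simp: V_space_def)
    then show False using * icoeff_int[of p "degree p"] by auto
  qed
qed

lemma V_space_coeff: "p \<in> V_space m \<Longrightarrow> int k > m \<Longrightarrow> coeff p k = 0"
  by (metis V_space_iff icoeff_int)

lemma V_spaceI: "(\<And>k. int k > m \<Longrightarrow> coeff p k = 0) \<Longrightarrow> p \<in> V_space m"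
  unfolding V_space_iff icoeff_def by auto

lemma V_space_neg: "m < 0 \<Longrightarrow> p \<in> V_space m \<longleftrightarrow> p = 0"
  by (auto simp: V_space_def)

lemma V_space_0 [simp]: "0 \<in> V_space m"
  by (simp add: V_space_def)

lemma V_space_add: "p \<in> V_space m \<Longrightarrow> q \<in> V_space m \<Longrightarrow> p + q \<in> V_space m"
  by (simp add: V_space_iff icoeff_add)

lemma V_space_diff: "p \<in> V_space m \<Longrightarrow> q \<in> V_space m \<Longrightarrow> p - q \<in> V_space m"
  by (simp add: V_space_iff icoeff_diff)

lemma V_space_smult: "p \<in> V_space m \<Longrightarrow> smult a p \<in> V_space m"
  by (simp add: V_space_iff icoeff_smult)

lemma V_space_sum: "(\<And>i. i \<in> I \<Longrightarrow> p i \<in> V_space m) \<Longrightarrow> (\<Sum>i\<in>I. p i) \<in> V_space m"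
  by (induction I rule: infinite_finite_induct) (auto intro: V_space_add)

lemma V_space_monom: "int k \<le> m \<Longrightarrow> monom a k \<in> V_space m"
  by (auto simp: V_space_def degree_monom_eq order.trans[OF _ degree_monom_le])
    (metis degree_monom_eq monom_eq_0)

lemma V_space_expand: "p \<in> V_space m \<Longrightarrow> p = (\<Sum>k\<le>nat m. monom (coeff p k) k)"
  by (rule poly_eqI) (auto simp: coeff_sum V_space_coeff)

lemma on_monomials_add: "on_monomials m F (p + q) = on_monomials m F p + on_monomials m F q"
  by (simp add: on_monomials_def smult_add_left sum.distrib)

lemma on_monomials_smult: "on_monomials m F (smult a p) = smult a (on_monomials m F p)"
  by (rule poly_eqI) (simp add: on_monomials_def coeff_sum sum_distrib_left mult.assoc)

lemma on_monomials_0 [simp]: "on_monomials m F 0 = 0"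
  by (simp add: on_monomials_def)

lemma on_monomials_diff: "on_monomials m F (p - q) = on_monomials m F p - on_monomials m F q"
  by (simp add: on_monomials_def smult_diff_left sum_subtractf)

lemma on_monomials_sum: "on_monomials m F (\<Sum>i\<in>I. p i) = (\<Sum>i\<in>I. on_monomials m F (p i))"
  by (induction I rule: infinite_finite_induct) (auto simp: on_monomials_add)

lemma on_monomials_monom: "int k \<le> m \<Longrightarrow> on_monomials m F (monom a k) = smult a (F k)"
  by (simp add: on_monomials_def if_distrib[where f="\<lambda>u. smult u _"] if_distribR cong: if_cong)

lemma icoeff_sum: "icoeff (\<Sum>i\<in>I. p i) j = (\<Sum>i\<in>I. icoeff (p i) j)"
  by (simp add: icoeff_def coeff_sum)

lemma icoeff_monom: "icoeff (monom a k) j = (if int k = j then a else 0)"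
  by (auto simp: icoeff_def)

text \<open>The Clifford homomorphisms are linear combinations of such weighted shifts, which
  send \<open>z^k\<close> to a multiple of \<open>z^(k - s)\<close>.\<close>

lemma icoeff_on_monomials_shift:
  assumes p: "p \<in> V_space m"
    and F: "\<And>k. int k \<le> m \<Longrightarrow> icoeff (F k) j = (if int k = j + s then a (int k) else 0)"
  shows "icoeff (on_monomials m F p) j = a (j + s) * icoeff p (j + s)"
proof (cases "m < 0")
  case True
  then show ?thesis using p by (simp add: V_space_neg icoeff_def)
next
  case False
  have "icoeff (on_monomials m F p) j = (\<Sum>k\<le>nat m. coeff p k * icoeff (F k) j)"
    by (simp add: on_monomials_def icoeff_sum icoeff_smult)
  also have "\<dots> = (\<Sum>k\<le>nat m. if int k = j + s then a (j + s) * icoeff p (j + s) else 0)"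
    using False by (intro sum.cong refl) (auto simp: F icoeff_int[symmetric])
  also have "\<dots> = a (j + s) * icoeff p (j + s)"
  proof (cases "0 \<le> j + s \<and> j + s \<le> m")
    case True
    then have "(\<Sum>k\<le>nat m. if int k = j + s then a (j + s) * icoeff p (j + s) else 0)
        = (\<Sum>k\<le>nat m. if k = nat (j + s) then a (j + s) * icoeff p (j + s) else 0)"
      by (intro sum.cong) auto
    then show ?thesis using True by (simp add: nat_le_iff)
  next
    case out: False
    then have "j + s < 0 \<or> j + s > m" by auto
    then have "icoeff p (j + s) = 0" using p by (auto simp: V_space_iff) (simp add: icoeff_def)
    then show ?thesis by (simp cong: if_cong)
  qed
  finally show ?thesis .
qed

lemma on_monomials_combine:
  "on_monomials m (\<lambda>k. smult a (A k) + smult b (B k) + smult c (C k)) p =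
     smult a (on_monomials m A p) + smult b (on_monomials m B p) + smult c (on_monomials m C p)"
  by (rule poly_eqI)
    (simp add: on_monomials_def coeff_sum sum_distrib_left sum.distrib algebra_simps)

lemma clifford_eq:
  "clifford m A B C \<xi> p =
     smult (2 * of_real (\<xi> $ 1)) (on_monomials m A p)
   + smult (of_real (\<xi> $ 2) - \<i> * of_real (\<xi> $ 3)) (on_monomials m B p)
   + smult (of_real (\<xi> $ 2) + \<i> * of_real (\<xi> $ 3)) (on_monomials m C p)"
  unfolding clifford_def by (rule on_monomials_combine)

text \<open>Up to a factor \<open>\<i>\<close> in the first one, these are the coordinates of a
  vector in the basis \<open>e1/2, e2/2 + \<i> e3/2, e2/2 - \<i> e3/2\<close>. The values of all
  three Clifford homomorphisms at \<open>e1/2\<close> carry the factor \<open>\<i>\<close>, so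
  in \<open>cu, cv, cw\<close> all formulas have rational coefficients.\<close>

definition cu :: "real^3 \<Rightarrow> complex" where "cu \<xi> = 2 * \<i> * of_real (\<xi> $ 1)"
definition cv :: "real^3 \<Rightarrow> complex" where "cv \<xi> = of_real (\<xi> $ 2) - \<i> * of_real (\<xi> $ 3)"
definition cw :: "real^3 \<Rightarrow> complex" where "cw \<xi> = of_real (\<xi> $ 2) + \<i> * of_real (\<xi> $ 3)"

lemma cuvw_cross3:
  "cu (cross3 \<xi> \<eta>) = cv \<xi> * cw \<eta> - cw \<xi> * cv \<eta>"
  "cv (cross3 \<xi> \<eta>) = (cv \<xi> * cu \<eta> - cu \<xi> * cv \<eta>) / 2"
  "cw (cross3 \<xi> \<eta>) = (cu \<xi> * cw \<eta> - cw \<xi> * cu \<eta>) / 2"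
  by (simp_all add: cu_def cv_def cw_def cross3_def complex_eq_iff algebra_simps)

lemma cuvw_inner: "of_real (\<xi> \<bullet> \<eta>) = (cv \<xi> * cw \<eta> + cw \<xi> * cv \<eta>) / 2 - cu \<xi> * cu \<eta> / 4"
  by (simp add: cu_def cv_def cw_def inner_vec_def sum_3 complex_eq_iff algebra_simps)

lemma cuvw_scaleR:
  "cu (r *\<^sub>R \<xi>) = of_real r * cu \<xi>" "cv (r *\<^sub>R \<xi>) = of_real r * cv \<xi>" "cw (r *\<^sub>R \<xi>) = of_real r * cw \<xi>"
  by (simp_all add: cu_def cv_def cw_def algebra_simps)

text \<open>The weights \<open>j + 1\<close> and \<open>m - j + 1\<close> vanish at \<open>j = -
  1\<close> and \<open>j = m + 1\<close>, the only indices outside the range from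
  \<open>0\<close> to \<open>m\<close> to which a coefficient could be shifted; so the formula
  has no exceptions.\<close>

lemma icoeff_rho0:
  assumes "p \<in> V_space m"
  shows "icoeff (rho0 m \<xi> p) j =
     cu \<xi> * (of_int j - of_int m / 2) * icoeff p j
   - cv \<xi> * of_int (j + 1) * icoeff p (j + 1)
   + cw \<xi> * of_int (m - j + 1) * icoeff p (j - 1)"
proof -
  have 1: "icoeff (on_monomials m (\<lambda>k. monom (\<i> * (of_nat k - of_int m / 2)) k) p) j
     = \<i> * (of_int (j + 0) - of_int m / 2) * icoeff p (j + 0)"
    by (rule icoeff_on_monomials_shift[OF assms]) (auto simp: icoeff_monom)
  have 2: "icoeff (on_monomials m (\<lambda>k. monom (- of_nat k) (k - 1)) p) j
     = - of_int (j + 1) * icoeff p (j + 1)"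
  proof (rule icoeff_on_monomials_shift[OF assms, where a="\<lambda>k. - of_int k"])
    fix k :: nat
    show "icoeff (monom (- of_nat k) (k - 1)) j = (if int k = j + 1 then - of_int (int k) else 0)"
      by (cases k) (auto simp: icoeff_monom)
  qed
  have 3: "icoeff (on_monomials m (\<lambda>k. monom (of_int m - of_nat k) (k + 1)) p) j
     = of_int (m - (j + - 1)) * icoeff p (j + - 1)"
    by (rule icoeff_on_monomials_shift[OF assms, where a="\<lambda>k. of_int (m - k)"])
      (auto simp: icoeff_monom dest!: arg_cong[where f="of_int :: int \<Rightarrow> complex"])
  show ?thesis
    unfolding rho0_def clifford_eq icoeff_add icoeff_smult 1 2 3
    by (simp add: cu_def cv_def cw_def algebra_simps)
qed

lemma icoeff_rho_plus:
  assumes "p \<in> V_space m"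
  shows "icoeff (rho_plus m \<xi> p) j =
     cu \<xi> * icoeff p (j - 1)
   - cv \<xi> * icoeff p j
   - cw \<xi> * icoeff p (j - 2)"
proof -
  have 1: "icoeff (on_monomials m (\<lambda>k. monom \<i> (k + 1)) p) j = \<i> * icoeff p (j + - 1)"
    by (rule icoeff_on_monomials_shift[OF assms]) (auto simp: icoeff_monom)
  have 2: "icoeff (on_monomials m (\<lambda>k. monom (- 1) k) p) j = - 1 * icoeff p (j + 0)"
    by (rule icoeff_on_monomials_shift[OF assms]) (auto simp: icoeff_monom)
  have 3: "icoeff (on_monomials m (\<lambda>k. monom (- 1) (k + 2)) p) j = - 1 * icoeff p (j + - 2)"
    by (rule icoeff_on_monomials_shift[OF assms]) (auto simp: icoeff_monom)
  show ?thesis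
    unfolding rho_plus_def clifford_eq
    by (simp add: cu_def cv_def cw_def icoeff_add icoeff_smult 1[simplified] 2[simplified] 3[simplified] algebra_simps)
qed

lemma icoeff_rho_minus:
  assumes "p \<in> V_space m"
  shows "icoeff (rho_minus m \<xi> p) j =
     cu \<xi> * of_int (j + 1) * of_int (m - j - 1) * icoeff p (j + 1)
   + cv \<xi> * of_int (j + 2) * of_int (j + 1) * icoeff p (j + 2)
   + cw \<xi> * of_int (m - j) * of_int (m - j - 1) * icoeff p j"
proof -
  have 1: "icoeff (on_monomials m (\<lambda>k. monom (\<i> * of_nat k * (of_int m - of_nat k)) (k - 1)) p) j
     = \<i> * of_int (j + 1) * (of_int m - of_int (j + 1)) * icoeff p (j + 1)"
  proof (rule icoeff_on_monomials_shift[OF assms, where a="\<lambda>k. \<i> * of_int k * (of_int m - of_int k)"])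
    fix k :: nat
    show "icoeff (monom (\<i> * of_nat k * (of_int m - of_nat k)) (k - 1)) j
      = (if int k = j + 1 then \<i> * of_int (int k) * (of_int m - of_int (int k)) else 0)"
      by (cases k) (auto simp: icoeff_monom)
  qed
  have 2: "icoeff (on_monomials m (\<lambda>k. monom (of_nat k * (of_nat k - 1)) (k - 2)) p) j
     = of_int (j + 2) * (of_int (j + 2) - 1) * icoeff p (j + 2)"
  proof (rule icoeff_on_monomials_shift[OF assms, where a="\<lambda>k. of_int k * (of_int k - 1)"])
    fix k :: nat
    consider "k = 0" | "k = 1" | l where "k = l + 2" by (metis One_nat_def Suc_eq_plus1 add_2_eq_Suc' not0_implies_Suc)
    then show "icoeff (monom (of_nat k * (of_nat k - 1)) (k - 2)) j
      = (if int k = j + 2 then of_int (int k) * (of_int (int k) - 1) else 0)"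
      by cases (auto simp: icoeff_monom)
  qed
  have 3: "icoeff (on_monomials m (\<lambda>k. monom ((of_int m - of_nat k) * (of_int m - of_nat k - 1)) k) p) j
     = (of_int m - of_int (j + 0)) * (of_int m - of_int (j + 0) - 1) * icoeff p (j + 0)"
    by (rule icoeff_on_monomials_shift[OF assms]) (auto simp: icoeff_monom)
  show ?thesis
    unfolding rho_minus_def clifford_eq icoeff_add icoeff_smult 1 2 3
    by (simp add: cu_def cv_def cw_def algebra_simps)
qed

lemma rho0_V_space: "p \<in> V_space m \<Longrightarrow> rho0 m \<xi> p \<in> V_space m"
proof (unfold V_space_iff[of "rho0 m \<xi> p"], intro allI impI)
  fix j assume p: "p \<in> V_space m" and j: "m < j"
  have z: "icoeff p i = 0" if "i > m" for i using p that by (simp add: V_space_iff)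
  have "icoeff p j = 0" "icoeff p (j + 1) = 0" using j by (auto intro: z)
  moreover have "m - j + 1 = 0 \<or> icoeff p (j - 1) = 0"
    using j z[of "j - 1"] by linarith
  ultimately  show "icoeff (rho0 m \<xi> p) j = 0"
    unfolding icoeff_rho0[OF p] by (elim disjE) simp_all
qed

lemma rho_plus_V_space: "p \<in> V_space m \<Longrightarrow> rho_plus m \<xi> p \<in> V_space (m + 2)"
  by (subst V_space_iff) (simp add: icoeff_rho_plus, simp add: V_space_iff)

lemma rho_minus_V_space: "p \<in> V_space m \<Longrightarrow> rho_minus m \<xi> p \<in> V_space (m - 2)"
proof (unfold V_space_iff[of "rho_minus m \<xi> p"], intro allI impI)
  fix j assume p: "p \<in> V_space m" and j: "m - 2 < j"
  have z: "icoeff p i = 0" if "i > m" for i using p that by (simp add: V_space_iff)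
  have "m - j - 1 = 0 \<or> icoeff p (j + 1) = 0"
    using j z[of "j + 1"] by linarith
  moreover have "icoeff p (j + 2) = 0" using j by (intro z) simp
  moreover have "m - j = 0 \<or> m - j - 1 = 0 \<or> icoeff p j = 0"
    using j z[of j] by linarith
  ultimately show "icoeff (rho_minus m \<xi> p) j = 0"
    unfolding icoeff_rho_minus[OF p] by (elim disjE) simp_all
qed

lemmas rho_V_space = rho0_V_space rho_plus_V_space rho_minus_V_space

lemmas rho_icoeff_simps = icoeff_add icoeff_diff icoeff_minus icoeff_smult
  icoeff_rho0 icoeff_rho_plus icoeff_rho_minus rho_V_space cuvw_cross3 cuvw_inner cuvw_scaleR

text \<open>The four Clifford relations carry the whole theorem. Both sides are difference
  operators, so each relation is a polynomial identity in \<open>j\<close>, \<open>m\<close> and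
  the coordinates of the two vectors. The symmetric part in the vectors is a multiple of the
  inner product, or zero; the skew part is again a Clifford homomorphism, applied to the cross
  product.\<close>

lemma clifford_relation_minus_plus:
  assumes p: "p \<in> V_space m"
  shows "rho0 m \<xi> (rho0 m \<eta> p) + rho_plus (m - 2) \<xi> (rho_minus m \<eta> p)
    = smult (- (of_int m)\<^sup>2 * of_real (\<xi> \<bullet> \<eta>)) p + smult (of_int m) (rho0 m (cross3 \<xi> \<eta>) p)"
  by (rule poly_eq_icoeffI, simp add: rho_icoeff_simps p, simp add: algebra_simps power2_eq_square add_divide_distrib diff_divide_distrib)

lemma clifford_relation_plus_minus:
  assumes p: "p \<in> V_space m"
  shows "rho0 m \<xi> (rho0 m \<eta> p) + rho_minus (m + 2) \<xi> (rho_plus m \<eta> p)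
    = smult (- (of_int (m + 2))\<^sup>2 * of_real (\<xi> \<bullet> \<eta>)) p - smult (of_int (m + 2)) (rho0 m (cross3 \<xi> \<eta>) p)"
  by (rule poly_eq_icoeffI, simp add: rho_icoeff_simps p, simp add: algebra_simps power2_eq_square add_divide_distrib diff_divide_distrib)

lemma clifford_relation_plus:
  assumes p: "p \<in> V_space m"
  shows "rho0 (m + 2) \<xi> (rho_plus m \<eta> p) - rho_plus m \<xi> (rho0 m \<eta> p)
    = smult (of_int (m + 2)) (rho_plus m (cross3 \<xi> \<eta>) p)"
  by (rule poly_eq_icoeffI, simp add: rho_icoeff_simps p, simp add: algebra_simps power2_eq_square add_divide_distrib diff_divide_distrib)

lemma clifford_relation_minus:
  assumes p: "p \<in> V_space m"
  shows "rho0 (m - 2) \<xi> (rho_minus m \<eta> p) - rho_minus m \<xi> (rho0 m \<eta> p)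
    = smult (- of_int m) (rho_minus m (cross3 \<xi> \<eta>) p)"
  by (rule poly_eq_icoeffI, simp add: rho_icoeff_simps p, simp add: algebra_simps power2_eq_square add_divide_distrib diff_divide_distrib)

text \<open>Infinitesimal equivariance: the bracket of \<open>su(2)\<close>, transported to
  \<open>R^3\<close>, is twice the cross product.\<close>

lemma commutator_rho0:
  assumes p: "p \<in> V_space m"
  shows "rho0 m \<zeta> (rho0 m \<xi> p) - rho0 m \<xi> (rho0 m \<zeta> p) = rho0 m (2 *\<^sub>R cross3 \<zeta> \<xi>) p"
  by (rule poly_eq_icoeffI, simp add: rho_icoeff_simps p, simp add: algebra_simps power2_eq_square add_divide_distrib diff_divide_distrib)

lemma commutator_rho_plus:
  assumes p: "p \<in> V_space m"
  shows "rho0 (m + 2) \<zeta> (rho_plus m \<xi> p) - rho_plus m \<xi> (rho0 m \<zeta> p) = rho_plus m (2 *\<^sub>R cross3 \<zeta> \<xi>) p"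
  by (rule poly_eq_icoeffI, simp add: rho_icoeff_simps p, simp add: algebra_simps power2_eq_square add_divide_distrib diff_divide_distrib)

lemma commutator_rho_minus:
  assumes p: "p \<in> V_space m"
  shows "rho0 (m - 2) \<zeta> (rho_minus m \<xi> p) - rho_minus m \<xi> (rho0 m \<zeta> p) = rho_minus m (2 *\<^sub>R cross3 \<zeta> \<xi>) p"
  by (rule poly_eq_icoeffI, simp add: rho_icoeff_simps p, simp add: algebra_simps power2_eq_square add_divide_distrib diff_divide_distrib)

section \<open>\<open>SU(2)\<close> and its adjoint action\<close>

lemmas mat2_simps = vec_eq_iff forall_2 matrix_matrix_mult_def sum_2 mat_def det_2

lemma su2_of_nth:
  "su2_of \<xi> $ 1 $ 1 = cu \<xi> / 2" "su2_of \<xi> $ 1 $ 2 = cw \<xi>"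
  "su2_of \<xi> $ 2 $ 1 = - cv \<xi>" "su2_of \<xi> $ 2 $ 2 = - cu \<xi> / 2"
  by (simp_all add: su2_of_def sigma1_def sigma2_def sigma3_def cu_def cv_def cw_def complex_eq_iff)

text \<open>A linear left inverse of \<open>su2_of\<close> on all matrices, which unlike
  \<open>inv su2_of\<close> can be differentiated through.\<close>

definition su2_coord :: "complex^2^2 \<Rightarrow> real^3" where
  "su2_coord B = vector [Im (B $ 1 $ 1), Re (B $ 1 $ 2), Im (B $ 1 $ 2)]"

lemma su2_coord_su2_of [simp]: "su2_coord (su2_of \<xi>) = \<xi>"
  by (simp add: su2_coord_def su2_of_nth vec_eq_iff forall_3 cu_def cw_def)

lemma inv_su2_of: "inv su2_of (su2_of \<xi>) = \<xi>"
  by (metis injI inv_f_f su2_coord_su2_of)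

lemma su2_of_inject: "su2_of \<xi> = su2_of \<eta> \<longleftrightarrow> \<xi> = \<eta>"
  by (metis su2_coord_su2_of)

definition is_su2 :: "complex^2^2 \<Rightarrow> bool" where
  "is_su2 B \<longleftrightarrow> adj B = - B \<and> B $ 1 $ 1 + B $ 2 $ 2 = 0"

lemma su2_of_su2_coord:
  assumes "is_su2 B"
  shows "su2_of (su2_coord B) = B"
proof -
  have "cnj (B $ 1 $ 1) = - B $ 1 $ 1" "cnj (B $ 1 $ 2) = - B $ 2 $ 1" "B $ 2 $ 2 = - B $ 1 $ 1"
    using assms by (auto simp: is_su2_def adj_def vec_eq_iff forall_2 eq_neg_iff_add_eq_0)
      (metis add.commute add.inverse_unique)
  then show ?thesis
    by (auto simp: vec_eq_iff forall_2 su2_of_nth su2_coord_def cu_def cv_def cw_def complex_eq_iff)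
qed

lemma bounded_linear_su2_coord: "bounded_linear su2_coord"
  by (rule linear_conv_bounded_linear[THEN iffD1], rule linearI)
    (simp_all add: su2_coord_def vec_eq_iff forall_3)

lemma linear_su2_of: "linear su2_of"
  by (rule linearI) (simp_all add: su2_of_def algebra_simps scaleR_add_left)

lemma su2_of_simps:
  "su2_of (\<xi> + \<eta>) = su2_of \<xi> + su2_of \<eta>" "su2_of (r *\<^sub>R \<xi>) = r *\<^sub>R su2_of \<xi>"
  "su2_of (\<xi> - \<eta>) = su2_of \<xi> - su2_of \<eta>" "su2_of (- \<xi>) = - su2_of \<xi>" "su2_of 0 = 0"
  using linear_su2_of by (simp_all add: linear_add linear_scale linear_diff linear_neg linear_0)

lemma is_su2_su2_of: "is_su2 (su2_of \<xi>)"
  by (simp add: is_su2_def adj_def vec_eq_iff forall_2 su2_of_nth)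
    (simp add: cu_def cv_def cw_def)

text \<open>Quaternion multiplication. Both \<open>ad\<close> and the invariance of inner and
  cross product under \<open>Ad\<close> are read off from it.\<close>

lemma su2_of_mult: "su2_of \<xi> ** su2_of \<eta> = su2_of (cross3 \<xi> \<eta>) - (\<xi> \<bullet> \<eta>) *\<^sub>R mat 1"
  unfolding mat2_simps
  by (simp add: su2_of_nth cuvw_cross3 cuvw_inner scaleR_conv_of_real[where 'a=complex] field_simps)

lemma mat_mult_simps:
  fixes A B C :: "complex^2^2"
  shows "(A + B) ** C = A ** C + B ** C" "A ** (B + C) = A ** B + A ** C"
    "(A - B) ** C = A ** C - B ** C" "A ** (B - C) = A ** B - A ** C"
    "(- A) ** B = - (A ** B)" "A ** (- B) = - (A ** B)"
    "(r *\<^sub>R A) ** B = r *\<^sub>R (A ** B)" "A ** (r *\<^sub>R B) = r *\<^sub>R (A ** B)"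
    "A ** (B ** C) = A ** B ** C"
  unfolding mat2_simps by (simp_all add: algebra_simps scaleR_conv_of_real[where 'a=complex])

lemma bounded_bilinear_mat_mult: "bounded_bilinear ((**) :: complex^2^2 \<Rightarrow> complex^2^2 \<Rightarrow> complex^2^2)"
  unfolding bilinear_conv_bounded_bilinear[symmetric] bilinear_def
  by (auto intro!: linearI simp: mat_mult_simps)

lemma ad_eq: "ad \<zeta> \<xi> = 2 *\<^sub>R cross3 \<zeta> \<xi>"
proof -
  have "su2_of \<zeta> ** su2_of \<xi> - su2_of \<xi> ** su2_of \<zeta> = su2_of (2 *\<^sub>R cross3 \<zeta> \<xi>)"
    unfolding su2_of_mult
    by (simp add: cross_skew[of \<xi> \<zeta>] inner_commute su2_of_simps vec_eq_iff scaleR_conv_of_real[where 'a=complex])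
  then show ?thesis by (simp add: ad_def inv_su2_of)
qed

lemma linear_ad: "linear (ad \<zeta>)"
  by (rule linearI) (simp_all add: ad_eq cross_add_right cross_mult_right scaleR_add_right)

lemma su2_of_ad: "su2_of (ad \<zeta> \<xi>) = su2_of \<zeta> ** su2_of \<xi> - su2_of \<xi> ** su2_of \<zeta>"
  unfolding ad_eq su2_of_mult
  by (simp add: cross_skew[of \<xi> \<zeta>] inner_commute su2_of_simps vec_eq_iff scaleR_conv_of_real[where 'a=complex])

lemma adj_simps:
  "adj (A ** B) = adj B ** adj A" "adj (adj A) = A" "adj (mat 1) = mat 1"
  "adj (A + B) = adj A + adj B" "adj (r *\<^sub>R A) = r *\<^sub>R adj A" "adj (- A) = - adj A"
  "adj (A - B) = adj A - adj B"
  unfolding mat2_simps adj_def by (simp_all add: algebra_simps)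

lemma bounded_linear_adj: "bounded_linear adj"
  by (rule linear_conv_bounded_linear[THEN iffD1], rule linearI) (simp_all add: adj_simps)

lemma SU2_inverse:
  assumes "h \<in> SU2" shows "h ** adj h = mat 1" "adj h ** h = mat 1"
proof -
  show "h ** adj h = mat 1" using assms by (simp add: SU2_def)
  then show "adj h ** h = mat 1" by (simp add: matrix_left_right_inverse)
qed

lemma SU2_cancel:
  assumes "h \<in> SU2"
  shows "B ** h ** adj h = B" "B ** adj h ** h = B"
  using SU2_inverse[OF assms] by (simp_all flip: matrix_mul_assoc)

lemma SU2_mult: "h \<in> SU2 \<Longrightarrow> g \<in> SU2 \<Longrightarrow> h ** g \<in> SU2"
  by (simp add: SU2_def adj_simps det_mul mat_mult_simps)
    (metis matrix_mul_assoc matrix_mul_rid)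

lemma det_adj: "det (adj h) = cnj (det h)"
  by (simp add: det_2 adj_def algebra_simps)

lemma SU2_adj: "h \<in> SU2 \<Longrightarrow> adj h \<in> SU2"
  using SU2_inverse(2)[of h] by (simp add: SU2_def adj_simps det_adj)

lemma SU2_one: "mat 1 \<in> SU2"
  by (simp add: SU2_def adj_simps)

lemma SU2_entries:
  assumes "h \<in> SU2"
  shows "cnj (h $ 1 $ 1) = h $ 2 $ 2" "cnj (h $ 2 $ 2) = h $ 1 $ 1"
    "cnj (h $ 1 $ 2) = - h $ 2 $ 1" "cnj (h $ 2 $ 1) = - h $ 1 $ 2"
    "h $ 1 $ 1 * h $ 2 $ 2 - h $ 1 $ 2 * h $ 2 $ 1 = 1"
proof -
  show d: "h $ 1 $ 1 * h $ 2 $ 2 - h $ 1 $ 2 * h $ 2 $ 1 = 1"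
    using assms by (simp add: SU2_def det_2)
  define k :: "complex^2^2" where "k = vector [vector [h $ 2 $ 2, - h $ 1 $ 2], vector [- h $ 2 $ 1, h $ 1 $ 1]]"
  have "k ** h = mat 1" unfolding k_def mat2_simps using d by (simp add: algebra_simps)
  then have "adj h = k" by (metis SU2_inverse(1)[OF assms] matrix_mul_assoc matrix_mul_lid matrix_mul_rid)
  then show "cnj (h $ 1 $ 1) = h $ 2 $ 2" "cnj (h $ 2 $ 2) = h $ 1 $ 1"
    "cnj (h $ 1 $ 2) = - h $ 2 $ 1" "cnj (h $ 2 $ 1) = - h $ 1 $ 2"
    by (simp_all add: k_def vec_eq_iff forall_2 adj_def)
qed

lemma is_su2_conj: "h \<in> SU2 \<Longrightarrow> is_su2 B \<Longrightarrow> is_su2 (h ** B ** adj h)"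
proof -
  assume h: "h \<in> SU2" and B: "is_su2 B"
  have 1: "adj (h ** B ** adj h) = - (h ** B ** adj h)"
    using B by (simp add: adj_simps is_su2_def mat_mult_simps)
  have "B $ 2 $ 2 = - B $ 1 $ 1" using B by (simp add: is_su2_def eq_neg_iff_add_eq_0 add.commute)
  then have "(h ** B ** adj h) $ 1 $ 1 + (h ** B ** adj h) $ 2 $ 2 = 0"
    unfolding matrix_matrix_mult_def by (simp add: sum_2 adj_def SU2_entries[OF h] algebra_simps)
  with 1 show ?thesis by (simp add: is_su2_def)
qed

lemma su2_of_Ad: "h \<in> SU2 \<Longrightarrow> su2_of (Ad h \<xi>) = h ** su2_of \<xi> ** adj h"
  by (metis Ad_def inv_su2_of is_su2_conj is_su2_su2_of su2_of_su2_coord)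

lemma Ad_coord: "h \<in> SU2 \<Longrightarrow> Ad h \<xi> = su2_coord (h ** su2_of \<xi> ** adj h)"
  by (metis su2_coord_su2_of su2_of_Ad)

text \<open>Conjugation by \<open>h\<close> preserves the matrix product; the trace and the
  trace-free part of \<open>su2_of_mult\<close> give the two claims.\<close>

lemma Ad_cross_inner:
  assumes h: "h \<in> SU2"
  shows "Ad h (cross3 \<xi> \<eta>) = cross3 (Ad h \<xi>) (Ad h \<eta>)" "Ad h \<xi> \<bullet> Ad h \<eta> = \<xi> \<bullet> \<eta>"
proof -
  have "su2_of (Ad h \<xi>) ** su2_of (Ad h \<eta>) = h ** (su2_of \<xi> ** su2_of \<eta>) ** adj h"
    by (simp add: su2_of_Ad h mat_mult_simps SU2_cancel)
  then have *: "su2_of (cross3 (Ad h \<xi>) (Ad h \<eta>)) - (Ad h \<xi> \<bullet> Ad h \<eta>) *\<^sub>R mat 1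
     = su2_of (Ad h (cross3 \<xi> \<eta>)) - (\<xi> \<bullet> \<eta>) *\<^sub>R mat 1"
    unfolding su2_of_mult by (simp add: mat_mult_simps su2_of_Ad h SU2_inverse)
  have "(su2_of \<alpha> - r *\<^sub>R mat 1) $ 1 $ 1 + (su2_of \<alpha> - r *\<^sub>R mat 1) $ 2 $ 2 = - 2 * complex_of_real r" for \<alpha> r
    by (simp add: su2_of_nth mat_def scaleR_conv_of_real[where 'a=complex])
  then have "- 2 * complex_of_real (Ad h \<xi> \<bullet> Ad h \<eta>) = - 2 * complex_of_real (\<xi> \<bullet> \<eta>)"
    using * by metis
  then show "Ad h \<xi> \<bullet> Ad h \<eta> = \<xi> \<bullet> \<eta>" by simp
  then show "Ad h (cross3 \<xi> \<eta>) = cross3 (Ad h \<xi>) (Ad h \<eta>)"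
    using * by (simp add: su2_of_inject)
qed

section \<open>The representations\<close>

abbreviation "form1 h \<equiv> [: h $ 2 $ 1, h $ 1 $ 1 :]"
abbreviation "form2 h \<equiv> [: h $ 2 $ 2, h $ 1 $ 2 :]"

lemma rep_0 [simp]: "rep m h 0 = 0"
  and rep_add: "rep m h (p + q) = rep m h p + rep m h q"
  and rep_smult: "rep m h (smult a p) = smult a (rep m h p)"
  and rep_sum: "rep m h (\<Sum>i\<in>I. f i) = (\<Sum>i\<in>I. rep m h (f i))"
  and rep_diff: "rep m h (p - q) = rep m h p - rep m h q"
  by (simp_all add: rep_def on_monomials_add on_monomials_smult on_monomials_sum on_monomials_diff)

lemma rep_monom: "int k \<le> m \<Longrightarrow> rep m h (monom a k) = smult a (form2 h ^ (nat m - k) * form1 h ^ k)"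
  unfolding rep_def by (rule on_monomials_monom)

lemma form_V_space: "[:a, b:] \<in> V_space 1"
  by (auto simp: V_space_def)

lemma V_space_mult: "p \<in> V_space m \<Longrightarrow> q \<in> V_space n \<Longrightarrow> p * q \<in> V_space (m + n)"
  using degree_mult_le[of p q] by (auto simp: V_space_def)

lemma V_space_power: "p \<in> V_space m \<Longrightarrow> p ^ n \<in> V_space (int n * m)"
proof (induction n)
  case 0
  then show ?case by (simp add: V_space_def)
next
  case (Suc n)
  then show ?case using V_space_mult[OF Suc(2) Suc(1)] by (simp add: algebra_simps)
qed

lemma rep_V_space: "p \<in> V_space m \<Longrightarrow> rep m h p \<in> V_space m"
proof (cases "m < 0")
  case False
  have "form2 h ^ (nat m - k) * form1 h ^ k \<in> V_space m" if "k \<le> nat m" for k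
    using V_space_mult[OF V_space_power[OF form_V_space] V_space_power[OF form_V_space],
        of "h $ 2 $ 2" "h $ 1 $ 2" "nat m - k" "h $ 2 $ 1" "h $ 1 $ 1" k] that False
    by (simp add: of_nat_diff)
  then show ?thesis unfolding rep_def on_monomials_def
    by (intro V_space_sum V_space_smult) auto
qed (simp add: V_space_neg)

text \<open>\<open>rep m h f\<close> is \<open>(b z + d)^m f((a z + c) / (b z + d))\<close>, so
  the representations are multiplicative in the polynomial. Hence they are determined by their
  values on linear forms, where the homomorphism property in \<open>h\<close> is just matrix
  multiplication.\<close>

lemma rep_mult:
  assumes p: "p \<in> V_space m" and q: "q \<in> V_space n" and mn: "m \<ge> 0" "n \<ge> 0"
  shows "rep (m + n) h (p * q) = rep m h p * rep n h q"
proof -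
  have "rep (m + n) h (p * q) =
    rep (m + n) h (\<Sum>i\<le>nat m. \<Sum>j\<le>nat n. monom (coeff p i * coeff q j) (i + j))"
    by (subst arg_cong2[where f="(*)", OF V_space_expand[OF p] V_space_expand[OF q]])
      (simp only: sum_product mult_monom)
  also have "\<dots> = (\<Sum>i\<le>nat m. \<Sum>j\<le>nat n. rep m h (monom (coeff p i) i) * rep n h (monom (coeff q j) j))"
    unfolding rep_sum
  proof (intro sum.cong refl)
    fix i j assume "i \<in> {..nat m}" "j \<in> {..nat n}"
    then have ij: "int i \<le> m" "int j \<le> n" "i \<le> nat m" "j \<le> nat n" using mn by auto
    have e: "nat m + nat n - (i + j) = (nat m - i) + (nat n - j)" using ij(3,4) by linarith
    show "rep (m + n) h (monom (coeff p i * coeff q j) (i + j))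
      = rep m h (monom (coeff p i) i) * rep n h (monom (coeff q j) j)"
      using ij(1,2) mn by (simp only: rep_monom nat_add_distrib e power_add of_nat_add add_mono mult_smult_left mult_smult_right smult_smult mult_ac)
  qed
  also have "\<dots> = rep m h (\<Sum>i\<le>nat m. monom (coeff p i) i) * rep n h (\<Sum>j\<le>nat n. monom (coeff q j) j)"
    by (simp only: rep_sum sum_product)
  also have "\<dots> = rep m h p * rep n h q"
    by (simp only: V_space_expand[OF p, symmetric] V_space_expand[OF q, symmetric])
  finally show ?thesis .
qed

lemma rep_one: "rep 0 h 1 = 1"
  using rep_monom[of 0 0 h 1] by simp

lemma rep_power:
  assumes "l \<in> V_space 1"
  shows "rep (int n) h (l ^ n) = rep 1 h l ^ n"
proof (induction n)
  case (Suc n)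
  have "l ^ n \<in> V_space (int n)" using V_space_power[OF assms, of n] by simp
  from rep_mult[OF assms this, of h] have "rep (1 + int n) h (l * l ^ n) = rep 1 h l ^ Suc n"
    unfolding Suc by simp
  moreover have "1 + int n = int (Suc n)" "l * l ^ n = l ^ Suc n" by simp_all
  ultimately show ?case by metis
qed (simp add: rep_one)

lemma rep_form: "rep 1 h [:a, b:] = smult a (form2 h) + smult b (form1 h)"
  by (simp add: rep_def on_monomials_def)

lemma rep_comp:
  assumes "p \<in> V_space m"
  shows "rep m h (rep m g p) = rep m (h ** g) p"
proof (cases "m < 0")
  case True
  then show ?thesis using assms by (simp add: V_space_neg)
next
  case False
  have f: "rep 1 h (form1 g) = form1 (h ** g)" "rep 1 h (form2 g) = form2 (h ** g)"
    unfolding rep_form by (simp_all add: matrix_matrix_mult_def sum_2 algebra_simps)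
  have *: "rep m h (form2 g ^ (nat m - k) * form1 g ^ k) = form2 (h ** g) ^ (nat m - k) * form1 (h ** g) ^ k"
    if "k \<le> nat m" for k
  proof -
    have "rep (int (nat m - k) + int k) h (form2 g ^ (nat m - k) * form1 g ^ k)
       = rep (int (nat m - k)) h (form2 g ^ (nat m - k)) * rep (int k) h (form1 g ^ k)"
      using V_space_power[OF form_V_space, of _ _ "nat m - k"] V_space_power[OF form_V_space, of _ _ k]
      by (intro rep_mult) simp_all
    moreover have "int (nat m - k) + int k = m" using that False by simp
    ultimately show ?thesis unfolding rep_power[OF form_V_space] f by simp
  qed
  have "rep m h (rep m g p) = (\<Sum>k\<le>nat m. smult (coeff p k) (rep m h (form2 g ^ (nat m - k) * form1 g ^ k)))"
    by (simp only: rep_def[of m g] on_monomials_def rep_sum rep_smult)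
  also have "\<dots> = (\<Sum>k\<le>nat m. smult (coeff p k) (form2 (h ** g) ^ (nat m - k) * form1 (h ** g) ^ k))"
    by (intro sum.cong refl) (simp only: * atMost_iff)
  also have "\<dots> = rep m (h ** g) p"
    by (simp only: rep_def on_monomials_def)
  finally show ?thesis .
qed

lemma rep_mat1: "p \<in> V_space m \<Longrightarrow> rep m (mat 1) p = p"
  using V_space_expand[of p m]
  by (simp add: rep_def on_monomials_def mat_def monom_altdef flip: one_pCons)

subsection \<open>Regular dependence on the group element\<close>

text \<open>The coefficients of \<open>rep m h p\<close> are polynomials in the entries of
  \<open>h\<close> and the coefficients of \<open>p\<close>, so they stay in any algebra of
  functions containing these. The algebras of interest are the functions differentiable at a
  point and the smooth functions on an open set.\<close>

definition subalg :: "('x \<Rightarrow> complex) set \<Rightarrow> bool" where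
  "subalg \<F> \<longleftrightarrow> (\<forall>c. (\<lambda>_. c) \<in> \<F>) \<and> (\<forall>f\<in>\<F>. \<forall>g\<in>\<F>. (\<lambda>x. f x + g x) \<in> \<F> \<and> (\<lambda>x. f x * g x) \<in> \<F>)"

lemma subalg_sum: "subalg \<F> \<Longrightarrow> (\<And>i. i \<in> I \<Longrightarrow> f i \<in> \<F>) \<Longrightarrow> (\<lambda>x. \<Sum>i\<in>I. f i x) \<in> \<F>"
  by (induction I rule: infinite_finite_induct) (auto simp: subalg_def)

lemma subalg_poly_mult:
  assumes "subalg \<F>" "\<And>n. (\<lambda>x. coeff (p x) n) \<in> \<F>" "\<And>n. (\<lambda>x. coeff (q x) n) \<in> \<F>"
  shows "(\<lambda>x. coeff (p x * q x) n) \<in> \<F>"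
  unfolding coeff_mult using assms by (intro subalg_sum) (auto simp: subalg_def)

lemma subalg_poly_power:
  assumes "subalg \<F>" "\<And>n. (\<lambda>x. coeff (p x) n) \<in> \<F>"
  shows "(\<lambda>x. coeff (p x ^ k) n) \<in> \<F>"
proof (induction k arbitrary: n)
  case 0
  then show ?case using assms(1) by (auto simp: subalg_def)
next
  case (Suc k)
  then show ?case using subalg_poly_mult[OF assms] by simp
qed

lemma subalg_form:
  assumes "subalg \<F>" "a \<in> \<F>" "b \<in> \<F>"
  shows "(\<lambda>x. coeff [:a x, b x:] n) \<in> \<F>"
proof -
  consider "n = 0" | "n = 1" | l where "n = Suc (Suc l)" by (metis One_nat_def not0_implies_Suc)
  then show ?thesis using assms by cases (auto simp: subalg_def)
qed

lemma subalg_rep: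
  assumes F: "subalg \<F>" and h: "\<And>i j. (\<lambda>x. h x $ i $ j) \<in> \<F>" and p: "\<And>n. (\<lambda>x. coeff (p x) n) \<in> \<F>"
  shows "(\<lambda>x. coeff (rep m (h x) (p x)) n) \<in> \<F>"
proof -
  have "(\<lambda>x. coeff (form2 (h x) ^ (nat m - k) * form1 (h x) ^ k) n) \<in> \<F>" for k
    by (intro subalg_poly_mult subalg_poly_power subalg_form F h)
  then show ?thesis
    unfolding rep_def on_monomials_def coeff_sum coeff_smult
    using F p by (intro subalg_sum) (auto simp: subalg_def)
qed

lemma subalg_differentiable: "subalg {f :: 'x::real_normed_vector \<Rightarrow> complex. f differentiable (at x)}"
  by (auto simp: subalg_def)

subsection \<open>The differential of the representation\<close>

text \<open>Polynomials are differentiated with respect to a real parameter coefficient by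
  coefficient.\<close>

definition coeff_deriv :: "(real \<Rightarrow> complex poly) \<Rightarrow> complex poly \<Rightarrow> bool" where
  "coeff_deriv f D \<longleftrightarrow> (\<forall>n. ((\<lambda>t. coeff (f t) n) has_vector_derivative coeff D n) (at 0))"

lemma coeff_deriv_const: "coeff_deriv (\<lambda>_. p) 0"
  by (simp add: coeff_deriv_def)

lemma coeff_deriv_mult:
  "coeff_deriv f D \<Longrightarrow> coeff_deriv g E \<Longrightarrow> coeff_deriv (\<lambda>t. f t * g t) (f 0 * E + D * g 0)"
  unfolding coeff_deriv_def coeff_mult coeff_add sum.distrib[symmetric]
  by (auto intro!: has_vector_derivative_sum has_vector_derivative_mult)

lemma coeff_deriv_power:
  "coeff_deriv f D \<Longrightarrow> coeff_deriv (\<lambda>t. f t ^ n) (of_nat n * f 0 ^ (n - 1) * D)"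
proof (induction n)
  case 0
  then show ?case by (simp add: coeff_deriv_const)
next
  case (Suc n)
  have e: "f 0 * (of_nat n * f 0 ^ (n - 1) * D) + D * f 0 ^ n = of_nat (Suc n) * f 0 ^ (Suc n - 1) * D"
    by (cases n) (auto simp: algebra_simps)
  show ?case using coeff_deriv_mult[OF Suc(2) Suc(1)[OF Suc(2)]] unfolding e by simp
qed

lemma coeff_deriv_smult: "coeff_deriv f D \<Longrightarrow> coeff_deriv (\<lambda>t. smult a (f t)) (smult a D)"
  unfolding coeff_deriv_def by (auto intro!: has_vector_derivative_mult_right)

lemma coeff_deriv_sum:
  "(\<And>i. i \<in> I \<Longrightarrow> coeff_deriv (f i) (D i)) \<Longrightarrow> coeff_deriv (\<lambda>t. \<Sum>i\<in>I. f i t) (\<Sum>i\<in>I. D i)"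
  unfolding coeff_deriv_def coeff_sum by (auto intro!: has_vector_derivative_sum)

lemma coeff_deriv_on_monomials:
  "coeff_deriv f D \<Longrightarrow> coeff_deriv (\<lambda>t. on_monomials m F (f t)) (on_monomials m F D)"
  unfolding coeff_deriv_def on_monomials_def coeff_sum coeff_smult
  by (auto intro!: has_vector_derivative_sum has_vector_derivative_mult_left)

lemma coeff_deriv_form: "coeff_deriv (\<lambda>t. [:a + t *\<^sub>R c, b + t *\<^sub>R d:]) [:c, d:]"
  unfolding coeff_deriv_def
proof
  fix n
  have *: "((\<lambda>t. a + t *\<^sub>R c) has_vector_derivative c) (at 0)" for a c :: complex
    by (auto intro!: derivative_eq_intros)
  consider "n = 0" | "n = 1" | l where "n = Suc (Suc l)" by (metis One_nat_def not0_implies_Suc)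
  then show "((\<lambda>t. coeff [:a + t *\<^sub>R c, b + t *\<^sub>R d:] n) has_vector_derivative coeff [:c, d:] n) (at 0)"
    by cases (auto simp: *)
qed

text \<open>The product rule applied to the image of \<open>z^k\<close> under \<open>rep m (mat
  1 + t A)\<close> at \<open>t = 0\<close>.\<close>

definition drep_monom :: "int \<Rightarrow> complex^2^2 \<Rightarrow> nat \<Rightarrow> complex poly" where
  "drep_monom m A k = of_nat k * [:0, 1:] ^ (k - 1) * form1 A + of_nat (nat m - k) * form2 A * [:0, 1:] ^ k"

lemma coeff_deriv_rep:
  "coeff_deriv (\<lambda>t. rep m (mat 1 + t *\<^sub>R A) p) (on_monomials m (drep_monom m A) p)"
proof -
  have 1: "coeff_deriv (\<lambda>t. form1 (mat 1 + t *\<^sub>R A)) (form1 A)"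
    using coeff_deriv_form[of 0 "A $ 2 $ 1" 1 "A $ 1 $ 1"] by (simp add: mat_def)
  have 2: "coeff_deriv (\<lambda>t. form2 (mat 1 + t *\<^sub>R A)) (form2 A)"
    using coeff_deriv_form[of 1 "A $ 2 $ 2" 0 "A $ 1 $ 2"] by (simp add: mat_def)
  have 3: "form1 (mat 1 + 0 *\<^sub>R A) = [:0, 1:]" "form2 (mat 1 + 0 *\<^sub>R A) = 1"
    by (simp_all add: mat_def one_pCons)
  have "coeff_deriv (\<lambda>t. form2 (mat 1 + t *\<^sub>R A) ^ (nat m - k) * form1 (mat 1 + t *\<^sub>R A) ^ k)
     (drep_monom m A k)" for k
    using coeff_deriv_mult[OF coeff_deriv_power[OF 2, of "nat m - k"] coeff_deriv_power[OF 1, of k]]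
    unfolding 3 drep_monom_def by simp
  then show ?thesis
    unfolding rep_def on_monomials_def by (intro coeff_deriv_sum coeff_deriv_smult)
qed

text \<open>The sum in \<open>drep\<close> stops at degree \<open>m\<close>, which loses
  nothing: the coefficients of higher degree vanish along the whole curve.\<close>

lemma drep_eqI:
  assumes D: "coeff_deriv (\<lambda>t. rep m (mat 1 + t *\<^sub>R A) p) D" and p: "p \<in> V_space m"
  shows "drep m A p = D"
proof -
  have "coeff D n = 0" if "int n > m" for n
  proof -
    have "coeff (rep m (mat 1 + t *\<^sub>R A) p) n = 0" for t
      using rep_V_space[OF p] V_space_coeff that by blast
    then have "(\<lambda>t::real. coeff (rep m (mat 1 + t *\<^sub>R A) p) n) = (\<lambda>t. 0)" by simp
    then have "((\<lambda>t::real. 0) has_vector_derivative coeff D n) (at 0)"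
      using D unfolding coeff_deriv_def by metis
    then show ?thesis using vector_derivative_unique_at has_vector_derivative_const by blast
  qed
  then have "D \<in> V_space m" by (rule V_spaceI)
  then have e: "D = (\<Sum>k\<le>nat m. monom (coeff D k) k)" by (rule V_space_expand)
  have "vector_derivative (\<lambda>t. coeff (rep m (mat 1 + t *\<^sub>R A) p) k) (at 0) = coeff D k" for k
    using D by (simp add: coeff_deriv_def vector_derivative_at)
  then show ?thesis unfolding drep_def using e by simp
qed

lemma drep_eq: "p \<in> V_space m \<Longrightarrow> drep m A p = on_monomials m (drep_monom m A) p"
  using drep_eqI[OF coeff_deriv_rep] .

lemma coeff_deriv_drep: "p \<in> V_space m \<Longrightarrow> coeff_deriv (\<lambda>t. rep m (mat 1 + t *\<^sub>R A) p) (drep m A p)"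
  using coeff_deriv_rep by (simp add: drep_eq)

lemma drep_minus: "p \<in> V_space m \<Longrightarrow> drep m (- A) p = - drep m A p"
proof -
  have *: "drep_monom m (- A) k = - drep_monom m A k" for k
  proof -
    have f: "form1 (- A) = - form1 A" "form2 (- A) = - form2 A" by simp_all
    show ?thesis unfolding drep_monom_def f
      by (simp only: mult_minus_left mult_minus_right minus_add_distrib)
  qed
  show "p \<in> V_space m \<Longrightarrow> ?thesis"
    by (simp add: drep_eq on_monomials_def * sum_negf)
qed

text \<open>The Clifford homomorphism \<open>rho0\<close> is the infinitesimal representation.
  Its Clifford relations and its part in the covariant derivative thus concern the same map.\<close>

lemma drep_su2_of:
  assumes "p \<in> V_space m"
  shows "drep m (su2_of \<zeta>) p = rho0 m \<zeta> p"
proof (cases "m < 0")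
  case True
  then show ?thesis using assms by (simp add: V_space_neg drep_eq rho0_def clifford_def)
next
  case False
  have "drep_monom m (su2_of \<zeta>) k =
      smult (2 * of_real (\<zeta> $ 1)) (monom (\<i> * (of_nat k - of_int m / 2)) k)
     + smult (of_real (\<zeta> $ 2) - \<i> * of_real (\<zeta> $ 3)) (monom (- of_nat k) (k - 1))
     + smult (of_real (\<zeta> $ 2) + \<i> * of_real (\<zeta> $ 3)) (monom (of_int m - of_nat k) (k + 1))"
    if k: "k \<le> nat m" for k
  proof -
    have x: "[:0, 1:] ^ j = monom (1::complex) j" for j by (simp add: monom_altdef)
    have n: "of_nat n * p = smult (of_nat n) p" for n and p :: "complex poly"
      by (simp add: of_nat_poly)
    have nk: "of_nat (nat m - k) = complex_of_int m - of_nat k" using k False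
      by (simp add: of_nat_diff)
    have pc: "[:a, b:] = monom a 0 + monom b 1" for a b :: complex
      by (simp add: monom_0 monom_Suc)
    have "drep_monom m (su2_of \<zeta>) k = monom (of_nat k * - cv \<zeta>) (k - 1) + monom (of_nat k * (cu \<zeta> / 2)) k
      + (monom (of_nat (nat m - k) * (- cu \<zeta> / 2)) k + monom (of_nat (nat m - k) * cw \<zeta>) (k + 1))"
      unfolding drep_monom_def x n su2_of_nth unfolding pc distrib_left distrib_right smult_add_right
        mult_smult_left mult_monom smult_monom
      by (cases k) simp_all
    moreover have "2 * of_real (\<zeta> $ 1) * (\<i> * (of_nat k - of_int m / 2))
        = of_nat k * (cu \<zeta> / 2) + (of_int m - of_nat k) * (- cu \<zeta> / 2)"
      "(of_real (\<zeta> $ 2) - \<i> * of_real (\<zeta> $ 3)) * - of_nat k = of_nat k * - cv \<zeta>"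
      "(of_real (\<zeta> $ 2) + \<i> * of_real (\<zeta> $ 3)) * (of_int m - of_nat k) = (of_int m - of_nat k) * cw \<zeta>"
      by (simp_all add: cu_def cv_def cw_def field_simps)
    ultimately show ?thesis
      unfolding nk smult_monom by (simp only: add_monom[symmetric] add_ac)
  qed
  then show ?thesis unfolding drep_eq[OF assms] rho0_def clifford_def on_monomials_def
    by (intro sum.cong refl) (simp only: atMost_iff)
qed

text \<open>Differentiate \<open>rep h rep (1 + t A) = rep (1 + t h A h\<inverse>) rep
  h\<close>.\<close>

lemma rep_drep:
  assumes h: "h \<in> SU2" and p: "p \<in> V_space m"
  shows "rep m h (drep m A p) = drep m (h ** A ** adj h) (rep m h p)"
proof -
  have "coeff_deriv (\<lambda>t. rep m h (rep m (mat 1 + t *\<^sub>R A) p)) (rep m h (drep m A p))"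
    unfolding rep_def[of m h] by (rule coeff_deriv_on_monomials[OF coeff_deriv_drep[OF p]])
  moreover have "rep m h (rep m (mat 1 + t *\<^sub>R A) p) = rep m (mat 1 + t *\<^sub>R (h ** A ** adj h)) (rep m h p)" for t
    by (simp add: rep_comp p mat_mult_simps SU2_cancel[OF h])
  ultimately have "coeff_deriv (\<lambda>t. rep m (mat 1 + t *\<^sub>R (h ** A ** adj h)) (rep m h p)) (rep m h (drep m A p))"
    by simp
  from drep_eqI[OF this rep_V_space[OF p]] show ?thesis by simp
qed

lemma rep_differentiable: "(\<lambda>h. coeff (rep m h p) n) differentiable (at h0)"
proof -
  have 1: "(\<lambda>h :: complex^2^2. h $ i $ j) \<in> {f. f differentiable (at h0)}" for i j
    by (auto intro!: bounded_linear_imp_differentiable bounded_linear_vec_nth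
      bounded_linear_compose[OF bounded_linear_vec_nth[of j] bounded_linear_vec_nth[of i]])
  have 2: "(\<lambda>h :: complex^2^2. coeff p n) \<in> {f. f differentiable (at h0)}" for n by simp
  show ?thesis using subalg_rep[OF subalg_differentiable 1 2] by simp
qed

text \<open>By multiplicativity the derivative at an arbitrary \<open>g\<close> reduces to that
  at the identity, along \<open>g (1 + t B)\<close>.\<close>

lemma frechet_derivative_rep:
  assumes p: "p \<in> V_space m"
  shows "frechet_derivative (\<lambda>h. coeff (rep m h p) n) (at g) (g ** B) = coeff (rep m g (drep m B p)) n"
proof -
  have c: "((\<lambda>t::real. g + t *\<^sub>R (g ** B)) has_vector_derivative g ** B) (at 0)"
    by (auto intro!: derivative_eq_intros)
  have f: "((\<lambda>h. coeff (rep m h p) n) has_derivative frechet_derivative (\<lambda>h. coeff (rep m h p) n) (at g)) (at g)"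
    using rep_differentiable by (simp add: frechet_derivative_works)
  then have f0: "((\<lambda>h. coeff (rep m h p) n) has_derivative frechet_derivative (\<lambda>h. coeff (rep m h p) n) (at g))
      (at (g + 0 *\<^sub>R (g ** B)))" by simp
  have "((\<lambda>t::real. coeff (rep m (g + t *\<^sub>R (g ** B)) p) n) has_vector_derivative
     frechet_derivative (\<lambda>h. coeff (rep m h p) n) (at g) (g ** B)) (at 0)"
    using has_derivative_compose[OF c[unfolded has_vector_derivative_def] f0]
      linear_scale[OF has_derivative_linear[OF f]]
    by (simp add: has_vector_derivative_def)
  moreover have "coeff_deriv (\<lambda>t. rep m g (rep m (mat 1 + t *\<^sub>R B) p)) (rep m g (drep m B p))"
    unfolding rep_def[of m g] by (rule coeff_deriv_on_monomials[OF coeff_deriv_drep[OF p]])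
  then have "((\<lambda>t::real. coeff (rep m (g + t *\<^sub>R (g ** B)) p) n) has_vector_derivative
      coeff (rep m g (drep m B p)) n) (at 0)"
    by (simp add: coeff_deriv_def rep_comp p mat_mult_simps)
  ultimately show ?thesis by (rule vector_derivative_unique_at)
qed

section \<open>Equivariance of the Clifford homomorphisms\<close>

text \<open>This is the condition under which \<open>F\<close> induces a map of the associated
  bundles.\<close>

definition equivariant :: "int \<Rightarrow> int \<Rightarrow> (real^3 \<Rightarrow> complex poly \<Rightarrow> complex poly) \<Rightarrow> bool" where
  "equivariant m m' F \<longleftrightarrow> (\<forall>h\<in>SU2. \<forall>\<xi>. \<forall>v\<in>V_space m. F (Ad h \<xi>) (rep m h v) = rep m' h (F \<xi> v))"

lemma rho0_equivariant:
  assumes "h \<in> SU2" "p \<in> V_space m"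
  shows "rho0 m (Ad h \<xi>) (rep m h p) = rep m h (rho0 m \<xi> p)"
  using assms by (simp add: rep_drep rep_V_space su2_of_Ad flip: drep_su2_of)

text \<open>\<open>rho_plus\<close> is multiplication by this polynomial, which is the product
  of the row \<open>(z, 1)\<close>, the matrix \<open>su2_of \<xi>\<close> and the column
  \<open>(1, - z)\<close>.\<close>

definition quadric :: "real^3 \<Rightarrow> complex poly" where
  "quadric \<xi> = [:- cv \<xi>, cu \<xi>, - cw \<xi>:]"

lemma rho_plus_eq:
  assumes "p \<in> V_space m"
  shows "rho_plus m \<xi> p = quadric \<xi> * p"
proof (rule poly_eqI)
  fix n
  have c: "coeff (rho_plus m \<xi> p) n = cu \<xi> * icoeff p (int n - 1) - cv \<xi> * coeff p n - cw \<xi> * icoeff p (int n - 2)"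
    using icoeff_rho_plus[OF assms, of \<xi> "int n"] unfolding icoeff_int .
  have q: "quadric \<xi> * p = smult (- cv \<xi>) p + pCons 0 (smult (cu \<xi>) p + pCons 0 (smult (- cw \<xi>) p))"
    by (simp add: quadric_def)
  show "coeff (rho_plus m \<xi> p) n = coeff (quadric \<xi> * p) n"
  proof (cases n)
    case 0
    then show ?thesis unfolding c q by (simp add: icoeff_def)
  next
    case (Suc k)
    have "int n - 1 = int k" using Suc by simp
    then have 1: "icoeff p (int n - 1) = coeff p k" by (simp only: icoeff_int)
    show ?thesis
    proof (cases k)
      case 0
      then show ?thesis using Suc unfolding c q 1 by (simp add: icoeff_def)
    next
      case (Suc l)
      have "int n - 2 = int l" using Suc \<open>n = Suc k\<close> by simp
      then have 2: "icoeff p (int n - 2) = coeff p l" by (simp only: icoeff_int)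
      show ?thesis unfolding c q 1 2 using Suc \<open>n = Suc k\<close> by simp
    qed
  qed
qed

lemma quadric_V_space: "quadric \<xi> \<in> V_space 2"
  by (auto simp: quadric_def V_space_def)

lemma quadric_eq_0: "quadric \<xi> = 0 \<longleftrightarrow> \<xi> = 0"
  by (auto simp: quadric_def cu_def cv_def cw_def complex_eq_iff vec_eq_iff forall_3)

text \<open>The entries of \<open>h su2_of \<xi> h\<inverse>\<close> are quadratic in those of
  \<open>h\<close>, since the inverse in \<open>SU(2)\<close> is the adjugate; comparing them
  with the substitution in the quadric gives the claim.\<close>

lemma rep_quadric:
  assumes h: "h \<in> SU2"
  shows "rep 2 h (quadric \<xi>) = quadric (Ad h \<xi>)"
proof -
  define t where "t = cu \<xi> / 2"
  have t: "cu \<xi> = 2 * t" "su2_of \<xi> $ 1 $ 1 = t" "su2_of \<xi> $ 2 $ 2 = - t"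
      "su2_of \<xi> $ 1 $ 2 = cw \<xi>" "su2_of \<xi> $ 2 $ 1 = - cv \<xi>"
    by (simp_all add: t_def su2_of_nth)
  have A: "su2_of (Ad h \<xi>) = h ** su2_of \<xi> ** adj h" by (rule su2_of_Ad[OF h])
  have "cu (Ad h \<xi>) = 2 * (h ** su2_of \<xi> ** adj h) $ 1 $ 1"
    "cw (Ad h \<xi>) = (h ** su2_of \<xi> ** adj h) $ 1 $ 2" "cv (Ad h \<xi>) = - (h ** su2_of \<xi> ** adj h) $ 2 $ 1"
    unfolding A[symmetric] su2_of_nth by simp_all
  then have c: "cu (Ad h \<xi>) = cu \<xi> * (h $ 1 $ 1 * h $ 2 $ 2 + h $ 1 $ 2 * h $ 2 $ 1)
       - 2 * cv \<xi> * h $ 1 $ 2 * h $ 2 $ 2 - 2 * cw \<xi> * h $ 1 $ 1 * h $ 2 $ 1"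
    "cw (Ad h \<xi>) = cw \<xi> * h $ 1 $ 1 ^ 2 + cv \<xi> * h $ 1 $ 2 ^ 2 - cu \<xi> * h $ 1 $ 1 * h $ 1 $ 2"
    "cv (Ad h \<xi>) = cw \<xi> * h $ 2 $ 1 ^ 2 + cv \<xi> * h $ 2 $ 2 ^ 2 - cu \<xi> * h $ 2 $ 1 * h $ 2 $ 2"
    by (simp_all add: matrix_matrix_mult_def sum_2 t adj_def SU2_entries[OF h] algebra_simps power2_eq_square)
  have s: "{..2::nat} = {0, 1, 2}" by auto
  have "rep 2 h (quadric \<xi>) = smult (- cv \<xi>) (form2 h ^ 2) + smult (cu \<xi>) (form2 h * form1 h)
      + smult (- cw \<xi>) (form1 h ^ 2)"
    by (simp add: rep_def on_monomials_def quadric_def s numeral_2_eq_2)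
  moreover have "form2 h ^ 2 = [:h $ 2 $ 2 ^ 2, 2 * h $ 1 $ 2 * h $ 2 $ 2, h $ 1 $ 2 ^ 2:]"
    "form2 h * form1 h = [:h $ 2 $ 2 * h $ 2 $ 1, h $ 1 $ 1 * h $ 2 $ 2 + h $ 1 $ 2 * h $ 2 $ 1, h $ 1 $ 2 * h $ 1 $ 1:]"
    "form1 h ^ 2 = [:h $ 2 $ 1 ^ 2, 2 * h $ 1 $ 1 * h $ 2 $ 1, h $ 1 $ 1 ^ 2:]"
    by (simp_all add: power2_eq_square algebra_simps)
  ultimately show ?thesis
    unfolding quadric_def c by (simp only: smult_pCons smult_0_right add_pCons add_0_right) (simp add: algebra_simps)
qed

lemma rho_plus_equivariant:
  assumes h: "h \<in> SU2" and p: "p \<in> V_space m"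
  shows "rho_plus m (Ad h \<xi>) (rep m h p) = rep (m + 2) h (rho_plus m \<xi> p)"
proof (cases "m < 0")
  case True
  then show ?thesis using p by (simp add: V_space_neg rho_plus_eq)
next
  case False
  have "rep (2 + m) h (quadric \<xi> * p) = quadric (Ad h \<xi>) * rep m h p"
    unfolding rep_quadric[OF h, symmetric] by (rule rep_mult[OF quadric_V_space p]) (use False in auto)
  then show ?thesis
    unfolding rho_plus_eq[OF p] rho_plus_eq[OF rep_V_space[OF p]] by (simp only: add.commute[of m 2])
qed

text \<open>The relation for \<open>rho0 rho0 + rho_plus rho_minus\<close> expresses the
  composition \<open>rho_plus rho_minus\<close> by equivariant maps. As \<open>rho_plus\<close>
  is equivariant and, at a nonzero vector, multiplication by a nonzero polynomial and hence
  injective, the factor \<open>rho_minus\<close> is equivariant too.\<close>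

lemma rho_minus_equivariant:
  assumes h: "h \<in> SU2" and p: "p \<in> V_space m"
  shows "rho_minus m (Ad h \<xi>) (rep m h p) = rep (m - 2) h (rho_minus m \<xi> p)"
proof -
  \<comment> \<open>any nonzero vector, so that the quadric of its image under \<open>Ad h\<close> is nonzero\<close>
  define \<eta> :: "real^3" where "\<eta> = axis 1 1"
  let ?d = "rho_minus m (Ad h \<xi>) (rep m h p) - rep (m - 2) h (rho_minus m \<xi> p)"
  note V = rho_V_space p rep_V_space V_space_diff
  have "rho_plus (m - 2) (Ad h \<eta>) (rho_minus m (Ad h \<xi>) (rep m h p))
      = rep m h (rho_plus (m - 2) \<eta> (rho_minus m \<xi> p))"
  proof -
    have "rep m h (rho0 m \<eta> (rho0 m \<xi> p)) + rep m h (rho_plus (m - 2) \<eta> (rho_minus m \<xi> p))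
      = rep m h (smult (- (of_int m)\<^sup>2 * of_real (\<eta> \<bullet> \<xi>)) p + smult (of_int m) (rho0 m (cross3 \<eta> \<xi>) p))"
      unfolding clifford_relation_minus_plus[OF p, symmetric] rep_add ..
    also have "\<dots> = smult (- (of_int m)\<^sup>2 * of_real (Ad h \<eta> \<bullet> Ad h \<xi>)) (rep m h p)
       + smult (of_int m) (rho0 m (cross3 (Ad h \<eta>) (Ad h \<xi>)) (rep m h p))"
      by (simp add: rep_add rep_diff rep_smult Ad_cross_inner(2)[OF h] rho0_equivariant h V
          flip: Ad_cross_inner(1)[OF h])
    also have "\<dots> = rho0 m (Ad h \<eta>) (rho0 m (Ad h \<xi>) (rep m h p))
       + rho_plus (m - 2) (Ad h \<eta>) (rho_minus m (Ad h \<xi>) (rep m h p))"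
      by (rule clifford_relation_minus_plus[symmetric]) (rule rep_V_space[OF p])
    finally show ?thesis by (simp add: rho0_equivariant h V)
  qed
  also have "\<dots> = rho_plus (m - 2) (Ad h \<eta>) (rep (m - 2) h (rho_minus m \<xi> p))"
    using rho_plus_equivariant[OF h rho_minus_V_space[OF p]] by simp
  finally have "quadric (Ad h \<eta>) * ?d = 0"
    by (simp add: rho_plus_eq[of _ "m - 2"] V algebra_simps)
  moreover have "Ad h \<eta> \<noteq> 0"
    using Ad_cross_inner(2)[OF h, of \<eta> \<eta>] by (auto simp: \<eta>_def inner_axis_axis)
  ultimately show ?thesis by (simp add: quadric_eq_0)
qed

section \<open>Frames and the Levi-Civita connection\<close>

lemma tcomb_axis: "tcomb e (axis i 1) = e i"
  by (auto simp: tcomb_def axis_def if_distrib[where f="\<lambda>u. u *\<^sub>R _"] fun_eq_iff cong: if_cong)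

lemma tcomb_nested: "tcomb e \<xi> = tlin 1 (tlin (\<xi> $ 1) (e 1) (\<xi> $ 2) (e 2)) (\<xi> $ 3) (e 3)"
  by (simp add: tcomb_def tlin_def sum_3)

lemma linear_tcomb: "linear (\<lambda>\<xi>. tcomb e \<xi> c)"
  by (rule linearI) (simp_all add: tcomb_def scaleR_add_left sum.distrib scaleR_right.sum)

lemma vec3_expand: "(\<xi>::real^3) = (\<Sum>i\<in>UNIV. \<xi> $ i *\<^sub>R axis i 1)"
  by (simp add: vec_eq_iff sum_3 forall_3 axis_def)

locale spin_manifold = manifold3 M for M :: "('a, 'p) spin3" +
  assumes riem: "riemannian_metric M" and lc: "levi_civita M" and spin: "spin_structure M"
begin

lemma chart_change_linear:
  assumes "chart_at M x c" "chart_at M x d"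
  shows "linear (frechet_derivative (chart_change c d) (at (snd c x)))"
  using chart_change_differentiable[OF assms] by (rule linear_frechet_derivative)

lemma tangentD:
  assumes "v \<in> tangent M x"
  shows "chart_at M x c \<Longrightarrow> chart_at M x d \<Longrightarrow> v d = frechet_derivative (chart_change c d) (at (snd c x)) (v c)"
    and "\<not> chart_at M x c \<Longrightarrow> v c = 0"
  using assms unfolding tangent_def by blast+

lemma tangent_tlin:
  assumes "v \<in> tangent M x" "w \<in> tangent M x"
  shows "tlin a v b w \<in> tangent M x"
  unfolding tangent_def
proof (intro CollectI conjI allI impI)
  fix c assume "\<not> chart_at M x c"
  then show "tlin a v b w c = 0" using assms[THEN tangentD(2)] by (simp add: tlin_def)
next
  fix c d assume cd: "chart_at M x c" "chart_at M x d"
  show "tlin a v b w d = frechet_derivative (chart_change c d) (at (snd c x)) (tlin a v b w c)"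
    using chart_change_linear[OF cd] tangentD(1)[OF assms(1) cd] tangentD(1)[OF assms(2) cd]
    by (simp add: tlin_def linear_add linear_scale)
qed

lemma tangent_tcomb: "(\<And>i. e i \<in> tangent M x) \<Longrightarrow> tcomb e \<xi> \<in> tangent M x"
  unfolding tcomb_nested by (intro tangent_tlin)

lemma tangent_eqI:
  assumes "v \<in> tangent M x" "w \<in> tangent M x" "chart_at M x c" "v c = w c"
  shows "v = w"
proof
  fix d show "v d = w d"
    using tangentD(1)[OF assms(1), of c d] tangentD(1)[OF assms(2), of c d] assms(3,4)
      tangentD(2)[OF assms(1), of d] tangentD(2)[OF assms(2), of d]
    by (cases "chart_at M x d") auto
qed

lemma onb_in_tangent: "oriented_onb M x e \<Longrightarrow> e i \<in> tangent M x"
  by (simp add: oriented_onb_def)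

lemma onb_det: "oriented_onb M x e \<Longrightarrow> chart_at M x c \<Longrightarrow> det (\<chi> i. e i c) > 0"
  unfolding oriented_onb_def by blast

text \<open>The determinant condition of an oriented basis makes its coordinate vectors in a
  chart linearly independent, and a tangent vector is determined by its coordinates in a single
  chart.\<close>

lemma onb_expand:
  assumes e: "oriented_onb M x e" and x: "x \<in> topspace (base M)" and v: "v \<in> tangent M x"
  shows "\<exists>\<xi>. v = tcomb e \<xi>"
proof -
  obtain c where c: "chart_at M x c" using ex_chart_at[OF x] by blast
  let ?A = "\<chi> i. e i c"
  have "det ?A > 0" by (rule onb_det[OF e c])
  then have "invertible (transpose ?A)" by (simp add: invertible_det_nz)
  then obtain B where "transpose ?A ** B = mat 1" by (auto simp: invertible_def)
  then have "transpose ?A *v (B *v v c) = v c" by (simp add: matrix_vector_mul_assoc)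
  moreover have "transpose ?A *v \<xi> = tcomb e \<xi> c" for \<xi>
    by (simp add: vec_eq_iff matrix_vector_mult_def transpose_def tcomb_def mult.commute)
  ultimately have "tcomb e (B *v v c) c = v c" by simp
  then have "v = tcomb e (B *v v c)"
    by (intro tangent_eqI[OF v tangent_tcomb c]) (use e in \<open>auto simp: oriented_onb_def\<close>)
  then show ?thesis by blast
qed

lemma metric_sym: "x \<in> topspace (base M) \<Longrightarrow> v \<in> tangent M x \<Longrightarrow> w \<in> tangent M x \<Longrightarrow> metric M x v w = metric M x w v"
  using riem unfolding riemannian_metric_def by blast

lemma metric_tlin:
  assumes "x \<in> topspace (base M)" "u \<in> tangent M x" "v \<in> tangent M x" "w \<in> tangent M x"
  shows "metric M x (tlin a u b v) w = a * metric M x u w + b * metric M x v w"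
  using riem assms unfolding riemannian_metric_def by blast

lemma metric_tcomb_left:
  assumes "x \<in> topspace (base M)" "\<And>i. e i \<in> tangent M x" "w \<in> tangent M x"
  shows "metric M x (tcomb e \<xi>) w = (\<Sum>i\<in>UNIV. \<xi> $ i * metric M x (e i) w)"
  unfolding tcomb_nested sum_3 using assms by (simp add: metric_tlin tangent_tlin)

lemma metric_tcomb:
  assumes e: "oriented_onb M x e" and x: "x \<in> topspace (base M)"
  shows "metric M x (tcomb e \<xi>) (e i) = \<xi> $ i"
    and "metric M x (tcomb e \<xi>) (tcomb e \<eta>) = \<xi> \<bullet> \<eta>"
proof -
  have o: "metric M x (e i) (e j) = (if i = j then 1 else 0)" for i j
    using e by (simp add: oriented_onb_def)
  note t = onb_in_tangent[OF e]
  show 1: "metric M x (tcomb e \<xi>) (e i) = \<xi> $ i" for \<xi> i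
    using exhaust_3[of i] by (auto simp: metric_tcomb_left[OF x t t] o sum_3)
  have "metric M x (e i) (tcomb e \<eta>) = \<eta> $ i" for i
    by (simp add: metric_sym[OF x t tangent_tcomb[OF t]] 1)
  then show "metric M x (tcomb e \<xi>) (tcomb e \<eta>) = \<xi> \<bullet> \<eta>"
    by (simp add: metric_tcomb_left[OF x t tangent_tcomb[OF t]] inner_vec_def)
qed

lemma tcomb_inject:
  assumes "oriented_onb M x e" "x \<in> topspace (base M)"
  shows "tcomb e \<xi> = tcomb e \<eta> \<longleftrightarrow> \<xi> = \<eta>"
  using metric_tcomb(1)[OF assms] by (metis vec_eq_iff)

lemma onb_expand_metric:
  assumes e: "oriented_onb M x e" and x: "x \<in> topspace (base M)" and v: "v \<in> tangent M x"
  shows "v = tcomb e (\<chi> i. metric M x v (e i))"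
proof -
  obtain \<xi> where \<xi>: "v = tcomb e \<xi>" using onb_expand[OF assms] by blast
  have "(\<chi> i. metric M x v (e i)) = \<xi>" unfolding \<xi> metric_tcomb(1)[OF e x] by simp
  then show ?thesis using \<xi> by simp
qed

text \<open>Orthonormality makes the coordinate matrix orthogonal, and the positive determinants
  of the two bases in a chart make it a rotation, which commutes with the cross product.\<close>

lemma onb_change:
  assumes e: "oriented_onb M x (\<lambda>i. tcomb E (a i))" and E: "oriented_onb M x E"
    and x: "x \<in> topspace (base M)"
  shows "a i \<bullet> a j = (if i = j then 1 else 0)"
    and "cross3 (a 1) (a 2) = a 3" "cross3 (a 2) (a 3) = a 1" "cross3 (a 3) (a 1) = a 2"
    and "(\<Sum>i\<in>UNIV. a i $ k * a i $ l) = (if k = l then 1 else 0)"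
proof -
  show o: "a i \<bullet> a j = (if i = j then 1 else 0)" for i j
    using e by (simp add: oriented_onb_def metric_tcomb(2)[OF E x])
  define A where "A = (\<chi> i. a i)"
  have AT: "A ** transpose A = mat 1"
    using o by (simp add: vec_eq_iff A_def matrix_matrix_mult_def transpose_def mat_def inner_vec_def)
  then have TA: "transpose A ** A = mat 1" by (simp add: matrix_left_right_inverse)
  have "(transpose A ** A) $ k $ l = (if k = l then 1 else 0)" by (simp add: TA mat_def)
  then show "(\<Sum>i\<in>UNIV. a i $ k * a i $ l) = (if k = l then 1 else 0)"
    by (simp add: matrix_matrix_mult_def transpose_def A_def)
  obtain c where c: "chart_at M x c" using ex_chart_at[OF x] by blast
  have "(\<chi> i. tcomb E (a i) c) = A ** (\<chi> i. E i c)"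
    by (simp add: vec_eq_iff matrix_matrix_mult_def A_def tcomb_def)
  moreover have "det (\<chi> i. tcomb E (a i) c) > 0" "det (\<chi> i. E i c) > 0"
    using onb_det[OF e c] onb_det[OF E c] by auto
  ultimately have "det A > 0" by (simp add: det_mul zero_less_mult_iff)
  moreover have oA: "orthogonal_matrix (transpose A)" using AT TA by (simp add: orthogonal_matrix_def)
  ultimately have rot: "rotation_matrix (transpose A)"
    using det_orthogonal_matrix[OF oA] by (auto simp: rotation_matrix_def)
  have ax: "transpose A *v axis i 1 = a i" for i
    by (simp add: vec_eq_iff matrix_vector_mult_def transpose_def A_def axis_def if_distrib cong: if_cong)
  have "cross3 (a i) (a j) = transpose A *v cross3 (axis i 1) (axis j 1)" for i j
    using cross_rotation_matrix[OF rot, of "axis i 1" "axis j 1"] unfolding ax .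
  then show "cross3 (a 1) (a 2) = a 3" "cross3 (a 2) (a 3) = a 1" "cross3 (a 3) (a 1) = a 2"
    unfolding cross_basis by (simp_all only: cross_basis ax)
qed

subsection \<open>Vector fields\<close>

lemma smooth_vfieldD:
  "smooth_vfield M U X \<Longrightarrow> x \<in> U \<Longrightarrow> X x \<in> tangent M x"
  by (auto simp: smooth_vfield_def)

lemma smooth_vfield_subset:
  assumes "smooth_vfield M U X" "V \<subseteq> U" shows "smooth_vfield M V X"
  using assms unfolding smooth_vfield_def
  by (auto intro: smooth_fun_subset[of "U \<inter> _"])

lemma smooth_vfield_cong:
  assumes "openin (base M) U" "\<And>y. y \<in> U \<Longrightarrow> X y = Y y" "smooth_vfield M U X"
  shows "smooth_vfield M U Y"
  unfolding smooth_vfield_def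
proof (intro conjI ballI)
  fix x assume "x \<in> U" then show "Y x \<in> tangent M x" using assms smooth_vfieldD by metis
next
  fix c assume c: "c \<in> atlas M"
  have "smooth_fun M (U \<inter> fst c) (\<lambda>x. X x c)" using assms(3) c by (simp add: smooth_vfield_def)
  then show "smooth_fun M (U \<inter> fst c) (\<lambda>x. Y x c)"
    using smooth_fun_cong[of "U \<inter> fst c" "\<lambda>x. X x c" "\<lambda>x. Y x c"] assms chart_openin[OF c] by auto
qed

lemma smooth_vfield_lin:
  assumes U: "openin (base M) U" and X: "smooth_vfield M U X" and Y: "smooth_vfield M U Y"
    and f: "smooth_fun M U f" and g: "smooth_fun M U g"
  shows "smooth_vfield M U (\<lambda>x. tlin (f x) (X x) (g x) (Y x))"
  unfolding smooth_vfield_def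
proof (intro conjI ballI)
  fix x assume "x \<in> U"
  then show "tlin (f x) (X x) (g x) (Y x) \<in> tangent M x"
    using X Y by (intro tangent_tlin) (auto simp: smooth_vfield_def)
next
  fix c assume c: "c \<in> atlas M"
  have o: "openin (base M) (U \<inter> fst c)" using U chart_openin[OF c] by auto
  show "smooth_fun M (U \<inter> fst c) (\<lambda>x. tlin (f x) (X x) (g x) (Y x) c)"
    unfolding tlin_def using X Y c
    by (intro smooth_fun_add smooth_fun_scaleR o smooth_fun_subset[OF f] smooth_fun_subset[OF g])
      (auto simp: smooth_vfield_def)
qed

lemma smooth_vfield_scale:
  assumes "openin (base M) U" "smooth_vfield M U X" "smooth_fun M U f"
  shows "smooth_vfield M U (\<lambda>y c. f y *\<^sub>R X y c)"
  using smooth_vfield_lin[OF assms(1,2,2,3) smooth_fun_const[of U 0]] by (simp add: tlin_def)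

lemma smooth_vfield_tcomb:
  assumes U: "openin (base M) U" and E: "\<And>i. smooth_vfield M U (E i)" and a: "smooth_fun M U a"
  shows "smooth_vfield M U (\<lambda>y. tcomb (\<lambda>i. E i y) (a y))"
  unfolding tcomb_nested
  by (intro smooth_vfield_lin U E smooth_fun_const smooth_fun_nth[OF U a])

lemma lc_rules:
  assumes "openin (base M) U" "smooth_vfield M U Y" "x \<in> U" "v \<in> tangent M x"
  shows "lc M x v Y \<in> tangent M x"
    and "w \<in> tangent M x \<Longrightarrow> lc M x (tlin a v b w) Y = tlin a (lc M x v Y) b (lc M x w Y)"
    and "smooth_vfield M U Z \<Longrightarrow> lc M x v (\<lambda>y. tlin 1 (Y y) 1 (Z y)) = tlin 1 (lc M x v Y) 1 (lc M x v Z)"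
    and "smooth_vfield M U Z \<Longrightarrow> (\<And>y. y \<in> U \<Longrightarrow> Y y = Z y) \<Longrightarrow> lc M x v Y = lc M x v Z"
    and "smooth_fun M U f \<Longrightarrow> lc M x v (\<lambda>y c. f y *\<^sub>R Y y c) = tlin (ddir M x v f) (Y x) (f x) (lc M x v Y)"
proof -
  note A = lc[unfolded levi_civita_def affine_connection_def, THEN conjunct1, THEN conjunct1,
      rule_format, OF conjI[OF assms(1,2)] assms(3,4)]
  show "lc M x v Y \<in> tangent M x" by (rule A[THEN conjunct1])
  note A = A[THEN conjunct2]
  show "w \<in> tangent M x \<Longrightarrow> lc M x (tlin a v b w) Y = tlin a (lc M x v Y) b (lc M x w Y)"
    by (rule A[THEN conjunct1, rule_format])
  note A = A[THEN conjunct2]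
  show "smooth_vfield M U Z \<Longrightarrow> lc M x v (\<lambda>y. tlin 1 (Y y) 1 (Z y)) = tlin 1 (lc M x v Y) 1 (lc M x v Z)"
    by (rule A[THEN conjunct1, rule_format])
  note A = A[THEN conjunct2]
  show "smooth_vfield M U Z \<Longrightarrow> (\<And>y. y \<in> U \<Longrightarrow> Y y = Z y) \<Longrightarrow> lc M x v Y = lc M x v Z"
    by (rule A[THEN conjunct1, rule_format]) blast
  show "smooth_fun M U f \<Longrightarrow> lc M x v (\<lambda>y c. f y *\<^sub>R Y y c) = tlin (ddir M x v f) (Y x) (f x) (lc M x v Y)"
    by (rule A[THEN conjunct2, rule_format])
qed

lemma lc_smooth: "openin (base M) U \<Longrightarrow> smooth_vfield M U X \<Longrightarrow> smooth_vfield M U Y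
    \<Longrightarrow> smooth_vfield M U (\<lambda>x. lc M x (X x) Y)"
  by (rule lc[unfolded levi_civita_def affine_connection_def, THEN conjunct1, THEN conjunct2,
    rule_format]) (intro conjI)

lemma lc_metric:
  assumes "openin (base M) U" "smooth_vfield M U Y" "smooth_vfield M U Z" "x \<in> U" "v \<in> tangent M x"
  shows "ddir M x v (\<lambda>y. metric M y (Y y) (Z y)) =
             metric M x (lc M x v Y) (Z x) + metric M x (Y x) (lc M x v Z)"
  by (rule lc[unfolded levi_civita_def, THEN conjunct2, THEN conjunct1,
    rule_format, OF conjI[OF assms(1) conjI[OF assms(2,3)]] assms(4,5)])

lemma lc_torsion:
  assumes "openin (base M) U" "smooth_vfield M U X" "smooth_vfield M U Y" "x \<in> U"
  shows "lie_bracket M X Y x = tlin 1 (lc M x (X x) Y) (-1) (lc M x (Y x) X)"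
  by (rule lc[unfolded levi_civita_def, THEN conjunct2, THEN conjunct2,
    rule_format, OF conjI[OF assms(1) conjI[OF assms(2,3)]] assms(4), symmetric])

lemma metric_smooth: "openin (base M) U \<Longrightarrow> smooth_vfield M U X \<Longrightarrow> smooth_vfield M U Y
    \<Longrightarrow> smooth_fun M U (\<lambda>x. metric M x (X x) (Y x))"
  by (rule riem[unfolded riemannian_metric_def, THEN conjunct2, rule_format]) (intro conjI)

lemma lc_tcomb:
  assumes U: "openin (base M) U" "x \<in> U" and E: "\<And>i. smooth_vfield M U (E i)"
    and a: "smooth_fun M U a" and v: "v \<in> tangent M x"
  shows "lc M x v (\<lambda>y. tcomb (\<lambda>i. E i y) (a y)) = (\<lambda>c. \<Sum>i\<in>UNIV.
     (ddir M x v a $ i) *\<^sub>R E i x c + (a x $ i) *\<^sub>R lc M x v (E i) c)"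
proof -
  have s: "smooth_fun M U (\<lambda>y. a y $ i)" for i by (rule smooth_fun_nth[OF U(1) a])
  have sv: "smooth_vfield M U (\<lambda>y c. (a y $ i) *\<^sub>R E i y c)" for i
    by (rule smooth_vfield_scale[OF U(1) E s])
  have sv2: "smooth_vfield M U (\<lambda>y. tlin 1 (\<lambda>c. (a y $ 1) *\<^sub>R E 1 y c) 1 (\<lambda>c. (a y $ 2) *\<^sub>R E 2 y c))"
    by (rule smooth_vfield_lin[OF U(1) sv sv smooth_fun_const smooth_fun_const])
  have e: "(\<lambda>y. tcomb (\<lambda>i. E i y) (a y)) = (\<lambda>y. tlin 1 (tlin 1 (\<lambda>c. (a y $ 1) *\<^sub>R E 1 y c) 1 (\<lambda>c. (a y $ 2) *\<^sub>R E 2 y c))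
      1 (\<lambda>c. (a y $ 3) *\<^sub>R E 3 y c))"
    by (simp add: tcomb_def sum_3 tlin_def)
  have d: "ddir M x v (\<lambda>y. a y $ i) = ddir M x v a $ i" for i
    by (rule ddir_linear[OF bounded_linear_vec_nth U a])
  have l: "lc M x v (\<lambda>y c. (a y $ i) *\<^sub>R E i y c) = tlin (ddir M x v a $ i) (E i x) (a x $ i) (lc M x v (E i))" for i
    using lc_rules(5)[OF U(1) E U(2) v s] by (simp add: d)
  show ?thesis
    unfolding e lc_rules(3)[OF U(1) sv2 U(2) v sv] lc_rules(3)[OF U(1) sv U(2) v sv] l
    by (simp add: tlin_def sum_3)
qed

text \<open>Differentiate the constant functions \<open>metric (E j) (E k)\<close>.\<close>

lemma lc_onframe_skew:
  assumes E: "local_onframe M U E" and x: "x \<in> U" and v: "v \<in> tangent M x"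
  shows "metric M x (lc M x v (E j)) (E k x) = - metric M x (lc M x v (E k)) (E j x)"
proof -
  have U: "openin (base M) U" and sm: "\<And>i. smooth_vfield M U (E i)"
    and onb: "\<And>y. y \<in> U \<Longrightarrow> oriented_onb M y (\<lambda>i. E i y)"
    using E by (auto simp: local_onframe_def)
  have xt: "x \<in> topspace (base M)" using U x openin_subset by blast
  have "ddir M x v (\<lambda>y. metric M y (E j y) (E k y)) = ddir M x v (\<lambda>y. if j = k then 1 else 0 :: real)"
    by (rule ddir_cong[OF U x]) (use onb in \<open>auto simp: oriented_onb_def\<close>)
  then have "metric M x (lc M x v (E j)) (E k x) + metric M x (E j x) (lc M x v (E k)) = 0"
    by (simp add: lc_metric[OF U sm sm x v] ddir_const)
  moreover have "metric M x (E j x) (lc M x v (E k)) = metric M x (lc M x v (E k)) (E j x)"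
    by (rule metric_sym[OF xt smooth_vfieldD[OF sm x] lc_rules(1)[OF U sm x v]])
  ultimately show ?thesis by simp
qed

end

section \<open>The spin bundle\<close>

context spin_manifold begin

lemma principal: "principal_SU2_bundle M"
  using spin by (simp add: spin_structure_def)

lemma fibre_facts:
  assumes "p \<in> spin_fibre M x"
  shows "x \<in> topspace (base M)" "spin_act M p (mat 1) = p"
    and "h \<in> SU2 \<Longrightarrow> spin_act M p h \<in> spin_fibre M x"
    and "h \<in> SU2 \<Longrightarrow> k \<in> SU2 \<Longrightarrow> spin_act M (spin_act M p h) k = spin_act M p (h ** k)"
    and "q \<in> spin_fibre M x \<Longrightarrow> \<exists>h\<in>SU2. q = spin_act M p h"
    and "h \<in> SU2 \<Longrightarrow> k \<in> SU2 \<Longrightarrow> spin_act M p h = spin_act M p k \<Longrightarrow> h = k"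
proof -
  have p: "p \<in> spin_total M" "spin_proj M p = x" using assms by (auto simp: spin_fibre_def)
  note A = principal[unfolded principal_SU2_bundle_def, THEN conjunct1, rule_format, OF p(1), unfolded p(2)]
  have u: "\<exists>!h. h \<in> SU2 \<and> q = spin_act M p h" if "q \<in> spin_fibre M x" for q
    using A[THEN conjunct2, THEN conjunct2, THEN conjunct2] that by (simp only: Ball_def simp_thms)
  show "x \<in> topspace (base M)" "spin_act M p (mat 1) = p" using A by simp_all
  show f: "h \<in> SU2 \<Longrightarrow> spin_act M p h \<in> spin_fibre M x" for h using A by simp
  show "h \<in> SU2 \<Longrightarrow> k \<in> SU2 \<Longrightarrow> spin_act M (spin_act M p h) k = spin_act M p (h ** k)" using A by simp
  show "q \<in> spin_fibre M x \<Longrightarrow> \<exists>h\<in>SU2. q = spin_act M p h" using u by blast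
  show "h \<in> SU2 \<Longrightarrow> k \<in> SU2 \<Longrightarrow> spin_act M p h = spin_act M p k \<Longrightarrow> h = k"
    using u[OF f] by blast
qed

lemma frame_onb: "p \<in> spin_fibre M x \<Longrightarrow> oriented_onb M x (spin_frame M p)"
  using spin unfolding spin_structure_def spin_fibre_def by auto

lemma frame_act:
  "p \<in> spin_fibre M x \<Longrightarrow> h \<in> SU2 \<Longrightarrow> tcomb (spin_frame M (spin_act M p h)) \<xi> = tcomb (spin_frame M p) (Ad h \<xi>)"
  using spin unfolding spin_structure_def spin_fibre_def by auto

lemma spin_transition_eq:
  assumes "s x \<in> spin_fibre M x" "h \<in> SU2" "t x = spin_act M (s x) h"
  shows "spin_transition M s t x = h"
  unfolding spin_transition_def
  by (rule the_equality) (use assms fibre_facts(6)[OF assms(1)] in auto)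

lemma spin_transition_works:
  assumes "s x \<in> spin_fibre M x" "t x \<in> spin_fibre M x"
  shows "spin_transition M s t x \<in> SU2" "t x = spin_act M (s x) (spin_transition M s t x)"
proof -
  obtain h where h: "h \<in> SU2" "t x = spin_act M (s x) h" using fibre_facts(5)[OF assms] by blast
  show "spin_transition M s t x \<in> SU2" "t x = spin_act M (s x) (spin_transition M s t x)"
    using spin_transition_eq[where s=s and t=t and x=x, OF assms(1) h] h by simp_all
qed

subsection \<open>Spinors\<close>

lemma spinor_class_iff:
  assumes p: "p \<in> spin_fibre M x" and h: "h \<in> SU2"
  shows "(spin_act M p h, u) \<in> spinor_class M m p v \<longleftrightarrow> u = rep m (adj h) v"
  using h fibre_facts(6)[OF p] unfolding spinor_class_def by blast

lemma spinor_class_base_iff: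
  assumes p: "p \<in> spin_fibre M x" and v: "v \<in> V_space m"
  shows "(p, u) \<in> spinor_class M m p v \<longleftrightarrow> u = v"
  using spinor_class_iff[OF p SU2_one, of u m v]
  by (simp add: fibre_facts(2)[OF p] adj_simps rep_mat1[OF v])

text \<open>Moving the base point along the fibre by \<open>h\<close> and the vector by
  \<open>h\<inverse>\<close> only reparametrises the class. So every fibre element can be
  represented over a prescribed point of the principal bundle, and all fibrewise operations
  reduce to those on polynomials.\<close>

lemma spinor_class_act:
  assumes p: "p \<in> spin_fibre M x" and h: "h \<in> SU2" and v: "v \<in> V_space m"
  shows "spinor_class M m (spin_act M p h) (rep m (adj h) v) = spinor_class M m p v"
proof -
  have 1: "spin_act M (spin_act M p h) k = spin_act M p (h ** k)"
    "rep m (adj k) (rep m (adj h) v) = rep m (adj (h ** k)) v" if "k \<in> SU2" for k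
    using fibre_facts(4)[OF p h that] by (simp_all add: rep_comp[OF v] adj_simps)
  show ?thesis
  proof (intro equalityI subsetI)
    fix z assume "z \<in> spinor_class M m (spin_act M p h) (rep m (adj h) v)"
    then obtain k where k: "k \<in> SU2" "z = (spin_act M p (h ** k), rep m (adj (h ** k)) v)"
      unfolding spinor_class_def using 1 by auto
    then show "z \<in> spinor_class M m p v" unfolding spinor_class_def using SU2_mult[OF h k(1)] by blast
  next
    fix z assume "z \<in> spinor_class M m p v"
    then obtain k where k: "k \<in> SU2" "z = (spin_act M p k, rep m (adj k) v)"
      unfolding spinor_class_def by blast
    define l where "l = adj h ** k"
    have l: "l \<in> SU2" "h ** l = k"
      using SU2_mult[OF SU2_adj[OF h] k(1)] SU2_inverse(1)[OF h] by (simp_all add: l_def mat_mult_simps)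
    then have "z = (spin_act M (spin_act M p h) l, rep m (adj l) (rep m (adj h) v))"
      using 1[OF l(1)] k(2) by simp
    then show "z \<in> spinor_class M m (spin_act M p h) (rep m (adj h) v)"
      unfolding spinor_class_def using l(1) by blast
  qed
qed

lemma spinor_fibreE:
  assumes "A \<in> spinor_fibre M m x" and p: "p \<in> spin_fibre M x"
  obtains v where "v \<in> V_space m" "A = spinor_class M m p v"
proof -
  obtain q w where q: "q \<in> spin_fibre M x" "w \<in> V_space m" "A = spinor_class M m q w"
    using assms(1) unfolding spinor_fibre_def by blast
  obtain h where h: "h \<in> SU2" "p = spin_act M q h" using fibre_facts(5)[OF q(1) p] by blast
  show ?thesis
    using that[of "rep m (adj h) w"] rep_V_space[OF q(2)] spinor_class_act[OF q(1) h(1) q(2)] h q(3) by simp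
qed

lemma spinor_class_mem:
  "z \<in> spinor_class M m p v \<longleftrightarrow> (\<exists>h\<in>SU2. z = (spin_act M p h, rep m (adj h) v))"
  unfolding spinor_class_def by blast

lemma spinor_scale_class: "spinor_scale a (spinor_class M m p v) = spinor_class M m p (smult a v)"
  unfolding spinor_scale_def spinor_class_def rep_smult by blast

lemma spinor_add_class:
  assumes p: "p \<in> spin_fibre M x"
  shows "spinor_add (spinor_class M m p v) (spinor_class M m p w) = spinor_class M m p (v + w)"
proof (intro equalityI subsetI)
  fix z assume "z \<in> spinor_add (spinor_class M m p v) (spinor_class M m p w)"
  then obtain q u u' where z: "z = (q, u + u')" "(q, u) \<in> spinor_class M m p v" "(q, u') \<in> spinor_class M m p w"
    unfolding spinor_add_def by blast
  then obtain h where "h \<in> SU2" "q = spin_act M p h" "u = rep m (adj h) v"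
    unfolding spinor_class_def by blast
  then show "z \<in> spinor_class M m p (v + w)" using z spinor_class_iff[OF p, of h u' m w]
    by (auto simp: spinor_class_mem rep_add)
next
  fix z assume "z \<in> spinor_class M m p (v + w)"
  then show "z \<in> spinor_add (spinor_class M m p v) (spinor_class M m p w)"
    unfolding spinor_add_def spinor_class_def rep_add by blast
qed

lemma spinor_diff_class:
  assumes p: "p \<in> spin_fibre M x"
  shows "spinor_diff (spinor_class M m p v) (spinor_class M m p w) = spinor_class M m p (v - w)"
  by (simp add: spinor_diff_def spinor_scale_class spinor_add_class[OF p])

text \<open>A pair in the sum determines its base point only through the summands, so the index
  set must not be empty.\<close>

lemma spinor_sum_class:
  assumes p: "p \<in> spin_fibre M x" and I: "I \<noteq> {}"
  shows "spinor_sum I (\<lambda>i. spinor_class M m p (v i)) = spinor_class M m p (\<Sum>i\<in>I. v i)"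
proof (intro equalityI subsetI)
  fix z assume "z \<in> spinor_sum I (\<lambda>i. spinor_class M m p (v i))"
  then obtain q u where z: "z = (q, \<Sum>i\<in>I. u i)" "\<And>i. i \<in> I \<Longrightarrow> (q, u i) \<in> spinor_class M m p (v i)"
    unfolding spinor_sum_def by blast
  from I obtain j where "j \<in> I" by blast
  from z(2)[OF this] obtain h where h: "h \<in> SU2" "q = spin_act M p h"
    unfolding spinor_class_def by blast
  then have "u i = rep m (adj h) (v i)" if "i \<in> I" for i
    using z(2)[OF that] spinor_class_iff[OF p h(1)] by blast
  then have "z = (spin_act M p h, rep m (adj h) (\<Sum>i\<in>I. v i))" using z h by (simp add: rep_sum)
  then show "z \<in> spinor_class M m p (\<Sum>i\<in>I. v i)" using h by (auto simp: spinor_class_mem)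
next
  fix z assume "z \<in> spinor_class M m p (\<Sum>i\<in>I. v i)"
  then show "z \<in> spinor_sum I (\<lambda>i. spinor_class M m p (v i))"
    unfolding spinor_sum_def spinor_class_def rep_sum by blast
qed

text \<open>Equivariance is what turns the pairs obtained over the various points of the fibre
  into one class.\<close>

lemma bundle_map_class:
  assumes p: "p \<in> spin_fibre M x" and v: "v \<in> V_space m" and F: "equivariant m m' F"
  shows "bundle_map M F (tcomb (spin_frame M p) \<xi>) (spinor_class M m p v) = spinor_class M m' p (F \<xi> v)"
proof (intro equalityI subsetI)
  have A: "Ad (adj h) (Ad h \<xi>) = \<xi>" "Ad h (Ad (adj h) \<xi>) = \<xi>" if "h \<in> SU2" for h \<xi>
    using that by (simp_all add: su2_of_inject[symmetric] su2_of_Ad SU2_adj adj_simps mat_mult_simps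
      SU2_inverse SU2_cancel)
  have F': "F (Ad (adj h) \<xi>) (rep m (adj h) v) = rep m' (adj h) (F \<xi> v)" if "h \<in> SU2" for h
    using F v SU2_adj[OF that] unfolding equivariant_def by blast
  {
    fix z assume "z \<in> bundle_map M F (tcomb (spin_frame M p) \<xi>) (spinor_class M m p v)"
    then obtain q u \<eta> where z: "z = (q, F \<eta> u)" "(q, u) \<in> spinor_class M m p v"
      "tcomb (spin_frame M p) \<xi> = tcomb (spin_frame M q) \<eta>" unfolding bundle_map_def by blast
    then obtain h where h: "h \<in> SU2" "q = spin_act M p h" "u = rep m (adj h) v"
      unfolding spinor_class_def by blast
    have "\<xi> = Ad h \<eta>"
      using z(3) tcomb_inject[OF frame_onb[OF p] fibre_facts(1)[OF p]]
      by (simp add: h(2) frame_act[OF p h(1)])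
    then have "\<eta> = Ad (adj h) \<xi>" by (simp add: A h)
    then show "z \<in> spinor_class M m' p (F \<xi> v)" using z h F' by (auto simp: spinor_class_mem)
  next
    fix z assume "z \<in> spinor_class M m' p (F \<xi> v)"
    then obtain h where h: "h \<in> SU2" "z = (spin_act M p h, F (Ad (adj h) \<xi>) (rep m (adj h) v))"
      using F' by (auto simp: spinor_class_mem)
    have "tcomb (spin_frame M p) \<xi> = tcomb (spin_frame M (spin_act M p h)) (Ad (adj h) \<xi>)"
      by (simp add: frame_act[OF p h(1)] A h(1))
    then show "z \<in> bundle_map M F (tcomb (spin_frame M p) \<xi>) (spinor_class M m p v)"
      unfolding bundle_map_def using h spinor_class_iff[OF p h(1)] by blast
  }
qed

end

section \<open>The connection form of a local section\<close>

lemma ad_axis: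
  "ad \<zeta> (axis 1 1) = vector [0, 2 * \<zeta> $ 3, - 2 * \<zeta> $ 2]"
  "ad \<zeta> (axis 2 1) = vector [- 2 * \<zeta> $ 3, 0, 2 * \<zeta> $ 1]"
  "ad \<zeta> (axis 3 1) = vector [2 * \<zeta> $ 2, - 2 * \<zeta> $ 1, 0]"
  unfolding ad_eq cross3_def axis_def vec_eq_iff forall_3 by simp_all

text \<open>A local section of the principal bundle whose induced frame is smooth, such as the
  members of the bundle atlas and their restrictions. All computations below take place in such
  a section.\<close>

locale spin_patch = spin_manifold M for M :: "('a, 'p) spin3" +
  fixes W :: "'a set" and s :: "'a \<Rightarrow> 'p"
  assumes sect: "spin_section M W s"
    and frame_smooth: "smooth_vfield M W (\<lambda>x. spin_frame M (s x) i)"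
begin

lemma W: "openin (base M) W"
  using sect by (simp add: spin_section_def)

lemma W_top: "x \<in> W \<Longrightarrow> x \<in> topspace (base M)"
  using W openin_subset by blast

lemma s_fibre: "x \<in> W \<Longrightarrow> s x \<in> spin_fibre M x"
  using sect by (simp add: spin_section_def)

abbreviation "E i y \<equiv> spin_frame M (s y) i"
abbreviation "Ecomb y \<equiv> tcomb (spin_frame M (s y))"

lemma E_onb: "x \<in> W \<Longrightarrow> oriented_onb M x (spin_frame M (s x))"
  using frame_onb s_fibre by blast

lemma E_local_onframe: "local_onframe M W E"
  using W frame_smooth E_onb by (simp add: local_onframe_def)

lemma E_tangent: "x \<in> W \<Longrightarrow> E i x \<in> tangent M x"
  using E_onb onb_in_tangent by blast

lemma E_inject: "x \<in> W \<Longrightarrow> Ecomb x \<xi> = Ecomb x \<eta> \<longleftrightarrow> \<xi> = \<eta>"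
  using tcomb_inject[OF E_onb W_top] by blast

definition frame_coord :: "'a \<Rightarrow> 'a tvec \<Rightarrow> real^3" where
  "frame_coord x v = (\<chi> i. metric M x v (E i x))"

lemma frame_coord_works: "x \<in> W \<Longrightarrow> v \<in> tangent M x \<Longrightarrow> Ecomb x (frame_coord x v) = v"
  using onb_expand_metric[OF E_onb W_top] by (simp add: frame_coord_def)

lemma frame_coord_smooth:
  assumes "openin (base M) U" "U \<subseteq> W" "smooth_vfield M U X"
  shows "smooth_fun M U (\<lambda>y. frame_coord y (X y))"
  unfolding frame_coord_def
  by (intro smooth_fun_vec assms metric_smooth smooth_vfield_subset[OF frame_smooth])

text \<open>A vector of \<open>R^3\<close> is determined by its cross products with two basis
  vectors.\<close>

lemma spin_form_eqI:
  assumes x: "x \<in> W" and t: "t x \<in> spin_fibre M x"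
    and "\<And>j. lc M x v (\<lambda>y. spin_frame M (t y) j) = tcomb (spin_frame M (t x)) (ad \<zeta> (axis j 1))"
  shows "spin_form M t x v = \<zeta>"
  unfolding spin_form_def
proof (rule the_equality)
  fix \<eta> assume \<eta>: "\<forall>j. lc M x v (\<lambda>y. spin_frame M (t y) j) = tcomb (spin_frame M (t x)) (ad \<eta> (axis j 1))"
  have "tcomb (spin_frame M (t x)) (ad \<eta> (axis j 1)) = tcomb (spin_frame M (t x)) (ad \<zeta> (axis j 1))" for j
    by (rule trans[OF sym[OF \<eta>[rule_format]] assms(3)])
  then have "ad \<eta> (axis j 1) = ad \<zeta> (axis j 1)" for j
    unfolding tcomb_inject[OF frame_onb[OF t] W_top[OF x]] .
  note c = this
  have "\<eta> $ 3 = \<zeta> $ 3" "\<eta> $ 2 = \<zeta> $ 2" "\<eta> $ 1 = \<zeta> $ 1"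
    using c[of 1] c[of 2] unfolding ad_axis vec_eq_iff forall_3 vector_3 by simp_all
  then show "\<eta> = \<zeta>" by (simp add: vec_eq_iff forall_3)
next
  show "\<forall>j. lc M x v (\<lambda>y. spin_frame M (t y) j) = tcomb (spin_frame M (t x)) (ad \<zeta> (axis j 1))"
    by (intro allI assms(3))
qed

definition conn_coeff :: "'a \<Rightarrow> 'a tvec \<Rightarrow> 3 \<Rightarrow> 3 \<Rightarrow> real" where
  "conn_coeff x v j k = metric M x (lc M x v (E j)) (E k x)"

text \<open>The skew matrix of connection coefficients as a vector; the factor
  \<open>1/2\<close> compensates \<open>ad \<zeta> \<xi> = 2 \<zeta> \<times> \<xi>\<close>.\<close>

definition conn_form :: "'a \<Rightarrow> 'a tvec \<Rightarrow> real^3" where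
  "conn_form x v = (1/2) *\<^sub>R vector [conn_coeff x v 2 3, - conn_coeff x v 1 3, conn_coeff x v 1 2]"

lemma lc_E:
  assumes x: "x \<in> W" and v: "v \<in> tangent M x"
  shows "lc M x v (E j) = Ecomb x (ad (conn_form x v) (axis j 1))"
proof -
  have sk: "conn_coeff x v j k = - conn_coeff x v k j" for j k
    unfolding conn_coeff_def by (rule lc_onframe_skew[OF E_local_onframe x v])
  have z: "conn_coeff x v j j = 0" for j using sk[of j j] by linarith
  have "lc M x v (E j) = Ecomb x (\<chi> k. conn_coeff x v j k)"
    using onb_expand_metric[OF E_onb[OF x] W_top[OF x] lc_rules(1)[OF W frame_smooth x v]]
    by (simp add: conn_coeff_def)
  also have "(\<chi> k. conn_coeff x v j k) = ad (conn_form x v) (axis j 1)"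
  proof -
    have c: "conn_coeff x v 2 1 = - conn_coeff x v 1 2" "conn_coeff x v 3 1 = - conn_coeff x v 1 3" "conn_coeff x v 3 2 = - conn_coeff x v 2 3"
      by (rule sk)+
    have "(\<chi> k. conn_coeff x v 1 k) = ad (conn_form x v) (axis 1 1)" "(\<chi> k. conn_coeff x v 2 k) = ad (conn_form x v) (axis 2 1)"
      "(\<chi> k. conn_coeff x v 3 k) = ad (conn_form x v) (axis 3 1)"
      unfolding ad_axis conn_form_def vec_eq_iff forall_3 by (simp_all add: z c)
    then show ?thesis using exhaust_3[of j] by metis
  qed
  finally show ?thesis .
qed

lemma conn_form_tlin:
  assumes "x \<in> W" "v \<in> tangent M x" "w \<in> tangent M x"
  shows "conn_form x (tlin a v b w) = a *\<^sub>R conn_form x v + b *\<^sub>R conn_form x w"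
proof -
  have "conn_coeff x (tlin a v b w) j k = a * conn_coeff x v j k + b * conn_coeff x w j k" for j k
    unfolding conn_coeff_def lc_rules(2)[OF W frame_smooth assms]
    by (rule metric_tlin) (use assms in \<open>auto intro: W_top E_tangent lc_rules(1)[OF W frame_smooth]\<close>)
  then show ?thesis by (simp add: conn_form_def vec_eq_iff forall_3 algebra_simps add_divide_distrib)
qed

lemma conn_form_smooth:
  assumes U: "openin (base M) U" "U \<subseteq> W" and X: "smooth_vfield M U X"
  shows "smooth_fun M U (\<lambda>y. conn_form y (X y))"
proof -
  note fs = smooth_vfield_subset[OF frame_smooth U(2)]
  have c: "smooth_fun M U (\<lambda>y. conn_coeff y (X y) j k)" for j k
    unfolding conn_coeff_def by (intro metric_smooth U lc_smooth X fs)
  have "conn_form y (X y) = (\<chi> i. (if i = 2 then - 1/2 else 1/2) * conn_coeff y (X y) (if i = 1 then 2 else 1) (if i = 3 then 2 else 3))" for y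
    by (simp add: conn_form_def vec_eq_iff forall_3)
  then show ?thesis by (simp only:) (intro smooth_fun_vec smooth_fun_mult smooth_fun_const U c)
qed

lemma lc_tcomb_E:
  assumes U: "openin (base M) U" "U \<subseteq> W" "x \<in> U" and a: "smooth_fun M U a" and v: "v \<in> tangent M x"
  shows "lc M x v (\<lambda>y. Ecomb y (a y))
    = Ecomb x (ddir M x v a + ad (conn_form x v) (a x))"
proof -
  have x: "x \<in> W" using U by auto
  have "lc M x v (\<lambda>y. Ecomb y (a y)) = (\<lambda>c. \<Sum>i\<in>UNIV.
     (ddir M x v a $ i) *\<^sub>R E i x c + (a x $ i) *\<^sub>R Ecomb x (ad (conn_form x v) (axis i 1)) c)"
    using lc_tcomb[OF U(1,3) smooth_vfield_subset[OF frame_smooth U(2)] a v] lc_E[OF x v] by simp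
  also have "\<dots> = Ecomb x (ddir M x v a + ad (conn_form x v) (a x))"
  proof
    fix c
    have lin: "linear (\<lambda>\<xi>. Ecomb x (ad (conn_form x v) \<xi>) c)"
      using linear_compose[OF linear_ad[of "conn_form x v"] linear_tcomb[of "spin_frame M (s x)" c]] by (simp add: comp_def)
    have "Ecomb x (ad (conn_form x v) (a x)) c
       = (\<Sum>i\<in>UNIV. (a x $ i) *\<^sub>R Ecomb x (ad (conn_form x v) (axis i 1)) c)"
      by (subst (1) vec3_expand[of "a x"]) (simp only: linear_sum[OF lin] linear_scale[OF lin])
    then show "(\<Sum>i\<in>UNIV. (ddir M x v a $ i) *\<^sub>R E i x c
         + (a x $ i) *\<^sub>R Ecomb x (ad (conn_form x v) (axis i 1)) c)
       = Ecomb x (ddir M x v a + ad (conn_form x v) (a x)) c"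
      by (simp add: tcomb_def scaleR_add_left sum.distrib)
  qed
  finally show ?thesis .
qed

end

section \<open>Spinor fields in coordinates\<close>

lemma clifford_add: "clifford m A B C \<xi> (p + q) = clifford m A B C \<xi> p + clifford m A B C \<xi> q"
  by (simp add: clifford_def on_monomials_add)

lemma clifford_smult: "clifford m A B C \<xi> (smult r p) = smult r (clifford m A B C \<xi> p)"
  by (simp add: clifford_def on_monomials_smult)

lemma clifford_sum: "clifford m A B C \<xi> (\<Sum>i\<in>I. p i) = (\<Sum>i\<in>I. clifford m A B C \<xi> (p i))"
  by (simp add: clifford_def on_monomials_sum)

lemma clifford_lin:
  "clifford m A B C (a *\<^sub>R \<xi> + b *\<^sub>R \<eta>) p =
     smult (of_real a) (clifford m A B C \<xi> p) + smult (of_real b) (clifford m A B C \<eta> p)"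
  by (rule poly_eqI) (simp add: clifford_eq algebra_simps)

text \<open>The common properties of the three Clifford homomorphisms on which everything below
  depends. Equivariance makes the bundle maps well defined, and the commutator condition makes
  them parallel.\<close>

definition clifford_map :: "int \<Rightarrow> int \<Rightarrow> (real^3 \<Rightarrow> complex poly \<Rightarrow> complex poly) \<Rightarrow> bool" where
  "clifford_map m m' F \<longleftrightarrow> (\<exists>A B C. F = clifford m A B C) \<and>
     (\<forall>\<xi>. \<forall>p\<in>V_space m. F \<xi> p \<in> V_space m') \<and>
     equivariant m m' F \<and>
     (\<forall>\<zeta> \<xi>. \<forall>p\<in>V_space m. rho0 m' \<zeta> (F \<xi> p) - F \<xi> (rho0 m \<zeta> p) = F (ad \<zeta> \<xi>) p)"

lemma clifford_map_rho0: "clifford_map m m (rho0 m)"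
  unfolding clifford_map_def equivariant_def ad_eq
  by (intro conjI allI ballI rho0_V_space rho0_equivariant commutator_rho0)
    (auto simp: rho0_def)

lemma clifford_map_rho_plus: "clifford_map m (m + 2) (rho_plus m)"
  unfolding clifford_map_def equivariant_def ad_eq
  by (intro conjI allI ballI rho_plus_V_space rho_plus_equivariant commutator_rho_plus)
    (auto simp: rho_plus_def)

lemma clifford_map_rho_minus: "clifford_map m (m - 2) (rho_minus m)"
  unfolding clifford_map_def equivariant_def ad_eq
  by (intro conjI allI ballI rho_minus_V_space rho_minus_equivariant commutator_rho_minus)
    (auto simp: rho_minus_def)

lemma clifford_map_facts:
  assumes "clifford_map m m' F"
  shows "p \<in> V_space m \<Longrightarrow> F \<xi> p \<in> V_space m'"
    and "equivariant m m' F"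
    and "p \<in> V_space m \<Longrightarrow> rho0 m' \<zeta> (F \<xi> p) = F \<xi> (rho0 m \<zeta> p) + F (ad \<zeta> \<xi>) p"
    and "F \<xi> (p + q) = F \<xi> p + F \<xi> q" "F \<xi> (smult r p) = smult r (F \<xi> p)"
      "F \<xi> (\<Sum>i\<in>I. f i) = (\<Sum>i\<in>I. F \<xi> (f i))"
    and "F (a *\<^sub>R \<xi> + b *\<^sub>R \<eta>) p = smult (of_real a) (F \<xi> p) + smult (of_real b) (F \<eta> p)"
proof -
  obtain A B C where F: "F = clifford m A B C" using assms unfolding clifford_map_def by blast
  show "F \<xi> (p + q) = F \<xi> p + F \<xi> q" "F \<xi> (smult r p) = smult r (F \<xi> p)"
      "F \<xi> (\<Sum>i\<in>I. f i) = (\<Sum>i\<in>I. F \<xi> (f i))"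
    "F (a *\<^sub>R \<xi> + b *\<^sub>R \<eta>) p = smult (of_real a) (F \<xi> p) + smult (of_real b) (F \<eta> p)"
    unfolding F by (rule clifford_add clifford_smult clifford_sum clifford_lin)+
  show "p \<in> V_space m \<Longrightarrow> F \<xi> p \<in> V_space m'"
    and "equivariant m m' F"
    using assms unfolding clifford_map_def by (elim conjE, blast)+
  assume p: "p \<in> V_space m"
  have "rho0 m' \<zeta> (F \<xi> p) - F \<xi> (rho0 m \<zeta> p) = F (ad \<zeta> \<xi>) p"
    using assms p unfolding clifford_map_def by (elim conjE) blast
  then show "rho0 m' \<zeta> (F \<xi> p) = F \<xi> (rho0 m \<zeta> p) + F (ad \<zeta> \<xi>) p"
    by (metis diff_eq_eq add.commute)
qed

lemma clifford_map_diff: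
  assumes "clifford_map m m' F"
  shows "F \<xi> (p - q) = F \<xi> p - F \<xi> q"
  using clifford_map_facts(4)[OF assms, of \<xi> "p - q" q] by simp

lemma clifford_map_add_vec:
  assumes "clifford_map m m' F"
  shows "F (\<xi> + \<eta>) p = F \<xi> p + F \<eta> p" "F (r *\<^sub>R \<xi>) p = smult (of_real r) (F \<xi> p)"
    "F 0 p = 0" "F (\<Sum>i\<in>I. f i) p = (\<Sum>i\<in>I. F (f i) p)" "F (- \<xi>) p = - F \<xi> p"
proof -
  show 1: "F (\<xi> + \<eta>) p = F \<xi> p + F \<eta> p" for \<xi> \<eta> using clifford_map_facts(7)[OF assms, of 1 \<xi> 1 \<eta>] by simp
  show 2: "F (r *\<^sub>R \<xi>) p = smult (of_real r) (F \<xi> p)" for r \<xi> using clifford_map_facts(7)[OF assms, of r \<xi> 0 0] by simp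
  show 3: "F 0 p = 0" using 2[of 0 0] by simp
  show "F (\<Sum>i\<in>I. f i) p = (\<Sum>i\<in>I. F (f i) p)"
    by (induction I rule: infinite_finite_induct) (auto simp: 1 3)
  show "F (- \<xi>) p = - F \<xi> p" using 2[of "-1" \<xi>] by simp
qed

lemma smult_sum_right: "smult a (\<Sum>i\<in>I. f i) = (\<Sum>i\<in>I. smult a (f i))"
  by (induction I rule: infinite_finite_induct) (auto simp: smult_add_right)

text \<open>Coefficientwise bilinearity, by which smoothness and the product rule for \<open>F
  (a y) (g y)\<close> follow from those for scalar functions.\<close>

lemma clifford_map_expand:
  assumes F: "clifford_map m m' F" and p: "p \<in> V_space m"
  shows "F \<xi> p = (\<Sum>i\<in>UNIV. \<Sum>k\<le>nat m. smult (of_real (\<xi> $ i) * coeff p k) (F (axis i 1) (monom 1 k)))"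
proof -
  have "F \<xi> p = F (\<Sum>i\<in>UNIV. \<xi> $ i *\<^sub>R axis i 1) (\<Sum>k\<le>nat m. smult (coeff p k) (monom 1 k))"
    using vec3_expand[of \<xi>] V_space_expand[OF p] by (simp add: smult_monom)
  then show ?thesis
    by (subst sum.swap) (simp add: clifford_map_add_vec[OF F] clifford_map_facts(5,6)[OF F] smult_sum_right mult.commute)
qed

context manifold3 begin

lemma subalg_smooth:
  "openin (base M) U \<Longrightarrow> subalg {f :: 'a \<Rightarrow> complex. smooth_fun M U f}"
  by (auto simp: subalg_def intro: smooth_fun_const smooth_fun_add smooth_fun_mult)

definition field_on :: "'a set \<Rightarrow> int \<Rightarrow> ('a \<Rightarrow> complex poly) \<Rightarrow> bool" where
  "field_on U m g \<longleftrightarrow> (\<forall>y\<in>U. g y \<in> V_space m) \<and> (\<forall>n. smooth_fun M U (\<lambda>y. coeff (g y) n))"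

lemma field_onD:
  assumes "field_on U m g"
  shows "y \<in> U \<Longrightarrow> g y \<in> V_space m" "smooth_fun M U (\<lambda>y. coeff (g y) n)"
  using assms by (auto simp: field_on_def)

lemma field_on_subset: "field_on U m g \<Longrightarrow> V \<subseteq> U \<Longrightarrow> field_on V m g"
  unfolding field_on_def using smooth_fun_subset by blast

lemma field_on_add: "openin (base M) U \<Longrightarrow> field_on U m f \<Longrightarrow> field_on U m g \<Longrightarrow> field_on U m (\<lambda>y. f y + g y)"
  unfolding field_on_def by (auto intro: smooth_fun_add V_space_add)

lemma field_on_sum:
  assumes "openin (base M) U" "\<And>i. i \<in> I \<Longrightarrow> field_on U m (f i)"
  shows "field_on U m (\<lambda>y. \<Sum>i\<in>I. f i y)"
  unfolding field_on_def coeff_sum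
proof (intro conjI ballI allI)
  fix y assume "y \<in> U"
  then show "(\<Sum>i\<in>I. f i y) \<in> V_space m" using assms(2) field_onD(1) by (intro V_space_sum) blast
next
  fix n
  show "smooth_fun M U (\<lambda>y. \<Sum>i\<in>I. coeff (f i y) n)"
    using assms(2) field_onD(2) by (intro smooth_fun_sum[OF assms(1)]) blast
qed

lemma field_on_clifford:
  assumes U: "openin (base M) U" and F: "clifford_map m m' F" and a: "smooth_fun M U a" and g: "field_on U m g"
  shows "field_on U m' (\<lambda>y. F (a y) (g y))"
proof -
  have "field_on U m' (\<lambda>y. F (a y) (g y)) \<longleftrightarrow> (\<forall>n. smooth_fun M U (\<lambda>y. coeff (F (a y) (g y)) n))"
    using clifford_map_facts(1)[OF F] field_onD(1)[OF g] by (auto simp: field_on_def)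
  moreover have "smooth_fun M U (\<lambda>y. coeff (F (a y) (g y)) n)" for n
  proof -
    have "smooth_fun M U (\<lambda>y. \<Sum>i\<in>UNIV. \<Sum>k\<le>nat m. of_real (a y $ i) * coeff (g y) k * coeff (F (axis i 1) (monom 1 k)) n)"
      by (intro smooth_fun_sum smooth_fun_mult smooth_fun_of_real smooth_fun_nth smooth_fun_const U a field_onD(2)[OF g])
    then show ?thesis
      by (rule smooth_fun_cong[OF U, THEN iffD1, rotated])
        (simp add: clifford_map_expand[OF F field_onD(1)[OF g]] coeff_sum)
  qed
  ultimately show ?thesis by blast
qed

subsection \<open>Coefficientwise derivatives\<close>

text \<open>The derivative of a polynomial-valued function in the first summand of
  \<open>nabla\<close>.\<close>

definition ddir_poly :: "int \<Rightarrow> 'a tvec \<Rightarrow> ('a \<Rightarrow> complex poly) \<Rightarrow> 'a \<Rightarrow> complex poly" where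
  "ddir_poly m v g x = (\<Sum>k\<le>nat m. monom (ddir M x v (\<lambda>y. coeff (g y) k)) k)"

lemma coeff_pd: "coeff (ddir_poly m v g x) k = (if k \<le> nat m then ddir M x v (\<lambda>y. coeff (g y) k) else 0)"
  by (simp add: ddir_poly_def coeff_sum)

lemma ddir_poly_eqI:
  assumes "D \<in> V_space m" "\<And>k. ddir M x v (\<lambda>y. coeff (g y) k) = coeff D k"
  shows "ddir_poly m v g x = D"
  unfolding ddir_poly_def assms(2) by (rule V_space_expand[OF assms(1), symmetric])

lemma ddir_poly_V_space:
  assumes U: "openin (base M) U" "x \<in> U" and g: "\<And>y. y \<in> U \<Longrightarrow> g y \<in> V_space m"
  shows "ddir_poly m v g x \<in> V_space m"
proof (cases "m < 0")
  case True
  have "ddir M x v (\<lambda>y. coeff (g y) k) = 0" for k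
    using ddir_cong[OF U, of "\<lambda>y. coeff (g y) k" "\<lambda>y. 0" v] g True ddir_const by (simp add: V_space_neg)
  then show ?thesis by (simp add: ddir_poly_def)
qed (auto simp: ddir_poly_def intro!: V_space_sum V_space_monom)

lemma ddir_poly_coeff_all:
  assumes U: "openin (base M) U" "x \<in> U" and g: "\<And>y. y \<in> U \<Longrightarrow> g y \<in> V_space m"
  shows "coeff (ddir_poly m v g x) k = ddir M x v (\<lambda>y. coeff (g y) k)"
proof (cases "k \<le> nat m")
  case False
  then have "coeff (g y) k = 0" if "y \<in> U" for y using V_space_coeff[OF g[OF that]] by simp
  then have "ddir M x v (\<lambda>y. coeff (g y) k) = 0"
    using ddir_cong[OF U, of "\<lambda>y. coeff (g y) k" "\<lambda>y. 0" v] ddir_const by simp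
  then show ?thesis using False by (simp add: coeff_pd)
qed (simp add: coeff_pd)

lemma ddir_poly_cong:
  assumes "openin (base M) U" "x \<in> U" "\<And>y. y \<in> U \<Longrightarrow> f y = g y"
  shows "ddir_poly m v f x = ddir_poly m v g x"
proof -
  have "ddir M x v (\<lambda>y. coeff (f y) k) = ddir M x v (\<lambda>y. coeff (g y) k)" for k
    by (rule ddir_cong[OF assms(1,2)]) (simp add: assms(3))
  then show ?thesis by (simp add: ddir_poly_def)
qed

lemma ddir_poly_sum:
  assumes U: "openin (base M) U" "x \<in> U" and f: "\<And>i. i \<in> I \<Longrightarrow> field_on U m (f i)"
  shows "ddir_poly m v (\<lambda>y. \<Sum>i\<in>I. f i y) x = (\<Sum>i\<in>I. ddir_poly m v (f i) x)"
proof -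
  have "ddir M x v (\<lambda>y. \<Sum>i\<in>I. coeff (f i y) k) = (\<Sum>i\<in>I. ddir M x v (\<lambda>y. coeff (f i y) k))" for k
    by (rule ddir_sum[OF U]) (use f field_onD(2) in blast)
  then show ?thesis
    by (intro poly_eqI) (simp add: coeff_pd coeff_sum)
qed

lemma ddir_poly_tlin:
  assumes U: "openin (base M) U" "x \<in> U" and g: "field_on U m g"
  shows "ddir_poly m (tlin a v b w) g x = smult (of_real a) (ddir_poly m v g x) + smult (of_real b) (ddir_poly m w g x)"
  by (rule poly_eqI)
    (simp add: coeff_pd ddir_tlin[OF U field_onD(2)[OF g]] scaleR_conv_of_real)

lemma ddir_of_real_nth:
  assumes "openin (base M) U" "x \<in> U" "smooth_fun M U (a :: 'a \<Rightarrow> real^3)"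
  shows "ddir M x v (\<lambda>y. complex_of_real (a y $ i)) = of_real (ddir M x v a $ i)"
proof -
  have "ddir M x v (\<lambda>y. complex_of_real (a y $ i)) = of_real (ddir M x v (\<lambda>y. a y $ i))"
    by (rule ddir_linear[OF bounded_linear_of_real assms(1,2) smooth_fun_nth[OF assms(1,3)]])
  then show ?thesis by (simp add: ddir_linear[OF bounded_linear_vec_nth assms])
qed

lemma ddir_poly_clifford:
  assumes U: "openin (base M) U" "x \<in> U" and F: "clifford_map m m' F"
    and a: "smooth_fun M U a" and g: "field_on U m g"
  shows "ddir_poly m' v (\<lambda>y. F (a y) (g y)) x = F (ddir M x v a) (g x) + F (a x) (ddir_poly m v g x)"
proof (rule ddir_poly_eqI)
  have pV: "ddir_poly m v g x \<in> V_space m" by (rule ddir_poly_V_space[OF U]) (rule field_onD(1)[OF g])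
  note gV = field_onD(1)[OF g U(2)]
  show "F (ddir M x v a) (g x) + F (a x) (ddir_poly m v g x) \<in> V_space m'"
    by (intro V_space_add clifford_map_facts(1)[OF F] pV gV)
  fix n
  let ?c = "\<lambda>i k. coeff (F (axis i 1) (monom 1 k)) n"
  have "ddir M x v (\<lambda>y. coeff (F (a y) (g y)) n) =
     ddir M x v (\<lambda>y. \<Sum>i\<in>UNIV. \<Sum>k\<le>nat m. of_real (a y $ i) * coeff (g y) k * ?c i k)"
    by (rule ddir_cong[OF U]) (simp add: clifford_map_expand[OF F field_onD(1)[OF g]] coeff_sum)
  also have "\<dots> = (\<Sum>i\<in>UNIV. \<Sum>k\<le>nat m. ddir M x v (\<lambda>y. of_real (a y $ i) * coeff (g y) k * ?c i k))"
    by (subst ddir_sum[OF U] | intro sum.cong refl smooth_fun_sum smooth_fun_mult smooth_fun_of_real smooth_fun_nth smooth_fun_const U a field_onD(2)[OF g])+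
  also have "\<dots> = (\<Sum>i\<in>UNIV. \<Sum>k\<le>nat m. of_real (ddir M x v a $ i) * coeff (g x) k * ?c i k
      + of_real (a x $ i) * coeff (ddir_poly m v g x) k * ?c i k)"
  proof (intro sum.cong refl)
    fix i :: 3 and k
    have s1: "smooth_fun M U (\<lambda>y. complex_of_real (a y $ i))"
      by (intro smooth_fun_of_real smooth_fun_nth U a)
    have "ddir M x v (\<lambda>y. of_real (a y $ i) * coeff (g y) k * ?c i k)
       = (of_real (a x $ i) * ddir M x v (\<lambda>y. coeff (g y) k) + ddir M x v (\<lambda>y. of_real (a y $ i)) * coeff (g x) k) * ?c i k"
      using ddir_bilinear[OF bounded_bilinear_mult U smooth_fun_mult[OF U(1) s1 field_onD(2)[OF g]] smooth_fun_const,
          of v k "?c i k"] ddir_bilinear[OF bounded_bilinear_mult U s1 field_onD(2)[OF g], of v k]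
      by (simp add: ddir_const)
    also have "ddir M x v (\<lambda>y. coeff (g y) k) = coeff (ddir_poly m v g x) k"
      by (rule ddir_poly_coeff_all[symmetric, OF U]) (rule field_onD(1)[OF g])
    finally show "ddir M x v (\<lambda>y. of_real (a y $ i) * coeff (g y) k * ?c i k) =
       of_real (ddir M x v a $ i) * coeff (g x) k * ?c i k + of_real (a x $ i) * coeff (ddir_poly m v g x) k * ?c i k"
      by (simp add: ddir_of_real_nth[OF U a] algebra_simps)
  qed
  also have "\<dots> = coeff (F (ddir M x v a) (g x) + F (a x) (ddir_poly m v g x)) n"
    by (simp add: clifford_map_expand[OF F gV] clifford_map_expand[OF F pV] coeff_sum sum.distrib)
  finally show "ddir M x v (\<lambda>y. coeff (F (a y) (g y)) n) = coeff (F (ddir M x v a) (g x) + F (a x) (ddir_poly m v g x)) n" .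
qed

lemma field_on_ddir_poly:
  assumes U: "openin (base M) U" and g: "field_on U m g" and X: "smooth_vfield M U X"
  shows "field_on U m (\<lambda>y. ddir_poly m (X y) g y)"
  unfolding field_on_def coeff_pd
proof (intro conjI ballI allI)
  fix y assume "y \<in> U" then show "ddir_poly m (X y) g y \<in> V_space m"
    using ddir_poly_V_space[OF U] field_onD(1)[OF g] by blast
next
  fix n show "smooth_fun M U (\<lambda>y. if n \<le> nat m then ddir M y (X y) (\<lambda>y. coeff (g y) n) else 0)"
    by (cases "n \<le> nat m") (simp_all add: smooth_fun_ddir[OF U field_onD(2)[OF g] X] smooth_fun_const)
qed

subsection \<open>Change of gauge\<close>

text \<open>\<open>\<beta>\<close> is the left logarithmic derivative \<open>h\<inverse>
  dh\<close>. This matrix lies in \<open>su(2)\<close> because \<open>h h\<inverse>\<close> and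
  \<open>det h\<close> are constant; so the derivatives of \<open>h\<close>, \<open>h\<inverse>\<close>
  and \<open>Ad h\<close> can all be expressed by \<open>\<beta>\<close>.\<close>

lemma gauge_derivative:
  fixes v :: "'a tvec"
  assumes N: "openin (base M) N" "x \<in> N" and h: "smooth_fun M N h" and hS: "\<And>y. y \<in> N \<Longrightarrow> h y \<in> SU2"
  defines "\<beta> \<equiv> su2_coord (adj (h x) ** ddir M x v h)"
  shows "ddir M x v h = h x ** su2_of \<beta>"
    and "ddir M x v (\<lambda>y. adj (h y)) = - (su2_of \<beta> ** adj (h x))"
    and "ddir M x v (\<lambda>y. Ad (h y) \<xi>) = Ad (h x) (ad \<beta> \<xi>)"
    and "smooth_fun M N (\<lambda>y. adj (h y))"
    and "smooth_fun M N (\<lambda>y. Ad (h y) \<xi>)"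
proof -
  let ?D = "ddir M x v h"
  note S = hS[OF N(2)]
  have ah: "ddir M x v (\<lambda>y. adj (h y)) = adj ?D"
    by (rule ddir_linear[OF bounded_linear_adj N h])
  show sah: "smooth_fun M N (\<lambda>y. adj (h y))"
    by (rule smooth_fun_linear[OF bounded_linear_adj N(1) h])
  \<comment> \<open>\<open>h h\<inverse> = 1\<close> makes \<open>h\<inverse> dh\<close> skew-Hermitian\<close>
  have "ddir M x v (\<lambda>y. h y ** adj (h y)) = ddir M x v (\<lambda>y. mat 1)"
    by (rule ddir_cong[OF N]) (simp add: SU2_inverse(1) hS)
  then have "h x ** adj ?D + ?D ** adj (h x) = 0"
    using ddir_bilinear[OF bounded_bilinear_mat_mult N h sah, of v] by (simp add: ddir_const ah)
  then have "adj (h x) ** (h x ** adj ?D + ?D ** adj (h x)) ** h x = 0"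
    by (simp add: mat_mult_simps)
  then have s1: "adj ?D ** h x = - (adj (h x) ** ?D)"
    by (simp add: mat_mult_simps SU2_cancel[OF S] SU2_inverse[OF S] eq_neg_iff_add_eq_0)
  have comp: "smooth_fun M N (\<lambda>y. h y $ i $ j)" for i j
    by (intro smooth_fun_nth N h)
  have dcomp: "ddir M x v (\<lambda>y. h y $ i $ j) = ?D $ i $ j" for i j
    using ddir_linear[OF bounded_linear_vec_nth N smooth_fun_nth[OF N(1) h], of v i j]
      ddir_linear[OF bounded_linear_vec_nth N h, of v i] by simp
  \<comment> \<open>\<open>det h = 1\<close> makes \<open>h\<inverse> dh\<close> trace-free\<close>
  have "ddir M x v (\<lambda>y. h y $ 1 $ 1 * h y $ 2 $ 2) = ddir M x v (\<lambda>y. h y $ 1 $ 2 * h y $ 2 $ 1 + 1)"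
    by (rule ddir_cong[OF N]) (metis SU2_entries(5) hS diff_eq_eq add.commute)
  then have s2: "h x $ 1 $ 1 * ?D $ 2 $ 2 + ?D $ 1 $ 1 * h x $ 2 $ 2 = h x $ 1 $ 2 * ?D $ 2 $ 1 + ?D $ 1 $ 2 * h x $ 2 $ 1"
    using ddir_bilinear[OF bounded_bilinear_mult N comp comp] 
      ddir_add[OF N smooth_fun_mult[OF N(1) comp comp] smooth_fun_const]
    by (simp add: dcomp ddir_const)
  have su: "is_su2 (adj (h x) ** ?D)"
    unfolding is_su2_def
  proof
    show "adj (adj (h x) ** ?D) = - (adj (h x) ** ?D)" by (simp add: adj_simps s1)
    show "(adj (h x) ** ?D) $ 1 $ 1 + (adj (h x) ** ?D) $ 2 $ 2 = 0"
      using s2 by (simp add: matrix_matrix_mult_def sum_2 adj_def SU2_entries[OF S] algebra_simps)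
  qed
  then have b: "su2_of \<beta> = adj (h x) ** ?D" by (simp add: \<beta>_def su2_of_su2_coord)
  show D: "?D = h x ** su2_of \<beta>" by (simp add: b mat_mult_simps SU2_inverse[OF S])
  have "adj (su2_of \<beta>) = - su2_of \<beta>" using is_su2_su2_of[of \<beta>] by (simp add: is_su2_def)
  then show aD: "ddir M x v (\<lambda>y. adj (h y)) = - (su2_of \<beta> ** adj (h x))"
    by (subst ah, subst D) (simp add: adj_simps mat_mult_simps)
  have e: "Ad (h y) \<xi> = su2_coord (h y ** su2_of \<xi> ** adj (h y))" if "y \<in> N" for y
    by (rule Ad_coord[OF hS[OF that]])
  have s3: "smooth_fun M N (\<lambda>y. h y ** su2_of \<xi>)"
    by (intro smooth_fun_bilinear[OF bounded_bilinear_mat_mult] N h smooth_fun_const)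
  have s4: "smooth_fun M N (\<lambda>y. h y ** su2_of \<xi> ** adj (h y))"
    by (intro smooth_fun_bilinear[OF bounded_bilinear_mat_mult] N s3 sah)
  show "smooth_fun M N (\<lambda>y. Ad (h y) \<xi>)"
    by (rule smooth_fun_cong[OF N(1), THEN iffD1, rotated, OF smooth_fun_linear[OF bounded_linear_su2_coord N(1) s4]])
      (rule e[symmetric])
  have "ddir M x v (\<lambda>y. Ad (h y) \<xi>) = ddir M x v (\<lambda>y. su2_coord (h y ** su2_of \<xi> ** adj (h y)))"
    by (rule ddir_cong[OF N e])
  also have "\<dots> = su2_coord (ddir M x v (\<lambda>y. h y ** su2_of \<xi> ** adj (h y)))"
    by (rule ddir_linear[OF bounded_linear_su2_coord N s4])
  also have "ddir M x v (\<lambda>y. h y ** su2_of \<xi> ** adj (h y)) =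
     h x ** su2_of \<xi> ** (- (su2_of \<beta> ** adj (h x))) + (h x ** su2_of \<beta>) ** su2_of \<xi> ** adj (h x)"
    using ddir_bilinear[OF bounded_bilinear_mat_mult N s3 sah, of v] 
      ddir_bilinear[OF bounded_bilinear_mat_mult N h smooth_fun_const, of v "su2_of \<xi>"]
    by (simp add: ddir_const aD D[symmetric] mat_mult_simps)
  also have "\<dots> = h x ** su2_of (ad \<beta> \<xi>) ** adj (h x)"
    by (simp add: su2_of_ad mat_mult_simps)
  also have "su2_coord \<dots> = Ad (h x) (ad \<beta> \<xi>)"
    by (rule Ad_coord[OF S, symmetric])
  finally show "ddir M x v (\<lambda>y. Ad (h y) \<xi>) = Ad (h x) (ad \<beta> \<xi>)" .
qed

text \<open>The derivative of \<open>h\<inverse>\<close> is \<open>h\<inverse>\<close> times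
  \<open>- Ad h \<beta>\<close>; thus \<open>frechet_derivative_rep\<close> yields the term with
  \<open>rho0\<close>, which is the inhomogeneous part in the change of gauge.\<close>

lemma gauge_ddir_poly:
  fixes v :: "'a tvec"
  assumes N: "openin (base M) N" "x \<in> N" and h: "smooth_fun M N h" and hS: "\<And>y. y \<in> N \<Longrightarrow> h y \<in> SU2"
    and g: "field_on N m g"
  defines "\<beta> \<equiv> su2_coord (adj (h x) ** ddir M x v h)"
  shows "ddir_poly m v (\<lambda>y. rep m (adj (h y)) (g y)) x =
     rep m (adj (h x)) (ddir_poly m v g x - rho0 m (Ad (h x) \<beta>) (g x))"
proof (rule ddir_poly_eqI)
  note gV = field_onD(1)[OF g]
  note G = gauge_derivative(1-3)[OF N h hS, where v=v, folded \<beta>_def] gauge_derivative(4)[OF N h hS]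
  have pV: "ddir_poly m v g x \<in> V_space m" by (rule ddir_poly_V_space[OF N gV])
  let ?D = "ddir_poly m v g x - rho0 m (Ad (h x) \<beta>) (g x)"
  show "rep m (adj (h x)) ?D \<in> V_space m"
    by (intro rep_V_space V_space_diff pV rho0_V_space gV N)
  fix n
  show "ddir M x v (\<lambda>y. coeff (rep m (adj (h y)) (g y)) n) = coeff (rep m (adj (h x)) ?D) n"
  proof (cases "m < 0")
    case True
    then have "?D = 0" "\<And>y. y \<in> N \<Longrightarrow> g y = 0"
      using gV pV N(2) V_space_diff[OF pV rho0_V_space] V_space_neg[OF True] by blast+
    then show ?thesis
      using ddir_cong[OF N, of "\<lambda>y. coeff (rep m (adj (h y)) (g y)) n" "\<lambda>y. 0" v] by (simp add: ddir_const)
  next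
    case False
    let ?z = "\<lambda>k. monom (1::complex) k"
    let ?r = "\<lambda>k y. coeff (rep m (adj (h y)) (?z k)) n"
    have zV: "?z k \<in> V_space m" if "k \<le> nat m" for k using that False by (intro V_space_monom) simp
    have ex: "coeff (rep m A p) n = (\<Sum>k\<le>nat m. coeff p k * coeff (rep m A (?z k)) n)" if "p \<in> V_space m" for p A
      by (subst V_space_expand[OF that]) (simp add: rep_sum coeff_sum smult_monom flip: rep_smult coeff_smult)
    have sr: "smooth_fun M N (?r k)" for k
    proof -
      have "(\<lambda>y. adj (h y) $ i $ j) \<in> {f. smooth_fun M N f}" for i j
        by (intro CollectI smooth_fun_nth N G(4))
      then show ?thesis
        using subalg_rep[OF subalg_smooth[OF N(1)], of "\<lambda>y. adj (h y)" "\<lambda>y. ?z k" m n] smooth_fun_const by blast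
    qed
    have dr: "ddir M x v (?r k) = - coeff (rep m (adj (h x)) (rho0 m (Ad (h x) \<beta>) (?z k))) n" if "k \<le> nat m" for k
    proof -
      have B: "- (su2_of \<beta> ** adj (h x)) = adj (h x) ** (- su2_of (Ad (h x) \<beta>))"
        using SU2_inverse[OF hS[OF N(2)]] by (simp add: su2_of_Ad[OF hS[OF N(2)]] mat_mult_simps)
      have "ddir M x v (?r k) = frechet_derivative (\<lambda>A. coeff (rep m A (?z k)) n) (at (adj (h x)))
          (ddir M x v (\<lambda>y. adj (h y)))"
        by (rule ddir_comp[OF N G(4) rep_differentiable])
      also have "\<dots> = coeff (rep m (adj (h x)) (drep m (- su2_of (Ad (h x) \<beta>)) (?z k))) n"
        using frechet_derivative_rep[OF zV[OF that], of n "adj (h x)" "- su2_of (Ad (h x) \<beta>)"]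
        by (simp only: G(2) B)
      finally show ?thesis
        using rep_diff[of m "adj (h x)" 0] by (simp add: drep_minus[OF zV[OF that]] drep_su2_of[OF zV[OF that]])
    qed
    have "ddir M x v (\<lambda>y. coeff (rep m (adj (h y)) (g y)) n) = ddir M x v (\<lambda>y. \<Sum>k\<le>nat m. coeff (g y) k * ?r k y)"
      by (rule ddir_cong[OF N]) (rule ex[OF gV])
    also have "\<dots> = (\<Sum>k\<le>nat m. ddir M x v (\<lambda>y. coeff (g y) k * ?r k y))"
      by (intro ddir_sum[OF N] smooth_fun_mult N sr field_onD(2)[OF g])
    also have "\<dots> = (\<Sum>k\<le>nat m. coeff (g x) k * - coeff (rep m (adj (h x)) (rho0 m (Ad (h x) \<beta>) (?z k))) n
        + coeff (ddir_poly m v g x) k * ?r k x)"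
      using ddir_bilinear[OF bounded_bilinear_mult N field_onD(2)[OF g] sr]
      by (intro sum.cong refl) (simp add: dr ddir_poly_coeff_all[OF N gV])
    also have "\<dots> = coeff (rep m (adj (h x)) (ddir_poly m v g x)) n
       - (\<Sum>k\<le>nat m. coeff (g x) k * coeff (rep m (adj (h x)) (rho0 m (Ad (h x) \<beta>) (?z k))) n)"
      unfolding ex[OF pV] by (simp add: sum.distrib sum_negf sum_subtractf)
    also have "(\<Sum>k\<le>nat m. coeff (g x) k * coeff (rep m (adj (h x)) (rho0 m (Ad (h x) \<beta>) (?z k))) n)
       = coeff (rep m (adj (h x)) (rho0 m (Ad (h x) \<beta>) (g x))) n"
    proof -
      note F = clifford_map_facts(5,6)[OF clifford_map_rho0]
      have "g x = (\<Sum>k\<le>nat m. smult (coeff (g x) k) (?z k))"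
        using V_space_expand[OF gV[OF N(2)]] by (simp add: smult_monom)
      then have "rho0 m (Ad (h x) \<beta>) (g x) = (\<Sum>k\<le>nat m. smult (coeff (g x) k) (rho0 m (Ad (h x) \<beta>) (?z k)))"
        by (metis (no_types, lifting) F sum.cong)
      then show ?thesis by (simp add: rep_sum rep_smult coeff_sum)
    qed
    finally show ?thesis by (simp add: rep_diff)
  qed
qed

end

lemma (in spin_manifold) spin_atlas_section:
  "\<forall>(U, s)\<in>spin_atlas M. openin (base M) U \<and> (\<forall>x\<in>U. s x \<in> spin_fibre M x)"
  using principal unfolding principal_SU2_bundle_def by (elim conjE)

lemma (in spin_manifold) spin_atlas_near:
  assumes "x \<in> topspace (base M)"
  obtains A r where "(A, r) \<in> spin_atlas M" "x \<in> A" "openin (base M) A" "\<forall>y\<in>A. r y \<in> spin_fibre M y"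
proof -
  have "x \<in> (\<Union>(U, s)\<in>spin_atlas M. U)"
    using assms principal unfolding principal_SU2_bundle_def by (elim conjE) (simp only:)
  then obtain z where z: "z \<in> spin_atlas M" "x \<in> (case z of (U, s) \<Rightarrow> U)" by blast
  obtain A r where "z = (A, r)" by (cases z)
  with z that spin_atlas_section show ?thesis by auto
qed

context spin_patch begin

text \<open>The covariant derivative in the coordinates of the section \<open>s\<close>.\<close>

definition cov_deriv :: "int \<Rightarrow> 'a tvec \<Rightarrow> ('a \<Rightarrow> complex poly) \<Rightarrow> 'a \<Rightarrow> complex poly" where
  "cov_deriv m v g x = ddir_poly m v g x + rho0 m (conn_form x v) (g x)"

lemma cov_deriv_V_space:
  assumes "field_on W m g" "x \<in> W"
  shows "cov_deriv m v g x \<in> V_space m"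
  unfolding cov_deriv_def
  by (intro V_space_add rho0_V_space ddir_poly_V_space[OF W] field_onD(1)[OF assms(1)] assms(2))

lemma field_on_cov_deriv:
  assumes g: "field_on W m g" and X: "smooth_vfield M W X"
  shows "field_on W m (\<lambda>y. cov_deriv m (X y) g y)"
  unfolding cov_deriv_def
  by (intro field_on_add W field_on_ddir_poly[OF W g X] field_on_clifford[OF W clifford_map_rho0 conn_form_smooth[OF W order_refl X] g])

lemma cov_deriv_tlin:
  assumes x: "x \<in> W" and g: "field_on W m g" and v: "v \<in> tangent M x" and w: "w \<in> tangent M x"
  shows "cov_deriv m (tlin a v b w) g x = smult (of_real a) (cov_deriv m v g x) + smult (of_real b) (cov_deriv m w g x)"
  unfolding cov_deriv_def ddir_poly_tlin[OF W x g] conn_form_tlin[OF x v w] clifford_map_facts(7)[OF clifford_map_rho0]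
  by (simp add: smult_add_right)

lemma cov_deriv_tcomb:
  assumes x: "x \<in> W" and g: "field_on W m g" and e: "\<And>i. e i \<in> tangent M x"
  shows "cov_deriv m (tcomb e \<xi>) g x = (\<Sum>i\<in>UNIV. smult (of_real (\<xi> $ i)) (cov_deriv m (e i) g x))"
  unfolding tcomb_nested sum_3
  by (simp add: cov_deriv_tlin[OF x g] tangent_tlin e smult_add_right)

text \<open>Clifford multiplication is parallel: by the commutator condition the connection form
  acts as a derivation, and \<open>ddir a + ad (conn_form) a\<close> is the covariant derivative
  of the vector field with coordinates \<open>a\<close>.\<close>

lemma cov_deriv_clifford:
  assumes x: "x \<in> W" and F: "clifford_map m m' F" and a: "smooth_fun M W a" and g: "field_on W m g"
  shows "cov_deriv m' v (\<lambda>y. F (a y) (g y)) x = F (ddir M x v a + ad (conn_form x v) (a x)) (g x) + F (a x) (cov_deriv m v g x)"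
  unfolding cov_deriv_def ddir_poly_clifford[OF W x F a g] clifford_map_facts(3)[OF F field_onD(1)[OF g x]]
    clifford_map_add_vec(1)[OF F] clifford_map_facts(4)[OF F]
  by (simp add: algebra_simps)

lemma cov_deriv_sum:
  assumes x: "x \<in> W" and f: "\<And>i. i \<in> I \<Longrightarrow> field_on W m (f i)"
  shows "cov_deriv m v (\<lambda>y. \<Sum>i\<in>I. f i y) x = (\<Sum>i\<in>I. cov_deriv m v (f i) x)"
  using ddir_poly_sum[OF W x f] by (simp add: cov_deriv_def clifford_map_facts(6)[OF clifford_map_rho0] sum.distrib)

subsection \<open>Independence of the section\<close>

text \<open>Near \<open>x\<close> the transition from \<open>s\<close> to \<open>t\<close>
  factors through a section of the bundle atlas.\<close>

lemma transition_smooth: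
  assumes t: "spin_section M U t" and x: "x \<in> W" "x \<in> U"
  obtains N where "openin (base M) N" "x \<in> N" "N \<subseteq> W" "N \<subseteq> U" "smooth_fun M N (spin_transition M s t)"
proof -
  obtain A r where Ar: "(A, r) \<in> spin_atlas M" "x \<in> A"
    and A: "openin (base M) A" "\<forall>y\<in>A. r y \<in> spin_fibre M y"
    by (rule spin_atlas_near[OF W_top[OF x(1)]])
  have tU: "openin (base M) U" "\<And>y. y \<in> U \<Longrightarrow> t y \<in> spin_fibre M y" using t by (auto simp: spin_section_def)
  define N where "N = W \<inter> U \<inter> A"
  have N: "openin (base M) N" using W tU(1) A(1) by (simp add: N_def openin_Int)
  have s1: "smooth_fun M (W \<inter> A) (spin_transition M r s)"
    using sect Ar by (auto simp: spin_section_def)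
  have s2: "smooth_fun M (U \<inter> A) (spin_transition M r t)"
    using t Ar by (auto simp: spin_section_def)
  have "smooth_fun M N (\<lambda>y. adj (spin_transition M r s y) ** spin_transition M r t y)"
    by (intro smooth_fun_bilinear[OF bounded_bilinear_mat_mult] smooth_fun_linear[OF bounded_linear_adj] N
        smooth_fun_subset[OF s1] smooth_fun_subset[OF s2]) (auto simp: N_def)
  moreover have "adj (spin_transition M r s y) ** spin_transition M r t y = spin_transition M s t y" if "y \<in> N" for y
  proof -
    have f: "r y \<in> spin_fibre M y" "s y \<in> spin_fibre M y" "t y \<in> spin_fibre M y"
      using that A(2) tU(2) s_fibre by (auto simp: N_def)
    let ?k = "spin_transition M r s y" and ?l = "spin_transition M r t y"
    note k = spin_transition_works[of r y s, OF f(1,2)]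
    note l = spin_transition_works[of r y t, OF f(1,3)]
    have "spin_act M (s y) (adj ?k ** ?l) = spin_act M (r y) (?k ** (adj ?k ** ?l))"
      using fibre_facts(4)[OF f(1) k(1) SU2_mult[OF SU2_adj[OF k(1)] l(1)]] k(2) by simp
    also have "\<dots> = t y" using l(2) SU2_inverse(1)[OF k(1)] by (simp add: mat_mult_simps)
    finally show ?thesis
      using spin_transition_eq[of s y "adj ?k ** ?l" t, OF f(2) SU2_mult[OF SU2_adj[OF k(1)] l(1)]] by simp
  qed
  ultimately have "smooth_fun M N (spin_transition M s t)"
    using smooth_fun_cong[OF N, of "\<lambda>y. adj (spin_transition M r s y) ** spin_transition M r t y" "spin_transition M s t"]
    by blast
  then show ?thesis using that[OF N] x Ar by (auto simp: N_def)
qed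

text \<open>The pair that an arbitrary section \<open>t = s h\<close> contributes to
  \<open>nabla\<close>. The connection form of \<open>t\<close> is \<open>Ad h\<inverse>
  \<omega> + h\<inverse> dh\<close>, with \<open>\<omega>\<close> that of \<open>s\<close>; its
  second summand cancels the inhomogeneous term of \<open>gauge_ddir_poly\<close>.\<close>

lemma nabla_value:
  assumes g: "field_on W m g" and \<phi>: "\<And>y. y \<in> W \<Longrightarrow> \<phi> y = spinor_class M m (s y) (g y)"
    and x: "x \<in> W" and v: "v \<in> tangent M x" and t: "spin_section M U t" "x \<in> U"
  shows "(\<Sum>k\<le>nat m. monom (ddir M x v (\<lambda>y. coeff (spinor_coord t \<phi> y) k)) k)
            + drep m (su2_of (spin_form M t x v)) (spinor_coord t \<phi> x)
    = rep m (adj (spin_transition M s t x)) (cov_deriv m v g x)"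
proof -
  obtain N where N: "openin (base M) N" "x \<in> N" "N \<subseteq> W" "N \<subseteq> U" "smooth_fun M N (spin_transition M s t)"
    by (rule transition_smooth[OF t(1) x t(2)])
  let ?h = "spin_transition M s t" and ?k = "adj (spin_transition M s t x)"
  have tf: "t y \<in> spin_fibre M y" if "y \<in> N" for y using t(1) N(4) that by (auto simp: spin_section_def)
  have sf: "s y \<in> spin_fibre M y" if "y \<in> N" for y using N(3) that s_fibre by auto
  have hS: "?h y \<in> SU2" and th: "t y = spin_act M (s y) (?h y)" if "y \<in> N" for y
    using spin_transition_works[of s y t, OF sf[OF that] tf[OF that]] by auto
  define \<beta> where "\<beta> = su2_coord (adj (?h x) ** ddir M x v ?h)"
  note G = gauge_derivative[OF N(1,2,5) hS]
  have gN: "field_on N m g" by (rule field_on_subset[OF g N(3)])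
  have gx: "g x \<in> V_space m" by (rule field_onD(1)[OF g x])
  note hx = hS[OF N(2)]
  have coord: "spinor_coord t \<phi> y = rep m (adj (?h y)) (g y)" if y: "y \<in> N" for y
    unfolding spinor_coord_def
    by (rule the_equality)
      (use \<phi>[of y] N(3) y spinor_class_iff[OF sf[OF y] hS[OF y], of _ m "g y"] th[OF y] in auto)
  have form: "spin_form M t x v = Ad (?k) (conn_form x v) + \<beta>"
  proof (rule spin_form_eqI[where t=t, OF x tf[OF N(2)]])
    fix j
    let ?a = "\<lambda>y. Ad (?h y) (axis j 1)"
    have fr: "Ecomb y (?a y) = spin_frame M (t y) j" if "y \<in> N" for y
      using frame_act[OF sf[OF that] hS[OF that], of "axis j 1"] th[OF that] by (simp add: tcomb_axis)
    have sa: "smooth_fun M N ?a" by (rule G(5))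
    have sv: "smooth_vfield M N (\<lambda>y. Ecomb y (?a y))"
      by (rule smooth_vfield_tcomb[OF N(1) smooth_vfield_subset[OF frame_smooth N(3)] sa])
    have sv': "smooth_vfield M N (\<lambda>y. spin_frame M (t y) j)"
      by (rule smooth_vfield_cong[OF N(1) _ sv]) (rule fr)
    have "lc M x v (\<lambda>y. spin_frame M (t y) j) = lc M x v (\<lambda>y. Ecomb y (?a y))"
      by (rule lc_rules(4)[OF N(1) sv N(2) v sv', symmetric]) (rule fr)
    also have "\<dots> = Ecomb x (ddir M x v ?a + ad (conn_form x v) (?a x))"
      by (rule lc_tcomb_E[OF N(1,3,2) sa v])
    also have "ddir M x v ?a + ad (conn_form x v) (?a x) = Ad (?h x) (ad (Ad (?k) (conn_form x v) + \<beta>) (axis j 1))"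
    proof -
      have G3: "ddir M x v ?a = Ad (?h x) (ad \<beta> (axis j 1))"
        unfolding \<beta>_def by (rule gauge_derivative(3)[OF N(1,2,5) hS])
      have "su2_of (ddir M x v ?a + ad (conn_form x v) (?a x)) = su2_of (Ad (?h x) (ad (Ad (?k) (conn_form x v) + \<beta>) (axis j 1)))"
        unfolding G3 su2_of_simps su2_of_Ad[OF hx] su2_of_ad su2_of_Ad[OF SU2_adj[OF hx]]
        by (simp add: mat_mult_simps adj_simps SU2_inverse[OF hx] SU2_cancel[OF hx] algebra_simps)
      then show ?thesis by (simp only: su2_of_inject)
    qed
    also have "Ecomb x (Ad (?h x) (ad (Ad (?k) (conn_form x v) + \<beta>) (axis j 1)))
        = tcomb (spin_frame M (t x)) (ad (Ad (?k) (conn_form x v) + \<beta>) (axis j 1))"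
      unfolding th[OF N(2)] by (rule frame_act[OF sf[OF N(2)] hx, symmetric])
    finally show "lc M x v (\<lambda>y. spin_frame M (t y) j)
        = tcomb (spin_frame M (t x)) (ad (Ad (?k) (conn_form x v) + \<beta>) (axis j 1))" .
  qed
  have "(\<Sum>k\<le>nat m. monom (ddir M x v (\<lambda>y. coeff (spinor_coord t \<phi> y) k)) k) = ddir_poly m v (spinor_coord t \<phi>) x"
    by (simp add: ddir_poly_def)
  also have "\<dots> = ddir_poly m v (\<lambda>y. rep m (adj (?h y)) (g y)) x"
    by (rule ddir_poly_cong[OF N(1,2) coord])
  also have "\<dots> = rep m (?k) (ddir_poly m v g x - rho0 m (Ad (?h x) \<beta>) (g x))"
    unfolding \<beta>_def by (rule gauge_ddir_poly[OF N(1,2,5) hS gN])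
  finally have 1: "(\<Sum>k\<le>nat m. monom (ddir M x v (\<lambda>y. coeff (spinor_coord t \<phi> y) k)) k)
     = rep m (?k) (ddir_poly m v g x) - rep m (?k) (rho0 m (Ad (?h x) \<beta>) (g x))"
    by (simp add: rep_diff)
  have AA: "Ad (?k) (Ad (?h x) \<beta>) = \<beta>"
    unfolding su2_of_inject[symmetric] su2_of_Ad[OF SU2_adj[OF hx]] su2_of_Ad[OF hx]
    by (simp add: adj_simps mat_mult_simps SU2_inverse[OF hx] SU2_cancel[OF hx])
  have "drep m (su2_of (spin_form M t x v)) (spinor_coord t \<phi> x)
     = rho0 m (Ad (?k) (conn_form x v)) (rep m (?k) (g x)) + rho0 m \<beta> (rep m (?k) (g x))"
    unfolding coord[OF N(2)] drep_su2_of[OF rep_V_space[OF gx]] form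
    by (rule clifford_map_add_vec(1)[OF clifford_map_rho0])
  also have "rho0 m (Ad (?k) (conn_form x v)) (rep m (?k) (g x)) = rep m (?k) (rho0 m (conn_form x v) (g x))"
    by (rule rho0_equivariant[OF SU2_adj[OF hx] gx])
  also have "rho0 m \<beta> (rep m (?k) (g x)) = rep m (?k) (rho0 m (Ad (?h x) \<beta>) (g x))"
    using rho0_equivariant[OF SU2_adj[OF hx] gx, of "Ad (?h x) \<beta>"] unfolding AA .
  finally show ?thesis unfolding 1 cov_deriv_def by (simp add: rep_add)
qed

lemma act_section:
  assumes k: "k \<in> SU2"
  shows "spin_section M W (\<lambda>y. spin_act M (s y) k)"
  unfolding spin_section_def
proof (intro conjI ballI W)
  fix x assume "x \<in> W" then show "spin_act M (s x) k \<in> spin_fibre M x"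
    using fibre_facts(3)[OF s_fibre k] by blast
next
  fix z assume z: "z \<in> spin_atlas M"
  obtain A r where Ar: "z = (A, r)" by (cases z)
  note at = spin_atlas_section
  have A: "openin (base M) A" "\<And>y. y \<in> A \<Longrightarrow> r y \<in> spin_fibre M y" using at z Ar by auto
  have N: "openin (base M) (W \<inter> A)" using W A(1) by (rule openin_Int)
  have "smooth_fun M (W \<inter> A) (spin_transition M r s)"
    using sect z Ar by (auto simp: spin_section_def)
  then have sm: "smooth_fun M (W \<inter> A) (\<lambda>y. spin_transition M r s y ** k)"
    by (rule smooth_fun_bilinear[OF bounded_bilinear_mat_mult N _ smooth_fun_const])
  have eq: "spin_transition M r s y ** k = spin_transition M r (\<lambda>y. spin_act M (s y) k) y" if "y \<in> W \<inter> A" for y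
  proof -
    have f: "r y \<in> spin_fibre M y" "s y \<in> spin_fibre M y" using that A(2) s_fibre by auto
    note w = spin_transition_works[of r y s, OF f]
    show ?thesis
      by (rule spin_transition_eq[where s=r and t="\<lambda>y. spin_act M (s y) k" and x=y, OF f(1) SU2_mult[OF w(1) k], symmetric])
        (use fibre_facts(4)[OF f(1) w(1) k] w(2) in simp)
  qed
  have "smooth_fun M (W \<inter> A) (spin_transition M r (\<lambda>y. spin_act M (s y) k))"
    by (rule smooth_fun_cong[OF N, THEN iffD1, rotated, OF sm]) (rule eq)
  then show "case z of (U, t) \<Rightarrow> smooth_fun M (W \<inter> U) (spin_transition M t (\<lambda>y. spin_act M (s y) k))"
    unfolding Ar prod.case .
qed

text \<open>By \<open>nabla_value\<close> all pairs lie in the class; conversely every point of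
  the fibre over \<open>x\<close> lies on a section \<open>s k\<close> with constant
  \<open>k\<close>.\<close>

lemma nabla_class:
  assumes g: "field_on W m g" and \<phi>: "\<And>y. y \<in> W \<Longrightarrow> \<phi> y = spinor_class M m (s y) (g y)"
    and x: "x \<in> W" and v: "v \<in> tangent M x"
  shows "nabla M m v \<phi> x = spinor_class M m (s x) (cov_deriv m v g x)"
proof -
  let ?val = "\<lambda>t. (\<Sum>k\<le>nat m. monom (ddir M x v (\<lambda>y. coeff (spinor_coord t \<phi> y) k)) k)
            + drep m (su2_of (spin_form M t x v)) (spinor_coord t \<phi> x)"
  have val: "?val t = rep m (adj (spin_transition M s t x)) (cov_deriv m v g x)"
    if "spin_section M U t" "x \<in> U" for U t
    by (rule nabla_value[OF g _ x v that]) (rule \<phi>)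
  show ?thesis
  proof (intro equalityI subsetI)
    fix z assume "z \<in> nabla M m v \<phi> x"
    then have "\<exists>U t. z = (t x, ?val t) \<and> spin_section M U t \<and> x \<in> U"
      unfolding nabla_def mem_Collect_eq .
    then obtain U t where t: "z = (t x, ?val t) \<and> spin_section M U t \<and> x \<in> U"
      by (elim exE)
    note t = t[THEN conjunct2, THEN conjunct1] t[THEN conjunct2, THEN conjunct2] t[THEN conjunct1]
    have f: "s x \<in> spin_fibre M x" "t x \<in> spin_fibre M x" using t(1,2) s_fibre[OF x] by (auto simp: spin_section_def)
    note w = spin_transition_works[of s x t, OF f]
    have "z = (spin_act M (s x) (spin_transition M s t x), rep m (adj (spin_transition M s t x)) (cov_deriv m v g x))"
      by (simp only: t(3) val[OF t(1,2)] w(2)[symmetric])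
    then show "z \<in> spinor_class M m (s x) (cov_deriv m v g x)" unfolding spinor_class_mem using w(1) by blast
  next
    fix z assume "z \<in> spinor_class M m (s x) (cov_deriv m v g x)"
    then obtain k where k: "k \<in> SU2" "z = (spin_act M (s x) k, rep m (adj k) (cov_deriv m v g x))"
      unfolding spinor_class_mem by blast
    define t where "t = (\<lambda>y. spin_act M (s y) k)"
    have t: "spin_section M W t" unfolding t_def by (rule act_section[OF k(1)])
    have st: "spin_transition M s t x = k"
      by (rule spin_transition_eq[where s=s and t=t and x=x, OF s_fibre[OF x] k(1)]) (simp add: t_def)
    have tx: "t x = spin_act M (s x) k" by (simp add: t_def)
    have "z = (t x, ?val t)" by (simp only: val[OF t x] k(2) st tx)
    then show "z \<in> nabla M m v \<phi> x" unfolding nabla_def mem_Collect_eq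
      by (intro exI[of _ W] exI[of _ t] conjI t x)
  qed
qed

subsection \<open>The Dirac operators in a local section\<close>

lemma frame_near_onframe:
  assumes "x \<in> W"
  obtains U where "x \<in> U" "local_onframe M U (frame_near M x)"
proof -
  have "\<exists>U. x \<in> U \<and> local_onframe M U (frame_near M x)"
    unfolding frame_near_def
    by (rule someI[where P="\<lambda>e. \<exists>U. x \<in> U \<and> local_onframe M U e" and x=E])
      (rule exI[of _ W], rule conjI[OF assms E_local_onframe])
  then show ?thesis using that by blast
qed

text \<open>The sum is the trace of a bilinear expression, and the two bases differ by an
  orthogonal matrix.\<close>

lemma onb_sum_independent:
  assumes x: "x \<in> W" and e: "oriented_onb M x e" and F: "clifford_map m m' F" and g: "field_on W m g"
  shows "(\<Sum>i\<in>UNIV. F (frame_coord x (e i)) (cov_deriv m (e i) g x)) = (\<Sum>k\<in>UNIV. F (axis k 1) (cov_deriv m (E k x) g x))"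
proof -
  let ?a = "\<lambda>i. frame_coord x (e i)"
  have te: "Ecomb x (?a i) = e i" for i
    by (rule frame_coord_works[OF x onb_in_tangent[OF e]])
  have e': "oriented_onb M x (\<lambda>i. Ecomb x (?a i))" using e by (simp add: te)
  have o: "(\<Sum>i\<in>UNIV. ?a i $ k * ?a i $ l) = (if k = l then 1 else 0)" for k l
    by (rule onb_change(5)[OF e' E_onb[OF x] W_top[OF x]])
  have "F (?a i) (cov_deriv m (e i) g x) =
     (\<Sum>l\<in>UNIV. \<Sum>k\<in>UNIV. smult (of_real (?a i $ l * ?a i $ k)) (F (axis l 1) (cov_deriv m (E k x) g x)))" for i
  proof -
    have c: "cov_deriv m (e i) g x = (\<Sum>k\<in>UNIV. smult (of_real (?a i $ k)) (cov_deriv m (E k x) g x))"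
    proof -
      have "cov_deriv m (Ecomb x (?a i)) g x = (\<Sum>k\<in>UNIV. smult (of_real (?a i $ k)) (cov_deriv m (E k x) g x))"
        by (rule cov_deriv_tcomb[OF x g E_tangent[OF x]])
      then show ?thesis unfolding te .
    qed
    have "F (?a i) p = (\<Sum>l\<in>UNIV. smult (of_real (?a i $ l)) (F (axis l 1) p))" for p
      by (subst vec3_expand[of "?a i"]) (simp add: clifford_map_add_vec[OF F])
    then show ?thesis
      unfolding c by (subst sum.swap) (simp add: clifford_map_facts(5,6)[OF F] smult_sum_right mult.commute)
  qed
  then have "(\<Sum>i\<in>UNIV. F (?a i) (cov_deriv m (e i) g x)) =
     (\<Sum>i\<in>UNIV. \<Sum>l\<in>UNIV. \<Sum>k\<in>UNIV. smult (of_real (?a i $ l * ?a i $ k)) (F (axis l 1) (cov_deriv m (E k x) g x)))"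
    by simp
  also have "\<dots> = (\<Sum>l\<in>UNIV. \<Sum>k\<in>UNIV. smult (of_real (\<Sum>i\<in>UNIV. ?a i $ l * ?a i $ k)) (F (axis l 1) (cov_deriv m (E k x) g x)))"
    by (simp add: sum_3 smult_add_left)
  also have "\<dots> = (\<Sum>k\<in>UNIV. F (axis k 1) (cov_deriv m (E k x) g x))"
    unfolding o by (simp add: sum_3)
  finally show ?thesis .
qed

text \<open>The chosen frame varies with the point in an uncontrolled way. Because of the
  independence, any smooth frame may be used instead, which makes the result a smooth field
  again.\<close>

lemma dirac_class:
  assumes g: "field_on W m g" and \<phi>: "\<And>y. y \<in> W \<Longrightarrow> \<phi> y = spinor_class M m (s y) (g y)"
    and x: "x \<in> W" and F: "clifford_map m m' F" and e: "oriented_onb M x e"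
  shows "dirac M m F \<phi> x = spinor_class M m' (s x) (\<Sum>i\<in>UNIV. F (frame_coord x (e i)) (cov_deriv m (e i) g x))"
proof -
  obtain U where U: "x \<in> U" "local_onframe M U (frame_near M x)" by (rule frame_near_onframe[OF x])
  let ?e = "\<lambda>i. frame_near M x i x"
  have e': "oriented_onb M x ?e" using U by (simp add: local_onframe_def)
  note eq = clifford_map_facts(2)[OF F]
  have b: "bundle_map M F (?e i) (nabla M m (?e i) \<phi> x) = spinor_class M m' (s x) (F (frame_coord x (?e i)) (cov_deriv m (?e i) g x))" for i
  proof -
    have t: "?e i \<in> tangent M x" by (rule onb_in_tangent[OF e'])
    show ?thesis
      using bundle_map_class[OF s_fibre[OF x] cov_deriv_V_space[OF g x] eq, of "frame_coord x (?e i)" "?e i"]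
      by (simp add: nabla_class[OF g \<phi> x t] frame_coord_works[OF x t])
  qed
  have "dirac M m F \<phi> x = spinor_class M m' (s x) (\<Sum>i\<in>UNIV. F (frame_coord x (?e i)) (cov_deriv m (?e i) g x))"
    unfolding dirac_def Let_def b by (rule spinor_sum_class[OF s_fibre[OF x]]) simp
  then show ?thesis by (simp only: onb_sum_independent[OF x e F g] onb_sum_independent[OF x e' F g])
qed

end

section \<open>The second-order identities\<close>

lemma sum_permutations_3:
  fixes f :: "(3 \<Rightarrow> 3) \<Rightarrow> 'b::comm_monoid_add"
  shows "(\<Sum>\<sigma> | \<sigma> permutes (UNIV :: 3 set). f \<sigma>) =
     f id + f (Transposition.transpose 2 3) + (f (Transposition.transpose 1 2) + f (Transposition.transpose 1 2 \<circ> Transposition.transpose 2 3)) + (f (Transposition.transpose 1 3) + f (Transposition.transpose 1 3 \<circ> Transposition.transpose 2 3))"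
proof -
  have f123: "finite {2::3, 3}" "1 \<notin> {2::3, 3}" by auto
  have f23: "finite {3::3}" "2 \<notin> {3::3}" by auto
  show ?thesis
    unfolding UNIV_3 sum_over_permutations_insert[OF f123] sum_over_permutations_insert[OF f23] permutes_sing
    by (simp add: add.assoc)
qed

context spin_patch begin

context
  fixes m :: int and g :: "'a \<Rightarrow> complex poly" and \<psi> :: "'a \<Rightarrow> 'p spinor" and e :: "3 \<Rightarrow> 'a vfield" and x :: 'a
  assumes g: "field_on W m g" and \<psi>: "\<And>y. y \<in> W \<Longrightarrow> \<psi> y = spinor_class M m (s y) (g y)"
    and e: "local_onframe M W e" and x: "x \<in> W"
begin

lemma frame_facts:
  shows "smooth_vfield M W (e i)" "y \<in> W \<Longrightarrow> oriented_onb M y (\<lambda>i. e i y)" "y \<in> W \<Longrightarrow> e i y \<in> tangent M y"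
  using e by (auto simp: local_onframe_def oriented_onb_def)

abbreviation "ecoord i \<equiv> frame_coord x (e i x)"

text \<open>The coordinates of the second covariant derivative \<open>\<nabla>\<^sub>X
  \<nabla>\<^sub>Y - \<nabla>\<^sub>Z\<close> with \<open>Z = \<nabla>\<^sub>X Y\<close>, for
  the frame vectors \<open>X = e i\<close> and \<open>Y = e j\<close>.\<close>

definition hess :: "3 \<Rightarrow> 3 \<Rightarrow> complex poly" where
  "hess i j = cov_deriv m (e i x) (\<lambda>y. cov_deriv m (e j y) g y) x - cov_deriv m (lc M x (e i x) (e j)) g x"

lemma field_on_cov_deriv_frame: "field_on W m (\<lambda>y. cov_deriv m (e j y) g y)"
  by (rule field_on_cov_deriv[OF g frame_facts(1)])

lemma lc_frame_tangent: "lc M x (e i x) (e j) \<in> tangent M x"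
  by (rule lc_rules(1)[OF W frame_facts(1) x frame_facts(3)[OF x]])

lemma hess_V_space: "hess i j \<in> V_space m"
  unfolding hess_def by (intro V_space_diff cov_deriv_V_space[OF _ x] field_on_cov_deriv_frame g)

lemma ecoord_rotation:
  shows "ecoord i \<bullet> ecoord j = (if i = j then 1 else 0)"
    and "cross3 (ecoord 1) (ecoord 2) = ecoord 3" "cross3 (ecoord 2) (ecoord 3) = ecoord 1" "cross3 (ecoord 3) (ecoord 1) = ecoord 2"
proof -
  have "oriented_onb M x (\<lambda>i. Ecomb x (ecoord i))"
    using frame_facts(2)[OF x] by (simp add: frame_coord_works[OF x frame_facts(3)[OF x]])
  note o = onb_change[OF this E_onb[OF x] W_top[OF x]]
  show "ecoord i \<bullet> ecoord j = (if i = j then 1 else 0)" by (rule o(1))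
  show "cross3 (ecoord 1) (ecoord 2) = ecoord 3" "cross3 (ecoord 2) (ecoord 3) = ecoord 1" "cross3 (ecoord 3) (ecoord 1) = ecoord 2"
    by (rule o(2) o(3) o(4))+
qed

text \<open>The left-hand side collects the terms in which \<open>\<nabla>\<close> hits the
  vector in the Clifford multiplication. Expand \<open>\<nabla> e j\<close> in the frame: its
  coefficients are skew, so the derivative may be moved, with a sign, to the vector along which
  the spinor is differentiated.\<close>

lemma frame_derivative_terms:
  assumes F: "clifford_map m m' F" and v: "v \<in> tangent M x"
  shows "(\<Sum>j\<in>UNIV. F (ddir M x v (\<lambda>y. frame_coord y (e j y)) + ad (conn_form x v) (ecoord j)) (cov_deriv m (e j x) g x))
     = - (\<Sum>j\<in>UNIV. F (ecoord j) (cov_deriv m (lc M x v (e j)) g x))"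
proof -
  define \<Gamma> where "\<Gamma> j k = metric M x (lc M x v (e j)) (e k x)" for j k
  have sk: "\<Gamma> j k = - \<Gamma> k j" for j k
    unfolding \<Gamma>_def by (rule lc_onframe_skew[OF e x v])
  let ?c = "\<lambda>j. cov_deriv m (e j x) g x"
  have t: "lc M x v (e j) \<in> tangent M x" for j
    by (rule lc_rules(1)[OF W frame_facts(1) x v])
  have l: "lc M x v (e j) = tcomb (\<lambda>k. e k x) (\<chi> k. \<Gamma> j k)" for j
    unfolding \<Gamma>_def by (rule onb_expand_metric[OF frame_facts(2)[OF x] W_top[OF x] t])
  have sa: "smooth_fun M W (\<lambda>y. frame_coord y (e j y))" for j
    by (rule frame_coord_smooth[OF W order_refl frame_facts(1)])
  have "ddir M x v (\<lambda>y. frame_coord y (e j y)) + ad (conn_form x v) (ecoord j) = (\<Sum>k\<in>UNIV. \<Gamma> j k *\<^sub>R ecoord k)" for j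
  proof -
    have xw: "Ecomb y (frame_coord y (e j y)) = e j y" if "y \<in> W" for y j
      by (rule frame_coord_works[OF that frame_facts(3)[OF that]])
    have "Ecomb x (ddir M x v (\<lambda>y. frame_coord y (e j y)) + ad (conn_form x v) (ecoord j))
       = lc M x v (\<lambda>y. Ecomb y (frame_coord y (e j y)))"
      by (rule lc_tcomb_E[OF W order_refl x sa v, symmetric])
    also have "\<dots> = lc M x v (e j)"
      by (rule lc_rules(4)[OF W frame_facts(1) x v, symmetric])
        (auto simp: xw intro: smooth_vfield_tcomb[OF W frame_smooth sa])
    also have "\<dots> = Ecomb x (\<Sum>k\<in>UNIV. \<Gamma> j k *\<^sub>R ecoord k)"
    proof
      fix c
      have "lc M x v (e j) c = (\<Sum>k\<in>UNIV. \<Gamma> j k *\<^sub>R Ecomb x (ecoord k) c)"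
        unfolding l by (simp add: tcomb_def[of "\<lambda>k. e k x"] xw[OF x])
      then show "lc M x v (e j) c = Ecomb x (\<Sum>k\<in>UNIV. \<Gamma> j k *\<^sub>R ecoord k) c"
        by (simp only: linear_sum[OF linear_tcomb] linear_scale[OF linear_tcomb])
    qed
    finally show ?thesis by (simp only: E_inject[OF x])
  qed
  then have "(\<Sum>j\<in>UNIV. F (ddir M x v (\<lambda>y. frame_coord y (e j y)) + ad (conn_form x v) (ecoord j)) (?c j))
     = (\<Sum>j\<in>UNIV. \<Sum>k\<in>UNIV. smult (of_real (\<Gamma> j k)) (F (ecoord k) (?c j)))"
    by (simp only: clifford_map_add_vec(2,4)[OF F])
  also have "\<dots> = (\<Sum>k\<in>UNIV. \<Sum>j\<in>UNIV. smult (of_real (\<Gamma> j k)) (F (ecoord k) (?c j)))"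
    by (rule sum.swap)
  also have "\<dots> = (\<Sum>k\<in>UNIV. \<Sum>j\<in>UNIV. - smult (of_real (\<Gamma> k j)) (F (ecoord k) (?c j)))"
    by (intro sum.cong refl) (subst sk, simp only: of_real_minus smult_minus_left)
  also have "\<dots> = - (\<Sum>k\<in>UNIV. \<Sum>j\<in>UNIV. smult (of_real (\<Gamma> k j)) (F (ecoord k) (?c j)))"
    by (simp only: sum_negf)
  also have "(\<Sum>k\<in>UNIV. \<Sum>j\<in>UNIV. smult (of_real (\<Gamma> k j)) (F (ecoord k) (?c j)))
     = (\<Sum>j\<in>UNIV. F (ecoord j) (cov_deriv m (lc M x v (e j)) g x))"
  proof (intro sum.cong refl)
    fix k :: 3
    have "cov_deriv m (lc M x v (e k)) g x = (\<Sum>j\<in>UNIV. smult (of_real (\<Gamma> k j)) (?c j))"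
      unfolding l cov_deriv_tcomb[OF x g frame_facts(3)[OF x]] by simp
    then show "(\<Sum>j\<in>UNIV. smult (of_real (\<Gamma> k j)) (F (ecoord k) (?c j))) = F (ecoord k) (cov_deriv m (lc M x v (e k)) g x)"
      by (simp only: clifford_map_facts(5,6)[OF F])
  qed
  finally show ?thesis .
qed

text \<open>The terms of \<open>frame_derivative_terms\<close> are exactly those completing
  \<open>\<nabla>\<^sub>X \<nabla>\<^sub>Y\<close> to the second covariant derivative, so no
  first-order terms remain.\<close>

lemma dirac_dirac_class:
  assumes F: "clifford_map m m' F" and G: "clifford_map m' m'' G"
  shows "dirac M m' G (dirac M m F \<psi>) x =
    spinor_class M m'' (s x) (\<Sum>i\<in>UNIV. \<Sum>j\<in>UNIV. G (ecoord i) (F (ecoord j) (hess i j)))"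
proof -
  let ?f = "\<lambda>j y. F (frame_coord y (e j y)) (cov_deriv m (e j y) g y)"
  have sa: "smooth_fun M W (\<lambda>y. frame_coord y (e j y))" for j
    by (rule frame_coord_smooth[OF W order_refl frame_facts(1)])
  have f: "field_on W m' (?f j)" for j
    by (rule field_on_clifford[OF W F sa field_on_cov_deriv_frame])
  have sf: "field_on W m' (\<lambda>y. \<Sum>j\<in>UNIV. ?f j y)"
    by (rule field_on_sum[OF W f])
  have "dirac M m F \<psi> y = spinor_class M m' (s y) (\<Sum>j\<in>UNIV. ?f j y)" if y: "y \<in> W" for y
    by (rule dirac_class[OF g \<psi> y F frame_facts(2)[OF y]])
  then have "dirac M m' G (dirac M m F \<psi>) x =
     spinor_class M m'' (s x) (\<Sum>i\<in>UNIV. G (ecoord i) (cov_deriv m' (e i x) (\<lambda>y. \<Sum>j\<in>UNIV. ?f j y) x))"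
    by (rule dirac_class[OF sf _ x G frame_facts(2)[OF x]])
  moreover have "cov_deriv m' (e i x) (\<lambda>y. \<Sum>j\<in>UNIV. ?f j y) x = (\<Sum>j\<in>UNIV. F (ecoord j) (hess i j))" for i
  proof -
    note neg = clifford_map_diff[OF F]
    have "cov_deriv m' (e i x) (\<lambda>y. \<Sum>j\<in>UNIV. ?f j y) x = (\<Sum>j\<in>UNIV. cov_deriv m' (e i x) (?f j) x)"
      by (rule cov_deriv_sum[OF x f])
    also have "\<dots> = (\<Sum>j\<in>UNIV. F (ddir M x (e i x) (\<lambda>y. frame_coord y (e j y)) + ad (conn_form x (e i x)) (ecoord j)) (cov_deriv m (e j x) g x))
        + (\<Sum>j\<in>UNIV. F (ecoord j) (cov_deriv m (e i x) (\<lambda>y. cov_deriv m (e j y) g y) x))"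
      by (simp only: cov_deriv_clifford[OF x F sa field_on_cov_deriv_frame] sum.distrib)
    also have "\<dots> = (\<Sum>j\<in>UNIV. F (ecoord j) (hess i j))"
      unfolding frame_derivative_terms[OF F frame_facts(3)[OF x]] hess_def neg sum_subtractf by simp
    finally show ?thesis .
  qed
  ultimately show ?thesis by (simp only: clifford_map_facts(6)[OF G])
qed

lemma nabla_psi: "v \<in> tangent M x \<Longrightarrow> nabla M m v \<psi> x = spinor_class M m (s x) (cov_deriv m v g x)"
  by (rule nabla_class[OF g \<psi> x])

lemma nabla_nabla_psi:
  "v \<in> tangent M x \<Longrightarrow> nabla M m v (\<lambda>y. nabla M m (e j y) \<psi> y) x
     = spinor_class M m (s x) (cov_deriv m v (\<lambda>y. cov_deriv m (e j y) g y) x)"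
  by (rule nabla_class[OF field_on_cov_deriv_frame _ x]) (rule nabla_class[OF g \<psi> _ frame_facts(3)])

lemma conn_laplacian_class:
  assumes "frame_near M x = e"
  shows "conn_laplacian M m \<psi> x = spinor_class M m (s x) (- (\<Sum>i\<in>UNIV. hess i i))"
proof -
  have "spinor_diff (nabla M m (e i x) (\<lambda>y. nabla M m (e i y) \<psi> y) x) (nabla M m (lc M x (e i x) (e i)) \<psi> x)
     = spinor_class M m (s x) (hess i i)" for i
    unfolding nabla_nabla_psi[OF frame_facts(3)[OF x]] nabla_psi[OF lc_frame_tangent] hess_def
    by (rule spinor_diff_class[OF s_fibre[OF x]])
  then show ?thesis
    unfolding conn_laplacian_def assms Let_def
    by (simp add: spinor_sum_class[OF s_fibre[OF x]] spinor_scale_class)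
qed

text \<open>The connection is torsion free, so the first-order terms of the two second covariant
  derivatives add up to the one with the bracket.\<close>

lemma curvature_class:
  "curvature M m (e i) (e j) \<psi> x = spinor_class M m (s x) (hess i j - hess j i)"
proof -
  have b: "lie_bracket M (e i) (e j) x = tlin 1 (lc M x (e i x) (e j)) (-1) (lc M x (e j x) (e i))"
    by (rule lc_torsion[OF W frame_facts(1) frame_facts(1) x])
  have t: "lie_bracket M (e i) (e j) x \<in> tangent M x"
    unfolding b by (rule tangent_tlin[OF lc_frame_tangent lc_frame_tangent])
  have c: "cov_deriv m (lie_bracket M (e i) (e j) x) g x = cov_deriv m (lc M x (e i x) (e j)) g x - cov_deriv m (lc M x (e j x) (e i)) g x"
    unfolding b by (simp add: cov_deriv_tlin[OF x g lc_frame_tangent lc_frame_tangent])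
  show ?thesis
    unfolding curvature_def nabla_nabla_psi[OF frame_facts(3)[OF x]] nabla_psi[OF t] spinor_diff_class[OF s_fibre[OF x]] c hess_def
    by (simp add: algebra_simps)
qed

text \<open>The sum over the cyclic permutations in the Clifford-contracted curvature.\<close>

definition curv_sum :: "(real^3 \<Rightarrow> complex poly \<Rightarrow> complex poly) \<Rightarrow> complex poly" where
  "curv_sum F = F (ecoord 1) (hess 2 3 - hess 3 2) + F (ecoord 2) (hess 3 1 - hess 1 3) + F (ecoord 3) (hess 1 2 - hess 2 1)"

text \<open>An odd permutation contributes the same as the cyclic one with its last two indices
  exchanged, since the curvature is skew; hence the factor \<open>2\<close>.\<close>

lemma clifford_curvature_class:
  assumes F: "clifford_map m m' F" and fn: "frame_near M x = e"
  shows "clifford_curvature M m F \<psi> x = spinor_class M m' (s x) (smult 2 (curv_sum F))"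
proof -
  note eq = clifford_map_facts(2)[OF F]
  note neg = clifford_map_diff[OF F]
  have two: "coeff (2 * p) n = 2 * coeff p n" for p :: "complex poly" and n
    by (simp only: mult_2 coeff_add)
  have b: "bundle_map M F (e i x) (spinor_class M m (s x) p) = spinor_class M m' (s x) (F (ecoord i) p)"
    if "p \<in> V_space m" for i p
    using bundle_map_class[OF s_fibre[OF x] that eq, of "ecoord i"] by (simp add: frame_coord_works[OF x frame_facts(3)[OF x]])
  have "clifford_curvature M m F \<psi> x = spinor_class M m' (s x) (\<Sum>\<sigma> | \<sigma> permutes (UNIV :: 3 set).
     smult (of_int (sign \<sigma>)) (F (ecoord (\<sigma> 1)) (hess (\<sigma> 2) (\<sigma> 3) - hess (\<sigma> 3) (\<sigma> 2))))"
    unfolding clifford_curvature_def fn Let_def curvature_class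
    by (simp only: b[OF V_space_diff[OF hess_V_space hess_V_space]] spinor_scale_class)
      (rule spinor_sum_class[OF s_fibre[OF x]], use permutes_id in blast)
  also have "(\<Sum>\<sigma> | \<sigma> permutes (UNIV :: 3 set).
     smult (of_int (sign \<sigma>)) (F (ecoord (\<sigma> 1)) (hess (\<sigma> 2) (\<sigma> 3) - hess (\<sigma> 3) (\<sigma> 2)))) = smult 2 (curv_sum F)"
    unfolding sum_permutations_3 curv_sum_def neg
    by (rule poly_eqI) (simp add: two sign_swap_id permutation_swap_id sign_compose sign_id Transposition.transpose_def algebra_simps)
  finally show ?thesis .
qed

text \<open>The cross product of two frame vectors is, up to sign, the third one, so this
  contraction retains only the skew part of the second derivative.\<close>

lemma sum_cross3_hess:
  assumes F: "clifford_map m m' F"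
  shows "(\<Sum>i\<in>UNIV. \<Sum>j\<in>UNIV. F (cross3 (ecoord i) (ecoord j)) (hess i j)) = curv_sum F"
proof -
  note neg = clifford_map_diff[OF F]
  have c: "cross3 (ecoord 2) (ecoord 1) = - ecoord 3" "cross3 (ecoord 3) (ecoord 2) = - ecoord 1" "cross3 (ecoord 1) (ecoord 3) = - ecoord 2"
    using ecoord_rotation(2-4) cross_skew by metis+
  show ?thesis
    unfolding sum_3 c ecoord_rotation(2-4) cross_refl clifford_map_add_vec(3,5)[OF F] curv_sum_def neg by simp
qed

lemma sum_inner_hess: "(\<Sum>i\<in>UNIV. \<Sum>j\<in>UNIV. smult (of_real (ecoord i \<bullet> ecoord j)) (hess i j)) = (\<Sum>i\<in>UNIV. hess i i)"
  unfolding ecoord_rotation(1) by (simp add: sum_3)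

text \<open>In each of the four combinations the Clifford relations replace the product of two
  Clifford homomorphisms by an inner product, absent in the last two combinations, and a cross
  product. The contraction of the inner product with \<open>hess\<close> is the trace, hence
  minus the connection Laplacian; that of the cross product is the curvature term.\<close>

lemma weitzenboeck_local:
  assumes fn: "frame_near M x = e"
  shows "spinor_add (D0 M m (D0 M m \<psi>) x) (D_plus M (m - 2) (D_minus M m \<psi>) x)
      = spinor_add (spinor_scale (of_int m ^ 2) (conn_laplacian M m \<psi> x))
                   (spinor_scale (of_int m / 2) (R0 M m \<psi> x))" (is ?G1)
    and "spinor_add (D0 M m (D0 M m \<psi>) x) (D_minus M (m + 2) (D_plus M m \<psi>) x)
      = spinor_diff (spinor_scale (of_int (m + 2) ^ 2) (conn_laplacian M m \<psi> x))
                    (spinor_scale (of_int (m + 2) / 2) (R0 M m \<psi> x))" (is ?G2)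
    and "spinor_diff (D0 M (m + 2) (D_plus M m \<psi>) x) (D_plus M m (D0 M m \<psi>) x)
      = spinor_scale (of_int (m + 2) / 2) (R_plus M m \<psi> x)" (is ?G3)
    and "spinor_diff (D0 M (m - 2) (D_minus M m \<psi>) x) (D_minus M m (D0 M m \<psi>) x)
      = spinor_scale (- (of_int m / 2)) (R_minus M m \<psi> x)" (is ?G4)
proof -
  note sx = s_fibre[OF x]
  note c0 = clifford_map_rho0 and cp = clifford_map_rho_plus and cm = clifford_map_rho_minus
  have cp': "clifford_map (m - 2) m (rho_plus (m - 2))" using cp[of "m - 2"] by simp
  have cm': "clifford_map (m + 2) m (rho_minus (m + 2))" using cm[of "m + 2"] by simp
  note S = D0_def D_plus_def D_minus_def R0_def R_plus_def R_minus_def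
    dirac_dirac_class[OF c0 c0] dirac_dirac_class[OF cm cp'] dirac_dirac_class[OF cp cm']
    dirac_dirac_class[OF cp c0] dirac_dirac_class[OF c0 cp] dirac_dirac_class[OF cm c0] dirac_dirac_class[OF c0 cm]
    conn_laplacian_class[OF fn] clifford_curvature_class[OF c0 fn] clifford_curvature_class[OF cp fn]
    clifford_curvature_class[OF cm fn] spinor_add_class[OF sx] spinor_diff_class[OF sx] spinor_scale_class
  have sm: "(\<Sum>i\<in>UNIV. \<Sum>j\<in>UNIV. smult r (f i j)) = smult r (\<Sum>i\<in>UNIV. \<Sum>j\<in>UNIV. f i j)"
    for r and f :: "3 \<Rightarrow> 3 \<Rightarrow> complex poly"
    by (simp only: smult_sum_right)
  have h: "smult (r / 2) (smult 2 p) = smult r p" for r and p :: "complex poly" by simp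
  have 1: "(\<Sum>i\<in>UNIV. \<Sum>j\<in>UNIV. rho0 m (ecoord i) (rho0 m (ecoord j) (hess i j)))
     + (\<Sum>i\<in>UNIV. \<Sum>j\<in>UNIV. rho_plus (m - 2) (ecoord i) (rho_minus m (ecoord j) (hess i j)))
     = smult (- (of_int m)\<^sup>2) (\<Sum>i\<in>UNIV. hess i i) + smult (of_int m) (curv_sum (rho0 m))"
    unfolding sum.distrib[symmetric] clifford_relation_minus_plus[OF hess_V_space]
    unfolding sum.distrib smult_smult[symmetric] sm sum_cross3_hess[OF c0] sum_inner_hess ..
  have 2: "(\<Sum>i\<in>UNIV. \<Sum>j\<in>UNIV. rho0 m (ecoord i) (rho0 m (ecoord j) (hess i j)))
     + (\<Sum>i\<in>UNIV. \<Sum>j\<in>UNIV. rho_minus (m + 2) (ecoord i) (rho_plus m (ecoord j) (hess i j)))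
     = smult (- (of_int (m + 2))\<^sup>2) (\<Sum>i\<in>UNIV. hess i i) - smult (of_int (m + 2)) (curv_sum (rho0 m))"
    unfolding sum.distrib[symmetric] clifford_relation_plus_minus[OF hess_V_space]
    unfolding sum_subtractf smult_smult[symmetric] sm sum_cross3_hess[OF c0] sum_inner_hess ..
  have 3: "(\<Sum>i\<in>UNIV. \<Sum>j\<in>UNIV. rho0 (m + 2) (ecoord i) (rho_plus m (ecoord j) (hess i j)))
     - (\<Sum>i\<in>UNIV. \<Sum>j\<in>UNIV. rho_plus m (ecoord i) (rho0 m (ecoord j) (hess i j)))
     = smult (of_int (m + 2)) (curv_sum (rho_plus m))"
    unfolding sum_subtractf[symmetric] clifford_relation_plus[OF hess_V_space]
    unfolding sm sum_cross3_hess[OF cp] ..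
  have 4: "(\<Sum>i\<in>UNIV. \<Sum>j\<in>UNIV. rho0 (m - 2) (ecoord i) (rho_minus m (ecoord j) (hess i j)))
     - (\<Sum>i\<in>UNIV. \<Sum>j\<in>UNIV. rho_minus m (ecoord i) (rho0 m (ecoord j) (hess i j)))
     = smult (- of_int m) (curv_sum (rho_minus m))"
    unfolding sum_subtractf[symmetric] clifford_relation_minus[OF hess_V_space]
    unfolding sm sum_cross3_hess[OF cm] ..
  show ?G1 ?G2 ?G3 ?G4
    unfolding S 1 2 3 4 h by simp_all
qed

end

end

lemma spin_patch_subset:
  assumes "spin_patch M W s" "openin (base M) V" "V \<subseteq> W"
  shows "spin_patch M V s"
proof -
  interpret spin_patch M W s by fact
  have "smooth_fun M (V \<inter> A) (spin_transition M r s)" if "(A, r) \<in> spin_atlas M" for A r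
  proof -
    have "smooth_fun M (W \<inter> A) (spin_transition M r s)" using sect that by (auto simp: spin_section_def)
    then show ?thesis by (rule smooth_fun_subset) (use assms(3) in auto)
  qed
  then have "spin_section M V s" using sect assms(2,3) by (auto simp: spin_section_def)
  then show ?thesis by unfold_locales (use smooth_vfield_subset[OF frame_smooth assms(3)] in auto)
qed

lemma (in spin_manifold) ex_spin_patch:
  assumes "x \<in> topspace (base M)"
  obtains W s where "spin_patch M W s" "x \<in> W"
proof -
  obtain A r where Ar: "(A, r) \<in> spin_atlas M" "x \<in> A"
    and A: "openin (base M) A" "\<forall>y\<in>A. r y \<in> spin_fibre M y"
    by (rule spin_atlas_near[OF assms])
  have tr: "\<forall>(U, s)\<in>spin_atlas M. \<forall>(W, t)\<in>spin_atlas M. smooth_fun M (U \<inter> W) (spin_transition M s t)"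
    using principal unfolding principal_SU2_bundle_def by (elim conjE)
  have "smooth_fun M (A \<inter> B) (spin_transition M q r)" if "(B, q) \<in> spin_atlas M" for B q
  proof -
    have "smooth_fun M (B \<inter> A) (spin_transition M q r)" using tr that Ar(1) by fastforce
    then show ?thesis by (simp add: Int_commute)
  qed
  then have sect: "spin_section M A r" using A by (auto simp: spin_section_def)
  have "\<forall>(U, s)\<in>spin_atlas M. \<forall>i. smooth_vfield M U (\<lambda>x. spin_frame M (s x) i)"
    using spin unfolding spin_structure_def by (elim conjE)
  then have fs: "smooth_vfield M A (\<lambda>x. spin_frame M (r x) i)" for i using Ar(1) by auto
  have "spin_patch M A r" by unfold_locales (fact sect fs)+
  then show ?thesis using that Ar(2) by blast
qed

theorem theorem4p3:
  fixes M :: "('a, 'p) spin3" and m :: int and \<psi> :: "'a \<Rightarrow> 'p spinor"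
  assumes "oriented_manifold3 M" and "riemannian_metric M" and "levi_civita M"
    and "spin_structure M"
    and "m \<ge> 0"
    and "\<psi> \<in> spinor_fields M m"
  shows "\<forall>x\<in>topspace (base M).
    spinor_add (D0 M m (D0 M m \<psi>) x) (D_plus M (m - 2) (D_minus M m \<psi>) x)
      = spinor_add (spinor_scale (of_int m ^ 2) (conn_laplacian M m \<psi> x))
                   (spinor_scale (of_int m / 2) (R0 M m \<psi> x)) \<and>
    spinor_add (D0 M m (D0 M m \<psi>) x) (D_minus M (m + 2) (D_plus M m \<psi>) x)
      = spinor_diff (spinor_scale (of_int (m + 2) ^ 2) (conn_laplacian M m \<psi> x))
                    (spinor_scale (of_int (m + 2) / 2) (R0 M m \<psi> x)) \<and>
    spinor_diff (D0 M (m + 2) (D_plus M m \<psi>) x) (D_plus M m (D0 M m \<psi>) x)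
      = spinor_scale (of_int (m + 2) / 2) (R_plus M m \<psi> x) \<and>
    spinor_diff (D0 M (m - 2) (D_minus M m \<psi>) x) (D_minus M m (D0 M m \<psi>) x)
      = spinor_scale (- (of_int m / 2)) (R_minus M m \<psi> x)"
proof (intro ballI, goal_cases)
  case (1 x)
  note x = this
  interpret spin_manifold M by unfold_locales (fact assms)+
  obtain A s where A: "spin_patch M A s" "x \<in> A" by (rule ex_spin_patch[OF x])
  obtain U where U: "x \<in> U" "local_onframe M U (frame_near M x)"
    by (rule spin_patch.frame_near_onframe[OF A])
  \<comment> \<open>a section and the frame used by the operators at \<open>x\<close>, on a common neighbourhood\<close>
  define W where "W = A \<inter> U"
  have oU: "openin (base M) U" using U(2) by (simp add: local_onframe_def)
  have oW: "openin (base M) W" unfolding W_def by (intro openin_Int spin_patch.W[OF A(1)] oU)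
  interpret P: spin_patch M W s
    by (rule spin_patch_subset[OF A(1) oW]) (simp add: W_def)
  have xW: "x \<in> W" using A(2) U(1) by (simp add: W_def)
  have e: "local_onframe M W (frame_near M x)"
    using U(2) oW smooth_vfield_subset[of U _ W] unfolding local_onframe_def W_def by auto
  let ?g = "spinor_coord s \<psi>"
  have g: "?g y \<in> V_space m \<and> \<psi> y = spinor_class M m (s y) (?g y)" if y: "y \<in> W" for y
  proof -
    have "\<psi> y \<in> spinor_fibre M m y" using assms(6) P.W_top[OF y] by (simp add: spinor_fields_def)
    then obtain v where v: "v \<in> V_space m" "\<psi> y = spinor_class M m (s y) v"
      by (rule spinor_fibreE[OF _ P.s_fibre[OF y]])
    have "?g y = v" unfolding spinor_coord_def v(2)
      by (rule the_equality) (simp_all add: spinor_class_base_iff[OF P.s_fibre[OF y] v(1)])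
    then show ?thesis using v by simp
  qed
  have fg: "field_on W m ?g"
  proof -
    have "\<forall>U s. spin_section M U s \<longrightarrow> (\<forall>k. smooth_fun M U (\<lambda>x. coeff (spinor_coord s \<psi> x) k))"
      using assms(6) unfolding spinor_fields_def by (elim CollectE conjE)
    then have "smooth_fun M W (\<lambda>y. coeff (?g y) n)" for n using P.sect by (simp only: simp_thms)
    then show ?thesis unfolding field_on_def by (intro conjI ballI allI g[THEN conjunct1])
  qed
  show ?case
    by (intro conjI; rule P.weitzenboeck_local[OF fg _ e xW refl]; simp only: g)
qed

end
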